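(* Let $g\ge 0$ and $n\ge 1$ be integers. The opening $\phi$ is a bijection between (i) pointed bipartite quadrangulations $(\mathfrak q,v_0)$ of genus $g$ that have $n$ faces, $2n$ edges, and $n+2-2g$ vertices ($i$ of which are at odd distance from the basepoint $v_0$), and (ii) well labeled $g$-trees that have $n$ edges and $n+1-2g$ vertices ($i$ of them having odd labels), such that the labels of the $g$-tree $\phi(\mathfrak q,v_0)$ associated to a bipartite quadrangulation $\mathfrak q$ with basepoint $v_0$ give the distances of the vertices of $\mathfrak q$ to $v_0$ (the vertices of $\phi(\mathfrak q,v_0)$ being the vertices of $\mathfrak q$ other than $v_0$).
   Context: $\mathcal S_g$ is the compact oriented surface of genus $g$ without boundary. A graph drawing on $\mathcal S_g$ is an embedding (without edge crossings) of a graph into $\mathcal S_g$; loops and multiple edges are allowed. A map of genus $g$ is a graph drawing on $\mathcal S_g$ each of whose faces (connected components of the complement) is homeomorphic to a disc. Maps are considered up to orientation-preserving homeomorphisms of $\mathcal S_g$ (carrying basepoints and labels). The degree of a face is the number of edges incident to it, an edge incident to it on both sides counting twice. A quadrangulation of genus $g$ is a map of genus $g$ all of whose faces have degree 4; it is bipartite if its vertices can be colored black and white so that adjacent vertices have different colors (the choice of colors is not counted as extra structure here). A pointed quadrangulation is a pair $(\mathfrak q,v_0)$ with $v_0$ a vertex of $\mathfrak q$, the basepoint. A $g$-tree is a map of genus $g$ with exactly one face. A map is well labeled if its vertices carry integer labels that differ by at most one along every edge, and the minimum label is $1$. Opening: given a pointed bipartite quadrangulation $(\mathfrak q,v_0)$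 of genus $g$, label each vertex by its graph distance to $v_0$. Labels of adjacent vertices differ by exactly one, so the labels read clockwise around a face form a cycle $(i-1,i,i-1,i)$ or $(i-1,i,i+1,i)$ for some $i\ge1$. The graph drawing $\phi(\mathfrak q,v_0)$ on $\mathcal S_g$ has as vertices all vertices of $\mathfrak q$ except $v_0$ (with their distance labels) and one edge $e_f$ for each face $f$ of $\mathfrak q$, drawn inside $f$ and connecting the two corners of $f$ whose label is larger than the label of the corner immediately preceding them in clockwise direction around $f$: in a face $(i-1,i,i-1,i)$ this edge joins the two corners labeled $i$; in a face $(i-1,i,i+1,i)$ (clockwise) it joins the corner labeled $i$ that follows the corner $i-1$ to the corner labeled $i+1$. *)

theory Defs
  imports
    "Graph_Theory.Digraph_Isomorphism"
    "Graph_Theory.Bidirected_Digraph"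
    "HOL-Combinatorics.Orbits"
begin

section \<open>Graph drawings as rotation systems\<close>

text \<open>
  A map on a compact oriented surface, up to orientation-preserving homeomorphism, is encoded by
  its rotation system. Every edge contributes two mutually opposite arcs (half-edges), so that
  loops and multiple edges are allowed. \<open>opp M\<close> exchanges the two arcs of an edge, and \<open>rot M a\<close> is
  the arc following \<open>a\<close> in counterclockwise order around the tail of \<open>a\<close>.
  Vertices are kept separately from the arcs, so a drawing may have isolated vertices; these carry
  no face here, so that the one-vertex map without edges is not represented correctly.
\<close>

record ('v, 'a) drawing =
  graph :: "('v, 'a) pre_digraph"
  opp :: "'a \<Rightarrow> 'a"
  rot :: "'a \<Rightarrow> 'a"

definition rotation_system :: "('v, 'a) drawing \<Rightarrow> bool" where
  "rotation_system M \<longleftrightarrow>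
     fin_digraph (graph M) \<and> bidirected_digraph (graph M) (opp M) \<and>
     rot M permutes arcs (graph M) \<and>
     (\<forall>v\<in>verts (graph M). out_arcs (graph M) v \<noteq> {} \<longrightarrow> cyclic_on (rot M) (out_arcs (graph M) v))"

definition edges :: "('v, 'a) drawing \<Rightarrow> 'a set set" where
  "edges M = (\<lambda>a. {a, opp M a}) ` arcs (graph M)"

text \<open>
  Arriving at a vertex along \<open>a\<close> and leaving along the arc that follows \<open>opp M a\<close> counterclockwise
  means turning right as sharply as possible. Hence \<open>face_succ M\<close> runs along the boundary of the
  face lying to the right of \<open>a\<close>, which is the clockwise direction around that face. An orbit of
  \<open>face_succ M\<close> contains an edge twice if the face is incident to it on both sides, so its
  cardinality is the degree of the face.

  An arc \<open>a\<close> also stands for a corner, namely the sector between the counterclockwise predecessor of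
  \<open>a\<close> and \<open>a\<close> itself. This corner lies at the tail of \<open>a\<close> in the face to the right of \<open>a\<close>; the
  following corner clockwise around this face is that of \<open>face_succ M a\<close>, and the
  following corner counterclockwise around the vertex is that of \<open>rot M a\<close>.
\<close>

definition face_succ :: "('v, 'a) drawing \<Rightarrow> 'a \<Rightarrow> 'a" where
  "face_succ M a = rot M (opp M a)"

definition faces :: "('v, 'a) drawing \<Rightarrow> 'a set set" where
  "faces M = (\<lambda>a. orbit (face_succ M) a) ` arcs (graph M)"

definition map_of_genus :: "nat \<Rightarrow> ('v, 'a) drawing \<Rightarrow> bool" where
  "map_of_genus g M \<longleftrightarrow>
     rotation_system M \<and> connected (graph M) \<and>
     int (card (verts (graph M))) - int (card (edges M)) + int (card (faces M)) = 2 - 2 * int g"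

definition quadrangulation :: "nat \<Rightarrow> ('v, 'a) drawing \<Rightarrow> bool" where
  "quadrangulation g M \<longleftrightarrow> map_of_genus g M \<and> (\<forall>F\<in>faces M. card F = 4)"

definition bipartite :: "('v, 'a) drawing \<Rightarrow> bool" where
  "bipartite M \<longleftrightarrow>
     (\<exists>color :: 'v \<Rightarrow> bool.
        \<forall>a\<in>arcs (graph M). color (tail (graph M) a) \<noteq> color (head (graph M) a))"

definition g_tree :: "nat \<Rightarrow> ('v, 'a) drawing \<Rightarrow> bool" where
  "g_tree g M \<longleftrightarrow> map_of_genus g M \<and> card (faces M) = 1"

definition well_labeled :: "('v, 'a) drawing \<Rightarrow> ('v \<Rightarrow> int) \<Rightarrow> bool" where
  "well_labeled M l \<longleftrightarrow>
     (\<forall>a\<in>arcs (graph M). \<bar>l (tail (graph M) a) - l (head (graph M) a)\<bar> \<le> 1) \<and>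
     Min (l ` verts (graph M)) = 1"

definition graph_dist :: "('v, 'a) drawing \<Rightarrow> 'v \<Rightarrow> 'v \<Rightarrow> nat" where
  "graph_dist M u v = (LEAST k. \<exists>p. pre_digraph.awalk (graph M) u p v \<and> length p = k)"


section \<open>Isomorphism\<close>

text \<open>
  Since isomorphisms commute with \<open>rot\<close>, they correspond to orientation-preserving homeomorphisms.
\<close>

definition drawing_isomorphism ::
    "('v, 'a, 'w, 'b) digraph_isomorphism \<Rightarrow> ('v, 'a) drawing \<Rightarrow> ('w, 'b) drawing \<Rightarrow> bool" where
  "drawing_isomorphism f M N \<longleftrightarrow>
     rotation_system M \<and> rotation_system N \<and>
     pre_digraph.digraph_isomorphism (graph M) f \<and> graph N = app_iso f (graph M) \<and>
     (\<forall>a\<in>arcs (graph M).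
        iso_arcs f (opp M a) = opp N (iso_arcs f a) \<and> iso_arcs f (rot M a) = rot N (iso_arcs f a))"

definition pointed_equiv ::
    "((('v, 'a) drawing \<times> 'v) \<times> (('v, 'a) drawing \<times> 'v)) set" where
  "pointed_equiv =
     {((M, v), (N, w)).
        v \<in> verts (graph M) \<and> (\<exists>f. drawing_isomorphism f M N \<and> iso_verts f v = w)}"

definition labeled_equiv ::
    "((('v, 'a) drawing \<times> ('v \<Rightarrow> int)) \<times> (('v, 'a) drawing \<times> ('v \<Rightarrow> int))) set" where
  "labeled_equiv =
     {((M, l), (N, k)).
        \<exists>f. drawing_isomorphism f M N \<and> (\<forall>v\<in>verts (graph M). k (iso_verts f v) = l v)}"


section \<open>Pointed bipartite quadrangulations and well labeled trees\<close>

text \<open>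
  Vertices and arcs are named by natural numbers, so that the objects up to isomorphism form a
  set: every finite drawing is isomorphic to one of this kind, and the names are
  irrelevant modulo \<open>pointed_equiv\<close> and \<open>labeled_equiv\<close>.
\<close>

definition pointed_bipartite_quadrangulations :: "nat \<Rightarrow> nat \<Rightarrow> ((nat, nat) drawing \<times> nat) set" where
  "pointed_bipartite_quadrangulations g n =
     {(q, v\<^sub>0). quadrangulation g q \<and> bipartite q \<and> v\<^sub>0 \<in> verts (graph q) \<and>
        card (faces q) = n \<and> card (edges q) = 2 * n \<and>
        int (card (verts (graph q))) = int n + 2 - 2 * int g}"

definition odd_distance_vertices :: "('v, 'a) drawing \<times> 'v \<Rightarrow> 'v set" where
  "odd_distance_vertices = (\<lambda>(q, v\<^sub>0). {v \<in> verts (graph q). odd (graph_dist q v\<^sub>0 v)})"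

definition well_labeled_trees :: "nat \<Rightarrow> nat \<Rightarrow> ((nat, nat) drawing \<times> (nat \<Rightarrow> int)) set" where
  "well_labeled_trees g n =
     {(t, l). g_tree g t \<and> well_labeled t l \<and>
        card (edges t) = n \<and> int (card (verts (graph t))) = int n + 1 - 2 * int g}"

definition odd_label_vertices :: "('v, 'a) drawing \<times> ('v \<Rightarrow> int) \<Rightarrow> 'v set" where
  "odd_label_vertices = (\<lambda>(t, l). {v \<in> verts (graph t). odd (l v)})"


section \<open>Opening\<close>

text \<open>
  The corners of \<open>q\<close> whose label exceeds that of the clockwise preceding corner. They serve as the
  arcs of the opened drawing: the arc named \<open>a\<close> is the half of the new edge that starts in
  corner \<open>a\<close>.
\<close>

definition opening_corners :: "('v, 'a) drawing \<Rightarrow> 'v \<Rightarrow> 'a set" where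
  "opening_corners q v\<^sub>0 =
     {a \<in> arcs (graph q).
        graph_dist q v\<^sub>0 (tail (graph q) (inv (face_succ q) a)) < graph_dist q v\<^sub>0 (tail (graph q) a)}"

text \<open>
  The new edge inside a face joins the two selected corners of that face.
\<close>

definition opening_opp :: "('v, 'a) drawing \<Rightarrow> 'v \<Rightarrow> 'a \<Rightarrow> 'a" where
  "opening_opp q v\<^sub>0 =
     perm_restrict
       (\<lambda>a. THE b. b \<in> opening_corners q v\<^sub>0 \<and> b \<in> orbit (face_succ q) a \<and> b \<noteq> a)
       (opening_corners q v\<^sub>0)"

text \<open>
  Around a vertex, the new edges leave in the counterclockwise order of the selected corners
  (a corner contains at most one end of a new edge): go to the next selected corner.
\<close>

definition opening_rot :: "('v, 'a) drawing \<Rightarrow> 'v \<Rightarrow> 'a \<Rightarrow> 'a" where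
  "opening_rot q v\<^sub>0 =
     perm_restrict
       (\<lambda>a. (rot q ^^ (LEAST k. 0 < k \<and> (rot q ^^ k) a \<in> opening_corners q v\<^sub>0)) a)
       (opening_corners q v\<^sub>0)"

definition opening_drawing :: "('v, 'a) drawing \<Rightarrow> 'v \<Rightarrow> ('v, 'a) drawing" where
  "opening_drawing q v\<^sub>0 =
     \<lparr> graph =
         \<lparr> verts = verts (graph q) - {v\<^sub>0},
           arcs = opening_corners q v\<^sub>0,
           tail = tail (graph q),
           head = (\<lambda>a. tail (graph q) (opening_opp q v\<^sub>0 a)) \<rparr>,
       opp = opening_opp q v\<^sub>0,
       rot = opening_rot q v\<^sub>0 \<rparr>"

definition quad_opening :: "('v, 'a) drawing \<times> 'v \<Rightarrow> ('v, 'a) drawing \<times> ('v \<Rightarrow> int)" where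
  "quad_opening = (\<lambda>(q, v\<^sub>0). (opening_drawing q v\<^sub>0, \<lambda>v. int (graph_dist q v\<^sub>0 v)))"

text \<open>
  The operation induced on isomorphism classes.
\<close>

definition opening_class ::
    "(('v, 'a) drawing \<times> 'v) set \<Rightarrow> (('v, 'a) drawing \<times> ('v \<Rightarrow> int)) set" where
  "opening_class C = labeled_equiv `` (quad_opening ` C)"

end

theory Submission
  imports Defs
begin

text \<open>
  Label the vertices of a pointed bipartite quadrangulation by their distance to the basepoint. Every
  edge then joins consecutive labels, so every arc either rises or falls, and every face has two
  rises and two falls. A selected corner is one that a rising arc leads into, and also one that follows
  a falling arc counterclockwise around its vertex. Hence each edge of the quadrangulation has exactly
  one selected corner at its upper end, and the arcs of the opened drawing correspond to the edges of
  the quadrangulation.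

  Under this correspondence the edge of the quadrangulation that belongs to a corner \<open>b\<close> of the opened
  drawing, with label at least 2, runs to the first corner with a smaller label that follows \<open>b\<close> along the
  contour of the face (\<open>descends_kappa\<close>). The proof goes through the faces between two neighbouring
  rising arcs at the same vertex: their corners are consecutive visits of the contour to the same
  label, with only larger labels in between (\<open>returns_neighbour\<close>). Two consequences carry the first
  half of the theorem. Following these edges downwards, every contour contains a corner of label 1;
  and turning around the basepoint, all corners of label 1 lie on the same contour. So the opened
  drawing has one face, is connected, and its genus can be read off from the numbers of vertices and
  edges (\<open>opening_well_labeled_tree\<close>).

  For the bijection, an arc of the quadrangulation is encoded by its direction, rising or falling, and
  the corner of the opened drawing that belongs to its edge. In this encoding the clockwise step
  along a face becomes a function \<open>closing_step\<close> of the opened drawing and its labels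
  alone (\<open>code_face_succ\<close>). An isomorphism between two opened drawings therefore lifts to the
  quadrangulations (\<open>iso_of_opening_iso\<close>), which is injectivity. For surjectivity, the same function
  serves as a definition: on the corners of a well labeled one-face map, each taken twice, it is a
  permutation all of whose cycles have length 4 (\<open>step_four\<close>, \<open>step_two\<close>). The resulting drawing is a
  quadrangulation, its distances are the given labels, and opening it gives back the map it
  was built from (\<open>opening_closing\<close>).
\<close>

section \<open>First returns of a permutation\<close>

definition first_return :: "('a \<Rightarrow> 'a) \<Rightarrow> 'a set \<Rightarrow> 'a \<Rightarrow> 'a" where
  "first_return f S a = (f ^^ (LEAST k. 0 < k \<and> (f ^^ k) a \<in> S)) a"

lemma first_return_eqI:
  assumes "0 < k" "(f ^^ k) a = b" "b \<in> S" "\<And>j. 0 < j \<Longrightarrow> j < k \<Longrightarrow> (f ^^ j) a \<notin> S"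
  shows "first_return f S a = b"
proof -
  have "(LEAST k. 0 < k \<and> (f ^^ k) a \<in> S) = k"
    using assms by (intro Least_equality) (auto simp: not_less[symmetric])
  then show ?thesis using assms by (simp add: first_return_def)
qed

lemma first_returnE:
  assumes "b \<in> S" "b \<in> orbit f a"
  obtains k where "0 < k" "first_return f S a = (f ^^ k) a" "(f ^^ k) a \<in> S"
    "\<forall>j. 0 < j \<and> j < k \<longrightarrow> (f ^^ j) a \<notin> S"
proof -
  define k where "k = (LEAST k. 0 < k \<and> (f ^^ k) a \<in> S)"
  have "\<exists>k. 0 < k \<and> (f ^^ k) a \<in> S"
    using assms by (auto simp: orbit_altdef)
  then have k: "0 < k \<and> (f ^^ k) a \<in> S"
    unfolding k_def by (rule LeastI_ex)
  show thesis
  proof (rule that)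
    show "0 < k" "(f ^^ k) a \<in> S" using k by auto
    show "first_return f S a = (f ^^ k) a" by (simp add: first_return_def k_def)
    show "\<forall>j. 0 < j \<and> j < k \<longrightarrow> (f ^^ j) a \<notin> S"
      using not_less_Least[of _ "\<lambda>k. 0 < k \<and> (f ^^ k) a \<in> S"] by (auto simp: k_def)
  qed
qed

lemma first_return_step_in: "f a \<in> S \<Longrightarrow> first_return f S a = f a"
  by (rule first_return_eqI[of 1]) auto

lemma first_return_step_out:
  assumes "f a \<notin> S" "b \<in> S" "b \<in> orbit f a"
  shows "first_return f S a = first_return f S (f a)"
proof -
  obtain k where k: "0 < k" "first_return f S a = (f ^^ k) a" "(f ^^ k) a \<in> S"
    "\<forall>j. 0 < j \<and> j < k \<longrightarrow> (f ^^ j) a \<notin> S"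
    by (rule first_returnE[OF assms(2,3)])
  obtain m where m: "k = Suc m" using k(1) by (cases k) auto
  have "m \<noteq> 0" using k(3) assms(1) m by (cases m) auto
  have "first_return f S (f a) = (f ^^ k) a"
  proof (rule first_return_eqI[of m])
    show "0 < m" using \<open>m \<noteq> 0\<close> by simp
    show "(f ^^ m) (f a) = (f ^^ k) a" by (simp add: m funpow_swap1)
    show "(f ^^ j) (f a) \<notin> S" if "0 < j" "j < m" for j
      using k(4)[rule_format, of "Suc j"] that by (simp add: m funpow_swap1)
  qed (rule k(3))
  then show ?thesis using k(2) by simp
qed

text \<open>
  Each visit to \<open>S\<close> on the way from \<open>a\<close> to \<open>b\<close> is one step of the first return map.
\<close>
lemma orbit_first_return:
  assumes "b \<in> S" "b \<in> orbit f a"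
  shows "b \<in> orbit (first_return f S) a"
proof -
  have "0 < n \<Longrightarrow> (f ^^ n) a = b \<Longrightarrow> b \<in> orbit (first_return f S) a" for n
  proof (induction n arbitrary: a rule: less_induct)
    case (less n)
    then have "b \<in> orbit f a" by (auto simp: orbit_altdef)
    then obtain k where k: "0 < k" "first_return f S a = (f ^^ k) a" "(f ^^ k) a \<in> S"
      "\<forall>j. 0 < j \<and> j < k \<longrightarrow> (f ^^ j) a \<notin> S"
      using first_returnE[OF assms(1)] by metis
    have "k \<le> n" using k(4)[rule_format, of n] less.prems assms(1) by (meson not_le)
    show ?case
    proof (cases "k = n")
      case True
      then show ?thesis using k(2) less.prems by (metis orbit.base)
    next
      case False
      have "(f ^^ (n - k)) ((f ^^ k) a) = b"
        using less.prems \<open>k \<le> n\<close> by (metis funpow_add le_add_diff_inverse2 o_apply)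
      then have "b \<in> orbit (first_return f S) (first_return f S a)"
        using less.IH[of "n - k" "(f ^^ k) a"] False \<open>k \<le> n\<close> k(1,2) by simp
      then show ?thesis by (rule orbit_subset)
    qed
  qed
  then show ?thesis using assms(2) by (auto simp: orbit_altdef)
qed

lemma cyclic_on_first_return:
  assumes "cyclic_on f C" "C \<inter> S \<noteq> {}"
  shows "cyclic_on (first_return f S) (C \<inter> S)"
proof -
  obtain s where s: "s \<in> C" "s \<in> S" using assms(2) by auto
  have orb: "orbit f x = C" if "x \<in> C" for x
    using assms(1) that by (rule orbit_cyclic_eq3)
  have "C \<inter> S \<subseteq> orbit (first_return f S) s"
    using orb[OF s(1)] by (auto intro: orbit_first_return)
  moreover have ret: "first_return f S x \<in> C \<inter> S" if x: "x \<in> C" for x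
  proof -
    obtain k where "0 < k" "first_return f S x = (f ^^ k) x" "(f ^^ k) x \<in> S"
      using first_returnE[OF s(2), of f x] s(1) unfolding orb[OF x] by blast
    then show ?thesis using cyclic_on_funpow_in[OF assms(1) x] by auto
  qed
  moreover have "x \<in> orbit (first_return f S) s \<Longrightarrow> x \<in> C \<inter> S" for x
    by (induction rule: orbit.induct) (use ret s in auto)
  ultimately show ?thesis using s by (intro cyclic_on_singleI[of s]) auto
qed

text \<open>
  A point of \<open>S\<close> lies on its own \<open>f\<close>-orbit, so going around that orbit once by first returns ends in
  it: the first return map is onto \<open>S\<close>, and \<open>S\<close> is finite.
\<close>
lemma first_return_permutes:
  assumes "f permutes A" "finite A" "S \<subseteq> A"
  shows "perm_restrict (first_return f S) S permutes S"
proof -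
  have perm: "permutation f" using assms by (auto simp: permutation_permutes)
  have self: "a \<in> orbit f a" for a by (rule permutation_self_in_orbit[OF perm])
  have "first_return f S a \<in> S" if "a \<in> S" for a
    using first_returnE[OF that self] by metis
  moreover have "\<exists>x\<in>S. first_return f S x = a" if "a \<in> S" for a
  proof -
    have "x \<in> orbit (first_return f S) a \<Longrightarrow> x \<in> S \<and> (\<exists>y\<in>S. first_return f S y = x)" for x
      by (induction rule: orbit.induct) (use \<open>a \<in> S\<close> calculation in auto)
    then show ?thesis using orbit_first_return[OF that self] by blast
  qed
  ultimately have "first_return f S ` S = S" by auto
  then have "bij_betw (first_return f S) S S"
    using finite_subset[OF assms(3,2)] by (simp add: bij_betw_def eq_card_imp_inj_on)
  then have "bij_betw (perm_restrict (first_return f S) S) S S"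
    by (rule bij_betw_cong[THEN iffD1, rotated]) (simp add: perm_restrict_simps)
  then show ?thesis by (rule bij_imp_permutes) (simp add: perm_restrict_simps)
qed

section \<open>Rotation systems\<close>

locale rotation_drawing =
  fixes M :: "('v, 'a) drawing"
  assumes rotation_system: "rotation_system M"
begin

abbreviation "A \<equiv> arcs (graph M)"
abbreviation "V \<equiv> verts (graph M)"
abbreviation "tl_of \<equiv> tail (graph M)"
abbreviation "hd_of \<equiv> head (graph M)"
abbreviation "\<alpha> \<equiv> opp M"
abbreviation "\<sigma> \<equiv> rot M"
abbreviation "\<phi> \<equiv> face_succ M"

sublocale fin_digraph "graph M"
  using rotation_system by (simp add: rotation_system_def)

sublocale bidirected_digraph "graph M" "opp M"
  using rotation_system by (simp add: rotation_system_def)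

lemma rot_permutes: "\<sigma> permutes A"
  using rotation_system by (simp add: rotation_system_def)

lemma rot_in_arcs[simp]: "\<sigma> a \<in> A \<longleftrightarrow> a \<in> A"
  using permutes_in_image[OF rot_permutes] .

lemma rot_cyclic: "a \<in> A \<Longrightarrow> cyclic_on \<sigma> (out_arcs (graph M) (tl_of a))"
  using rotation_system unfolding rotation_system_def by (metis empty_iff in_out_arcs_conv wellformed(1))

lemma tail_rot[simp]: "a \<in> A \<Longrightarrow> tl_of (\<sigma> a) = tl_of a"
  using cyclic_on_inI[OF rot_cyclic, of a a] by simp

lemma orbit_rot: "a \<in> A \<Longrightarrow> orbit \<sigma> a = {b \<in> A. tl_of b = tl_of a}"
  using orbit_cyclic_eq3[OF rot_cyclic, of a a] by (auto simp: out_arcs_def)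

lemma face_succ_permutes: "\<phi> permutes A"
proof -
  have "\<phi> = \<sigma> \<circ> \<alpha>" by (auto simp: face_succ_def)
  then show ?thesis using permutes_compose[OF arev_permutes_arcs rot_permutes] by simp
qed

lemma face_succ_in_arcs[simp]: "\<phi> a \<in> A \<longleftrightarrow> a \<in> A"
  using permutes_in_image[OF face_succ_permutes] .

lemma permutation_face_succ: "permutation \<phi>"
  using face_succ_permutes finite_arcs by (auto simp: permutation_permutes simp del: finite_arcs)

lemma permutation_rot: "permutation \<sigma>"
  using rot_permutes finite_arcs by (auto simp: permutation_permutes simp del: finite_arcs)

lemma tail_face_succ[simp]: "a \<in> A \<Longrightarrow> tl_of (\<phi> a) = hd_of a"
  by (simp add: face_succ_def)

lemma face_succ_opp[simp]: "\<phi> (\<alpha> a) = \<sigma> a"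
  by (simp add: face_succ_def)

lemma face_in_arcs: "F \<in> faces M \<Longrightarrow> F \<subseteq> A"
  unfolding faces_def using permutes_orbit_subset[OF face_succ_permutes] by auto

lemma Union_faces: "\<Union> (faces M) = A"
proof
  show "\<Union> (faces M) \<subseteq> A" using face_in_arcs by auto
  show "A \<subseteq> \<Union> (faces M)"
    unfolding faces_def using permutation_self_in_orbit[OF permutation_face_succ] by auto
qed

lemma faces_disjoint: "F \<in> faces M \<Longrightarrow> G \<in> faces M \<Longrightarrow> F \<noteq> G \<Longrightarrow> F \<inter> G = {}"
proof (rule ccontr)
  assume F: "F \<in> faces M" "G \<in> faces M" "F \<noteq> G" and "F \<inter> G \<noteq> {}"
  then obtain x where "x \<in> F" "x \<in> G" by auto
  moreover have "cyclic_on \<phi> F" "cyclic_on \<phi> G"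
    using F cyclic_on_orbit'[OF permutation_face_succ] unfolding faces_def by auto
  ultimately have "F = G" using orbit_cyclic_eq3 by metis
  then show False using F by simp
qed

lemma finite_faces[simp]: "finite (faces M)"
  by (simp add: faces_def)

text \<open>
  The faces are the cycles of the face permutation, hence partition the arcs.
\<close>
lemma card_arcs_faces: "(\<And>F. F \<in> faces M \<Longrightarrow> card F = k) \<Longrightarrow> k * card (faces M) = card A"
  using card_partition[of "faces M" k] faces_disjoint by (simp add: Union_faces)

lemma card_arcs_edges: "card A = 2 * card (edges M)"
proof -
  have "2 * card (edges M) = card (\<Union> (edges M))"
  proof (rule card_partition)
    show "finite (edges M)" by (simp add: edges_def)
    show "finite (\<Union> (edges M))" by (auto simp: edges_def)
    show "card c = 2" if "c \<in> edges M" for c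
      using that arev_neq by (fastforce simp: edges_def card_insert_if)
    show "c1 \<inter> c2 = {}" if "c1 \<in> edges M" "c2 \<in> edges M" "c1 \<noteq> c2" for c1 c2
      using that unfolding edges_def by (auto simp: doubleton_eq_iff arev_eq_iff)
  qed
  also have "\<Union> (edges M) = A" by (auto simp: edges_def)
  finally show ?thesis by simp
qed

end

lemma rotation_systemI:
  assumes "finite (verts (graph M))" "finite (arcs (graph M))"
    and "\<And>a. a \<in> arcs (graph M) \<Longrightarrow> tail (graph M) a \<in> verts (graph M)"
    and "\<And>a. a \<notin> arcs (graph M) \<Longrightarrow> opp M a = a"
    and "\<And>a. a \<in> arcs (graph M) \<Longrightarrow> opp M a \<in> arcs (graph M)"
    and "\<And>a. a \<in> arcs (graph M) \<Longrightarrow> opp M a \<noteq> a"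
    and "\<And>a. a \<in> arcs (graph M) \<Longrightarrow> opp M (opp M a) = a"
    and "\<And>a. a \<in> arcs (graph M) \<Longrightarrow> head (graph M) a = tail (graph M) (opp M a)"
    and "rot M permutes arcs (graph M)"
    and "\<And>v. v \<in> verts (graph M) \<Longrightarrow> out_arcs (graph M) v \<noteq> {} \<Longrightarrow>
           cyclic_on (rot M) (out_arcs (graph M) v)"
  shows "rotation_system M"
proof -
  have "wf_digraph (graph M)" using assms by unfold_locales auto
  moreover then have "fin_digraph (graph M)" using assms(1,2)
    by (rule wf_digraph.fin_digraphI)
  ultimately show ?thesis using assms unfolding rotation_system_def
    by (auto intro!: wf_digraph.bidirected_digraphI)
qed

section \<open>Distances to a root\<close>

context rotation_drawing
begin

lemma connectedI_root:
  assumes "r \<in> V" "\<And>v. v \<in> V \<Longrightarrow> r \<rightarrow>\<^sup>*\<^bsub>graph M\<^esub> v"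
  shows "connected (graph M)"
proof -
  have "u \<rightarrow>\<^sup>*\<^bsub>graph M\<^esub> v" if "u \<in> V" "v \<in> V" for u v
    using assms that by (meson symmetric_reachable' reachable_trans)
  then show ?thesis
    unfolding connected_def strongly_connected_def
    using assms(1) reachable_mk_symmetric_eq[OF sym_arcs] by (auto simp: mk_symmetric_def)
qed

lemma connected_reachable:
  assumes "connected (graph M)" "u \<in> V" "v \<in> V"
  shows "u \<rightarrow>\<^sup>*\<^bsub>graph M\<^esub> v"
  using symmetric_connected_imp_strongly_connected[OF sym_arcs assms(1)] assms(2,3) by auto

text \<open>
  The numbers \<open>L\<close> grow by at most one along an arc, so a walk from the root to \<open>v\<close> has at least \<open>L v\<close>
  arcs; going back from \<open>v\<close> along arcs where \<open>L\<close> drops gives a walk with exactly \<open>L v\<close> arcs.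
\<close>
lemma graph_dist_eqI:
  fixes L :: "'v \<Rightarrow> nat"
  assumes root: "r \<in> V" "L r = 0"
    and step: "\<And>a. a \<in> A \<Longrightarrow> L (hd_of a) \<le> Suc (L (tl_of a))"
    and down: "\<And>v. v \<in> V \<Longrightarrow> v \<noteq> r \<Longrightarrow> \<exists>a\<in>A. hd_of a = v \<and> L (tl_of a) < L v"
    and v: "v \<in> V"
  shows "graph_dist M r v = L v" and "r \<rightarrow>\<^sup>*\<^bsub>graph M\<^esub> v"
proof -
  have lower: "awalk u p w \<Longrightarrow> L w \<le> L u + length p" for u p w
  proof (induction p arbitrary: u)
    case (Cons a p)
    then have "a \<in> A" "u = tl_of a" "L w \<le> L (hd_of a) + length p"
      by (auto simp: awalk_simps)
    then show ?case using step[of a] by simp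
  qed (simp add: awalk_simps)
  have "\<exists>p. awalk r p v \<and> length p = L v"
    using v
  proof (induction "L v" arbitrary: v rule: less_induct)
    case less
    show ?case
    proof (cases "v = r")
      case True
      then show ?thesis using root by (intro exI[of _ "[]"]) (simp add: awalk_Nil_iff)
    next
      case False
      then obtain a where a: "a \<in> A" "hd_of a = v" "L (tl_of a) < L v"
        using down less.prems by blast
      then obtain p where "awalk r p (tl_of a)" "length p = L (tl_of a)"
        using less.hyps[of "tl_of a"] by auto
      moreover have "L v = Suc (L (tl_of a))" using step[OF a(1)] a by simp
      moreover have "awalk (tl_of a) [a] v" using arc_implies_awalk[OF a(1)] a by simp
      ultimately show ?thesis
        by (intro exI[of _ "p @ [a]"]) (auto intro: awalk_appendI)
    qed
  qed
  then obtain p where p: "awalk r p v" "length p = L v" by blast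
  show "r \<rightarrow>\<^sup>*\<^bsub>graph M\<^esub> v" using p reachable_awalk by blast
  show "graph_dist M r v = L v"
    unfolding graph_dist_def
  proof (rule Least_equality)
    show "\<exists>p. awalk r p v \<and> length p = L v" using p by blast
    show "L v \<le> k" if "\<exists>p. awalk r p v \<and> length p = k" for k
      using that lower[of r _ v] root(2) by auto
  qed
qed

lemma
  assumes conn: "connected (graph M)" and r: "r \<in> V"
  shows graph_dist_root: "graph_dist M r r = 0"
    and graph_dist_step: "\<And>a. a \<in> A \<Longrightarrow> graph_dist M r (hd_of a) \<le> Suc (graph_dist M r (tl_of a))"
    and graph_dist_down: "\<And>v. v \<in> V \<Longrightarrow> v \<noteq> r \<Longrightarrow>
      \<exists>a\<in>A. hd_of a = v \<and> graph_dist M r (tl_of a) < graph_dist M r v"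
proof -
  have upper: "graph_dist M r v \<le> length p" if "awalk r p v" for p v
    unfolding graph_dist_def using that by (intro Least_le) auto
  have attained: "\<exists>p. awalk r p v \<and> length p = graph_dist M r v" if v: "v \<in> V" for v
  proof -
    obtain p where "awalk r p v"
      using connected_reachable[OF conn r v] reachable_awalk by blast
    then have "\<exists>k p. awalk r p v \<and> length p = k" by blast
    then show ?thesis unfolding graph_dist_def by (rule LeastI_ex)
  qed
  show "graph_dist M r r = 0" using upper[of "[]" r] r by (simp add: awalk_Nil_iff)
  show "graph_dist M r (hd_of a) \<le> Suc (graph_dist M r (tl_of a))" if a: "a \<in> A" for a
  proof -
    obtain p where p: "awalk r p (tl_of a)" "length p = graph_dist M r (tl_of a)"
      using attained[of "tl_of a"] a by auto
    have "awalk r (p @ [a]) (hd_of a)"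
      using p(1) arc_implies_awalk[OF a] by (rule awalk_appendI)
    from upper[OF this] show ?thesis using p(2) by simp
  qed
  show "\<exists>a\<in>A. hd_of a = v \<and> graph_dist M r (tl_of a) < graph_dist M r v" if v: "v \<in> V" "v \<noteq> r" for v
  proof -
    obtain p where p: "awalk r p v" "length p = graph_dist M r v"
      using attained v by blast
    have "p \<noteq> []" using p(1) v(2) by (auto simp: awalk_Nil_iff)
    then obtain q a where q: "p = q @ [a]" by (cases p rule: rev_cases) auto
    have "awalk (awlast r q) [a] v" and w: "awalk r q (awlast r q)"
      using p(1) q by auto
    then have a: "a \<in> A" "awlast r q = tl_of a" "hd_of a = v"
      by (auto simp: awalk_simps)
    then show ?thesis using upper[of q "tl_of a"] w p(2) q by (intro bexI[of _ a]) auto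
  qed
qed

end

section \<open>Isomorphisms of drawings\<close>

text \<open>
  An isomorphism as a plain pair of maps. Heads are carried along because the head of an arc is the
  tail of its opposite.
\<close>
definition drawing_iso ::
    "('v \<Rightarrow> 'w) \<Rightarrow> ('a \<Rightarrow> 'b) \<Rightarrow> ('v, 'a) drawing \<Rightarrow> ('w, 'b) drawing \<Rightarrow> bool" where
  "drawing_iso p f M N \<longleftrightarrow>
     rotation_system M \<and> rotation_system N \<and>
     bij_betw p (verts (graph M)) (verts (graph N)) \<and>
     bij_betw f (arcs (graph M)) (arcs (graph N)) \<and>
     (\<forall>a\<in>arcs (graph M).
        p (tail (graph M) a) = tail (graph N) (f a) \<and>
        f (opp M a) = opp N (f a) \<and> f (rot M a) = rot N (f a))"

lemma ex_drawing_isomorphism_iff: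
  "(\<exists>h. drawing_isomorphism h M N \<and> P (iso_verts h)) \<longleftrightarrow> (\<exists>p f. drawing_iso p f M N \<and> P p)"
proof
  assume "\<exists>h. drawing_isomorphism h M N \<and> P (iso_verts h)"
  then obtain h where h: "drawing_isomorphism h M N" "P (iso_verts h)" by blast
  have "drawing_iso (iso_verts h) (iso_arcs h) M N"
    using h(1) unfolding drawing_isomorphism_def drawing_iso_def pre_digraph.digraph_isomorphism_def
    by (auto simp: bij_betw_def)
  then show "\<exists>p f. drawing_iso p f M N \<and> P p" using h(2) by blast
next
  assume "\<exists>p f. drawing_iso p f M N \<and> P p"
  then obtain p f where f: "drawing_iso p f M N" "P p" by blast
  interpret M: rotation_drawing M using f(1) by unfold_locales (simp add: drawing_iso_def)
  interpret N: rotation_drawing N using f(1) by unfold_locales (simp add: drawing_iso_def)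
  define h where "h = \<lparr>iso_verts = p, iso_arcs = f, iso_head = head (graph N), iso_tail = tail (graph N)\<rparr>"
  have hd: "p (head (graph M) a) = head (graph N) (f a)" if "a \<in> arcs (graph M)" for a
  proof -
    have "f a \<in> arcs (graph N)" using f(1) that by (auto simp: drawing_iso_def bij_betw_def)
    then show ?thesis
      using f(1) that unfolding drawing_iso_def
      by (metis M.tail_arev M.arev_in_arcs N.tail_arev)
  qed
  have "drawing_isomorphism h M N"
    using f(1) hd M.wf_digraph unfolding drawing_isomorphism_def pre_digraph.digraph_isomorphism_def
    by (auto simp: h_def drawing_iso_def bij_betw_def app_iso_def)
  moreover have "P (iso_verts h)" using f(2) by (simp add: h_def)
  ultimately show "\<exists>h. drawing_isomorphism h M N \<and> P (iso_verts h)" by blast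
qed

lemma drawing_iso_refl: "rotation_system M \<Longrightarrow> drawing_iso id id M M"
  by (simp add: drawing_iso_def)

lemma drawing_iso_trans:
  assumes "drawing_iso p f M N" "drawing_iso q g N P"
  shows "drawing_iso (q \<circ> p) (g \<circ> f) M P"
proof -
  have "bij_betw (q \<circ> p) (verts (graph M)) (verts (graph P))"
    "bij_betw (g \<circ> f) (arcs (graph M)) (arcs (graph P))"
    using assms unfolding drawing_iso_def by (auto intro: bij_betw_trans)
  moreover have "f a \<in> arcs (graph N)" if "a \<in> arcs (graph M)" for a
    using assms that by (auto simp: drawing_iso_def bij_betw_def)
  ultimately show ?thesis using assms unfolding drawing_iso_def by simp
qed

lemma drawing_iso_sym:
  assumes "drawing_iso p f M N"
  shows "drawing_iso (the_inv_into (verts (graph M)) p) (the_inv_into (arcs (graph M)) f) N M"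
    (is "drawing_iso ?q ?g N M")
proof -
  interpret M: rotation_drawing M using assms by unfold_locales (simp add: drawing_iso_def)
  interpret N: rotation_drawing N using assms by unfold_locales (simp add: drawing_iso_def)
  have p: "bij_betw p (verts (graph M)) (verts (graph N))"
    and f: "bij_betw f (arcs (graph M)) (arcs (graph N))"
    using assms by (auto simp: drawing_iso_def)
  have qp: "?q (p v) = v" if "v \<in> verts (graph M)" for v
    using p that by (simp add: bij_betw_def the_inv_into_f_f)
  have gf: "?g (f a) = a" if "a \<in> arcs (graph M)" for a
    using f that by (simp add: bij_betw_def the_inv_into_f_f)
  have "?q (tail (graph N) b) = tail (graph M) (?g b) \<and> ?g (opp N b) = opp M (?g b) \<and>
      ?g (rot N b) = rot M (?g b)" if "b \<in> arcs (graph N)" for b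
  proof -
    obtain a where a: "a \<in> arcs (graph M)" "b = f a"
      using f \<open>b \<in> _\<close> by (auto simp: bij_betw_def)
    then show ?thesis using assms qp gf unfolding drawing_iso_def
      by (metis M.arev_in_arcs M.rot_in_arcs M.tail_in_verts)
  qed
  then show ?thesis using assms bij_betw_the_inv_into[OF p] bij_betw_the_inv_into[OF f]
    unfolding drawing_iso_def by auto
qed

locale drawing_iso_pair =
  fixes p :: "'v \<Rightarrow> 'w" and f :: "'a \<Rightarrow> 'b" and M N
  assumes iso: "drawing_iso p f M N"
begin

sublocale M: rotation_drawing M using iso by unfold_locales (simp add: drawing_iso_def)
sublocale N: rotation_drawing N using iso by unfold_locales (simp add: drawing_iso_def)

lemma bij_p: "bij_betw p M.V N.V" and bij_f: "bij_betw f M.A N.A"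
  using iso by (auto simp: drawing_iso_def)

lemma f_image: "f ` M.A = N.A" and p_image: "p ` M.V = N.V"
  using bij_p bij_f by (auto simp: bij_betw_def)

lemma f_in[simp]: "a \<in> M.A \<Longrightarrow> f a \<in> N.A" and p_in[simp]: "v \<in> M.V \<Longrightarrow> p v \<in> N.V"
  using f_image p_image by auto

lemma f_eq_iff: "a \<in> M.A \<Longrightarrow> b \<in> M.A \<Longrightarrow> f a = f b \<longleftrightarrow> a = b"
  using bij_f by (auto simp: bij_betw_def dest: inj_onD)

lemma f_opp: "a \<in> M.A \<Longrightarrow> f (opp M a) = opp N (f a)"
  and f_rot: "a \<in> M.A \<Longrightarrow> f (rot M a) = rot N (f a)"
  and p_tail: "a \<in> M.A \<Longrightarrow> p (M.tl_of a) = N.tl_of (f a)"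
  using iso by (auto simp: drawing_iso_def)

lemma p_head: "a \<in> M.A \<Longrightarrow> p (M.hd_of a) = N.hd_of (f a)"
  by (metis M.arev_in_arcs M.tail_arev N.tail_arev f_in f_opp p_tail)

lemma f_face_succ: "a \<in> M.A \<Longrightarrow> f (face_succ M a) = face_succ N (f a)"
  by (simp add: face_succ_def f_rot f_opp)

lemma f_orbit:
  assumes "a \<in> M.A"
  shows "f ` orbit (face_succ M) a = orbit (face_succ N) (f a)"
proof (rule orbit_inverse)
  show "a \<in> orbit (face_succ M) a"
    by (rule permutation_self_in_orbit[OF M.permutation_face_succ])
  show "face_succ N (f x) = f (face_succ M x)" if "x \<in> orbit (face_succ M) a" for x
    using permutes_orbit_subset[OF M.face_succ_permutes assms] that f_face_succ by auto
qed

lemma faces_eq: "faces N = (`) f ` faces M"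
proof -
  have "faces N = (\<lambda>a. orbit (face_succ N) (f a)) ` M.A"
    unfolding faces_def f_image[symmetric] by (rule image_image)
  also have "\<dots> = (\<lambda>a. f ` orbit (face_succ M) a) ` M.A"
    using f_orbit by (intro image_cong) auto
  finally show ?thesis by (simp add: faces_def image_image)
qed

lemma card_face: "F \<in> faces M \<Longrightarrow> card (f ` F) = card F"
  using M.face_in_arcs[of F] inj_on_subset[OF bij_betw_imp_inj_on[OF bij_f]] by (intro card_image) blast

lemma card_faces: "card (faces N) = card (faces M)"
proof -
  have "inj_on ((`) f) (faces M)"
    using M.face_in_arcs
    by (intro inj_on_subset[OF inj_on_image_Pow[OF bij_betw_imp_inj_on[OF bij_f]]]) auto
  then show ?thesis by (simp add: faces_eq card_image)
qed

lemma card_edges: "card (edges N) = card (edges M)"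
  using M.card_arcs_edges N.card_arcs_edges bij_betw_same_card[OF bij_f] by simp

lemma card_verts: "card N.V = card M.V"
  using bij_betw_same_card[OF bij_p] by simp

lemma reachable_p: "u \<rightarrow>\<^sup>*\<^bsub>graph M\<^esub> v \<Longrightarrow> p u \<rightarrow>\<^sup>*\<^bsub>graph N\<^esub> p v"
proof (induction rule: M.reachable_induct)
  case base
  then show ?case by simp
next
  case (step x y)
  then obtain e where "e \<in> M.A" "M.tl_of e = x" "M.hd_of e = y" by auto
  then have "p x \<rightarrow>\<^bsub>graph N\<^esub> p y"
    using N.in_arcs_imp_in_arcs_ends[of "f e"] by (auto simp: p_head p_tail)
  with step show ?case by (meson N.reachable_adj_trans)
qed

lemma connected_transfer:
  assumes "connected (graph M)"
  shows "connected (graph N)"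
proof -
  obtain r where "r \<in> M.V" using assms by (auto simp: connected_def strongly_connected_def)
  then have "p r \<rightarrow>\<^sup>*\<^bsub>graph N\<^esub> w" if "w \<in> N.V" for w
    using that reachable_p M.connected_reachable[OF assms] unfolding p_image[symmetric] by blast
  then show ?thesis using p_in[OF \<open>r \<in> M.V\<close>] by (rule N.connectedI_root[rotated])
qed

lemma map_of_genus_transfer: "map_of_genus g M \<Longrightarrow> map_of_genus g N"
  using N.rotation_system connected_transfer
  by (simp add: map_of_genus_def card_faces card_edges card_verts)

lemma quadrangulation_transfer: "quadrangulation g M \<Longrightarrow> quadrangulation g N"
  using map_of_genus_transfer by (auto simp: quadrangulation_def faces_eq card_face)

lemma bipartite_transfer:
  assumes "bipartite M"
  shows "bipartite N"
proof -
  obtain c :: "'v \<Rightarrow> bool" where c: "\<And>a. a \<in> M.A \<Longrightarrow> c (M.tl_of a) \<noteq> c (M.hd_of a)"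
    using assms by (auto simp: bipartite_def)
  have "(c \<circ> the_inv_into M.V p) (N.tl_of b) \<noteq> (c \<circ> the_inv_into M.V p) (N.hd_of b)" if b: "b \<in> N.A" for b
  proof -
    obtain a where a: "a \<in> M.A" "b = f a" using b unfolding f_image[symmetric] by blast
    have inv: "the_inv_into M.V p (p v) = v" if "v \<in> M.V" for v
      using bij_p that by (simp add: bij_betw_def the_inv_into_f_f)
    have "N.tl_of b = p (M.tl_of a)" "N.hd_of b = p (M.hd_of a)"
      using a p_tail p_head by simp_all
    then show ?thesis using c[OF a(1)] inv a(1) by simp
  qed
  then show ?thesis unfolding bipartite_def by blast
qed

lemma graph_dist_transfer:
  assumes "connected (graph M)" "r \<in> M.V" "v \<in> M.V"
  shows "graph_dist N (p r) (p v) = graph_dist M r v"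
proof -
  define L where "L = graph_dist M r \<circ> the_inv_into M.V p"
  have L: "L (p v) = graph_dist M r v" if "v \<in> M.V" for v
    using bij_p that by (simp add: bij_betw_def the_inv_into_f_f L_def)
  have "graph_dist N (p r) (p v) = L (p v)"
  proof (rule N.graph_dist_eqI)
    show "p r \<in> N.V" "p v \<in> N.V" using assms by auto
    show "L (p r) = 0" using assms by (simp add: L M.graph_dist_root)
    show "L (N.hd_of b) \<le> Suc (L (N.tl_of b))" if b: "b \<in> N.A" for b
    proof -
      obtain a where a: "a \<in> M.A" "b = f a" using b unfolding f_image[symmetric] by blast
      then have "N.tl_of b = p (M.tl_of a)" "N.hd_of b = p (M.hd_of a)"
        using p_tail p_head by simp_all
      then show ?thesis
        using M.graph_dist_step[OF assms(1,2) a(1)] a(1) by (simp add: L)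
    qed
    show "\<exists>b\<in>N.A. N.hd_of b = w \<and> L (N.tl_of b) < L w" if w: "w \<in> N.V" "w \<noteq> p r" for w
    proof -
      obtain v where v: "v \<in> M.V" "w = p v" using w(1) unfolding p_image[symmetric] by blast
      then obtain a where a: "a \<in> M.A" "M.hd_of a = v" "graph_dist M r (M.tl_of a) < graph_dist M r v"
        using M.graph_dist_down[OF assms(1,2), of v] w by blast
      have "N.tl_of (f a) = p (M.tl_of a)" "N.hd_of (f a) = p (M.hd_of a)"
        using p_tail[OF a(1)] p_head[OF a(1)] by simp_all
      then have "N.hd_of (f a) = w \<and> L (N.tl_of (f a)) < L w"
        using v a by (simp add: L)
      then show ?thesis using f_in[OF a(1)] by blast
    qed
  qed
  then show ?thesis using L assms by simp
qed

end

section \<open>Labels along a contour\<close>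

text \<open>
  The labels along the contour \<open>f\<close> are read as a height profile. In \<open>returns f l e d\<close>, the corner \<open>e\<close> is the
  previous visit to the height of \<open>d\<close>, and the contour stays strictly above that height in between. In
  \<open>descends f l d c\<close>, the corner \<open>c\<close> is the first one after \<open>d\<close> that lies below \<open>d\<close>.
\<close>
definition returns :: "('a \<Rightarrow> 'a) \<Rightarrow> ('a \<Rightarrow> int) \<Rightarrow> 'a \<Rightarrow> 'a \<Rightarrow> bool" where
  "returns f l e d \<longleftrightarrow>
     (\<exists>k>0. (f ^^ k) e = d \<and> l e = l d \<and> (\<forall>j. 0 < j \<and> j < k \<longrightarrow> l d < l ((f ^^ j) e)))"

definition descends :: "('a \<Rightarrow> 'a) \<Rightarrow> ('a \<Rightarrow> int) \<Rightarrow> 'a \<Rightarrow> 'a \<Rightarrow> bool" where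
  "descends f l d c \<longleftrightarrow>
     (\<exists>k>0. (f ^^ k) d = c \<and> l c < l d \<and> (\<forall>j<k. l d \<le> l ((f ^^ j) d)))"

lemma descends_unique:
  assumes "descends f l d c" "descends f l d c'"
  shows "c = c'"
proof -
  obtain k where k: "(f ^^ k) d = c" "l c < l d" "\<forall>j<k. l d \<le> l ((f ^^ j) d)"
    using assms(1) by (auto simp: descends_def)
  obtain m where m: "(f ^^ m) d = c'" "l c' < l d" "\<forall>j<m. l d \<le> l ((f ^^ j) d)"
    using assms(2) by (auto simp: descends_def)
  have "\<not> m < k" "\<not> k < m" using k m by auto
  then have "k = m" by simp
  then show ?thesis using k m by simp
qed

text \<open>
  Two candidates lie at different distances before \<open>d\<close>; the nearer one has the label of \<open>d\<close> but is an
  intermediate point for the farther one.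
\<close>
lemma returns_unique:
  assumes "returns f l e d" "returns f l e' d" "inj f"
  shows "e = e'"
proof -
  obtain k where k: "0 < k" "(f ^^ k) e = d" "l e = l d" "\<forall>j. 0 < j \<and> j < k \<longrightarrow> l d < l ((f ^^ j) e)"
    using assms(1) by (auto simp: returns_def)
  obtain m where m: "0 < m" "(f ^^ m) e' = d" "l e' = l d" "\<forall>j. 0 < j \<and> j < m \<longrightarrow> l d < l ((f ^^ j) e')"
    using assms(2) by (auto simp: returns_def)
  have cancel: "(f ^^ i) x = y" if "(f ^^ (i + j)) x = (f ^^ j) y" for i j x y
    using that inj_fn[OF assms(3), of j] by (simp add: add.commute[of i] funpow_add inj_eq)
  consider "k = m" | "k < m" | "m < k" by linarith
  then show ?thesis
  proof cases
    case 1
    then have "(f ^^ k) e = (f ^^ k) e'" using k(2) m(2) by simp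
    then show ?thesis by (rule injD[OF inj_fn[OF assms(3)]])
  next
    case 2
    then have "(f ^^ (m - k)) e' = e" using cancel[of "m - k" k e' e] k(2) m(2) by simp
    then show ?thesis using m(4)[rule_format, of "m - k"] k(1,3) 2 by simp
  next
    case 3
    then have "(f ^^ (k - m)) e = e'" using cancel[of "k - m" m e e'] k(2) m(2) by simp
    then show ?thesis using k(4)[rule_format, of "k - m"] m(1,3) 3 by simp
  qed
qed

lemma descends_step: "l (f d) < l d \<Longrightarrow> descends f l d (f d)"
  unfolding descends_def by (intro exI[of _ 1]) auto

lemma returns_step: "l (f e) = l e \<Longrightarrow> returns f l e (f e)"
  unfolding returns_def by (intro exI[of _ 1]) auto

lemma returns_over:
  assumes "l e < l (f e)" "descends f l (f e) d" "l d = l e"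
  shows "returns f l e d"
proof -
  obtain k where k: "0 < k" "(f ^^ k) (f e) = d" "\<forall>j<k. l (f e) \<le> l ((f ^^ j) (f e))"
    using assms(2) by (auto simp: descends_def)
  have "l d < l ((f ^^ j) e)" if "0 < j" "j < Suc k" for j
  proof -
    have "j = Suc (j - 1)" "j - 1 < k" using that by auto
    then have "(f ^^ j) e = (f ^^ (j - 1)) (f e)" "l (f e) \<le> l ((f ^^ (j - 1)) (f e))"
      using k(3) by (metis funpow_Suc_right o_apply, blast)
    then show ?thesis using assms(1,3) by simp
  qed
  then show ?thesis
    using k assms(3) unfolding returns_def by (intro exI[of _ "Suc k"]) (simp add: funpow_swap1)
qed

lemma returns_descends:
  assumes "returns f l e d" "descends f l d c"
  shows "descends f l e c"
proof -
  obtain k where k: "0 < k" "(f ^^ k) e = d" "l e = l d" "\<forall>j. 0 < j \<and> j < k \<longrightarrow> l d < l ((f ^^ j) e)"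
    using assms(1) by (auto simp: returns_def)
  obtain m where m: "(f ^^ m) d = c" "l c < l d" "\<forall>j<m. l d \<le> l ((f ^^ j) d)"
    using assms(2) by (auto simp: descends_def)
  have "l e \<le> l ((f ^^ j) e)" if "j < m + k" for j
  proof (cases "j < k")
    case True
    then show ?thesis using k(3,4) by (cases "j = 0") (auto intro: less_imp_le)
  next
    case False
    then have "(f ^^ j) e = (f ^^ (j - k)) ((f ^^ k) e)"
      by (simp add: funpow_add[symmetric, unfolded o_def fun_eq_iff, rule_format])
    then have "(f ^^ j) e = (f ^^ (j - k)) d" using k(2) by simp
    then show ?thesis using m(3) k(3) False that by simp
  qed
  moreover have "(f ^^ (m + k)) e = c" using k(2) m(1) by (simp add: funpow_add)
  ultimately show ?thesis
    unfolding descends_def using k(1,3) m(2) by (intro exI[of _ "m + k"]) auto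
qed

text \<open>
  If the contour enters \<open>f x\<close> from below, then any visit to the height of \<open>f x\<close> before it is
  separated from it by the lower point \<open>x\<close>.
\<close>
lemma no_return_after_rise:
  assumes "inj f" "l x < l (f x)"
  shows "\<not> returns f l e (f x)"
proof
  assume "returns f l e (f x)"
  then obtain k where k: "0 < k" "(f ^^ k) e = f x" "l e = l (f x)"
    "\<forall>j. 0 < j \<and> j < k \<longrightarrow> l (f x) < l ((f ^^ j) e)"
    by (auto simp: returns_def)
  obtain m where m: "k = Suc m" using k(1) by (cases k) auto
  have "(f ^^ m) e = x" using k(2) m assms(1) by (simp add: inj_eq)
  then show False using k(3) k(4)[rule_format, of m] m assms(2) by (cases "m = 0") auto
qed

lemma returns_label: "returns f l e d \<Longrightarrow> l e = l d"
  by (auto simp: returns_def)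

lemma descends_label: "descends f l d c \<Longrightarrow> l c < l d"
  by (auto simp: descends_def)

lemma descends_orbit: "descends f l d c \<Longrightarrow> c \<in> orbit f d"
  by (auto simp: descends_def orbit_altdef)

lemma returns_orbit: "returns f l e d \<Longrightarrow> d \<in> orbit f e"
  by (auto simp: returns_def orbit_altdef)

text \<open>
  The clockwise face step of the quadrangulation, written in terms of the one-face map. The pair
  \<open>(u, b)\<close> stands for the edge that starts in corner \<open>b\<close> and runs down to the next lower corner of the
  contour \<open>\<psi>\<close>; it is traversed upwards if \<open>u\<close> holds and downwards otherwise. The edge of the one-face map
  at \<open>b\<close> is \<open>{b, \<beta> b}\<close>, and \<open>\<psi> (\<beta> b)\<close> is the next corner around the vertex of \<open>b\<close>.
\<close>
definition closing_step ::
    "('a \<Rightarrow> 'a) \<Rightarrow> ('a \<Rightarrow> 'a) \<Rightarrow> ('a \<Rightarrow> int) \<Rightarrow> bool \<times> 'a \<Rightarrow> bool \<times> 'a" where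
  "closing_step \<beta> \<psi> l = (\<lambda>(u, b).
     if u then (if l b < l (\<beta> b) then (True, \<beta> b) else (False, \<psi> (\<beta> b)))
     else if \<exists>e. returns \<psi> l e b then (True, THE e. returns \<psi> l e b)
     else (False, THE c. descends \<psi> l b c))"

lemma closing_step_simps:
  "l b < l (\<beta> b) \<Longrightarrow> closing_step \<beta> \<psi> l (True, b) = (True, \<beta> b)"
  "\<not> l b < l (\<beta> b) \<Longrightarrow> closing_step \<beta> \<psi> l (True, b) = (False, \<psi> (\<beta> b))"
  by (auto simp: closing_step_def)

lemma closing_step_returns:
  assumes "returns \<psi> l e b" "inj \<psi>"
  shows "closing_step \<beta> \<psi> l (False, b) = (True, e)"
proof -
  have "(THE e. returns \<psi> l e b) = e"
    using assms by (intro the_equality) (auto intro: returns_unique)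
  then show ?thesis using assms by (auto simp: closing_step_def)
qed

lemma closing_step_descends:
  assumes "descends \<psi> l b c" "\<not> (\<exists>e. returns \<psi> l e b)"
  shows "closing_step \<beta> \<psi> l (False, b) = (False, c)"
proof -
  have "(THE c. descends \<psi> l b c) = c"
    using assms by (intro the_equality) (auto intro: descends_unique)
  then show ?thesis using assms by (auto simp: closing_step_def)
qed

section \<open>Pointed bipartite quadrangulations\<close>

locale pointed_quadrangulation = rotation_drawing q for q :: "('v, 'a) drawing" +
  fixes v0 :: 'v
  assumes connected_q: "connected (graph q)"
    and card_face_q: "F \<in> faces q \<Longrightarrow> card F = 4"
    and bipartite_q: "bipartite q"
    and root_in: "v0 \<in> V"
begin

definition L :: "'v \<Rightarrow> int" where
  "L v = int (graph_dist q v0 v)"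

definition up :: "'a \<Rightarrow> bool" where
  "up a \<longleftrightarrow> L (tl_of a) < L (hd_of a)"

abbreviation "C \<equiv> opening_corners q v0"
abbreviation "\<beta> \<equiv> opening_opp q v0"
abbreviation "\<rho> \<equiv> opening_rot q v0"
abbreviation "T \<equiv> opening_drawing q v0"
abbreviation "\<psi> \<equiv> face_succ T"
abbreviation "l \<equiv> (\<lambda>b. L (tl_of b))"
text \<open>
  The corner of the opened drawing in which the arc \<open>a\<close> lies, if \<open>a\<close> does not leave the basepoint:
  the next selected corner counterclockwise.
\<close>
abbreviation "\<kappa> \<equiv> first_return \<sigma> C"

lemma L_root: "L v0 = 0"
  by (simp add: L_def graph_dist_root[OF connected_q root_in])

lemma L_nonneg: "0 \<le> L v"
  by (simp add: L_def)

lemma down_neighbour: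
  assumes "v \<in> V" "v \<noteq> v0"
  obtains a where "a \<in> A" "tl_of a = v" "\<not> up a"
proof -
  obtain a where "a \<in> A" "hd_of a = v" "graph_dist q v0 (tl_of a) < graph_dist q v0 v"
    using graph_dist_down[OF connected_q root_in assms] by blast
  then show thesis using that[of "\<alpha> a"] by (simp add: up_def L_def)
qed

text \<open>
  Distances of adjacent vertices differ by at most one, and since the colors of a bipartition record
  the parity of the distance, they are not equal.
\<close>
lemma L_step:
  assumes "a \<in> A"
  shows "L (hd_of a) = L (tl_of a) + (if up a then 1 else - 1)"
proof -
  obtain c :: "'v \<Rightarrow> bool" where c: "\<And>a. a \<in> A \<Longrightarrow> c (tl_of a) \<noteq> c (hd_of a)"
    using bipartite_q by (auto simp: bipartite_def)
  have parity: "c v = c v0 \<longleftrightarrow> even (graph_dist q v0 v)" if "v \<in> V" for v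
    using that
  proof (induction "graph_dist q v0 v" arbitrary: v rule: less_induct)
    case less
    show ?case
    proof (cases "v = v0")
      case True
      then show ?thesis by (simp add: graph_dist_root[OF connected_q root_in])
    next
      case False
      then obtain a where a: "a \<in> A" "hd_of a = v" "graph_dist q v0 (tl_of a) < graph_dist q v0 v"
        using graph_dist_down[OF connected_q root_in] less.prems by blast
      then have "graph_dist q v0 v = Suc (graph_dist q v0 (tl_of a))"
        using graph_dist_step[OF connected_q root_in a(1)] by simp
      moreover have "c (tl_of a) = c v0 \<longleftrightarrow> even (graph_dist q v0 (tl_of a))"
        using less.hyps[OF a(3)] a(1) by simp
      ultimately show ?thesis using c[OF a(1)] a(2) by auto
    qed
  qed
  have "graph_dist q v0 (hd_of a) \<noteq> graph_dist q v0 (tl_of a)"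
    using parity[of "tl_of a"] parity[of "hd_of a"] c[OF assms] assms by auto
  moreover have "graph_dist q v0 (hd_of a) \<le> Suc (graph_dist q v0 (tl_of a))"
    "graph_dist q v0 (tl_of a) \<le> Suc (graph_dist q v0 (hd_of a))"
    using graph_dist_step[OF connected_q root_in assms]
      graph_dist_step[OF connected_q root_in, of "\<alpha> a"] assms by auto
  ultimately show ?thesis by (auto simp: L_def up_def)
qed

lemma up_opp[simp]: "a \<in> A \<Longrightarrow> up (\<alpha> a) \<longleftrightarrow> \<not> up a"
  using L_step[of a] by (auto simp: up_def)

lemma L_tail_face_succ: "a \<in> A \<Longrightarrow> L (tl_of (\<phi> a)) = L (tl_of a) + (if up a then 1 else - 1)"
  by (simp add: L_step)

lemma L_pos:
  assumes "v \<in> V" "v \<noteq> v0"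
  shows "0 < L v"
proof -
  obtain a where "a \<in> A" "tl_of a = v" "\<not> up a" by (rule down_neighbour[OF assms])
  then show ?thesis using L_step[of a] L_nonneg[of "hd_of a"] by simp
qed

lemma not_up_root: "a \<in> A \<Longrightarrow> \<not> up a \<Longrightarrow> tl_of a \<noteq> v0"
  using L_root L_nonneg[of "hd_of a"] L_step[of a] by auto

lemma face_four:
  assumes "a \<in> A"
  shows "\<phi> (\<phi> (\<phi> (\<phi> a))) = a" and "\<phi> (\<phi> a) \<noteq> a"
    and "orbit \<phi> a = {a, \<phi> a, \<phi> (\<phi> a), \<phi> (\<phi> (\<phi> a))}"
proof -
  have self: "a \<in> orbit \<phi> a" by (rule permutation_self_in_orbit[OF permutation_face_succ])
  have "card (orbit \<phi> a) = 4" using card_face_q assms by (simp add: faces_def)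
  moreover have "card (orbit \<phi> a) = funpow_dist1 \<phi> a a"
    using inj_on_funpow_dist1[OF self]
    by (subst orbit_conv_funpow_dist1[OF self]) (simp add: card_image)
  ultimately have four: "funpow_dist1 \<phi> a a = 4" by simp
  have p4: "(\<phi> ^^ 4) a = a" using funpow_dist1_prop[OF self] unfolding four .
  then show "\<phi> (\<phi> (\<phi> (\<phi> a))) = a" by (simp add: eval_nat_numeral)
  have "(\<phi> ^^ 2) a \<noteq> a" by (rule funpow_dist1_least) (simp_all only: four)
  then show "\<phi> (\<phi> a) \<noteq> a" by (simp add: eval_nat_numeral)
  have "orbit \<phi> a = {(\<phi> ^^ m) a |m. m < 4}" by (rule orbit_altdef_bounded[OF p4]) simp
  also have "\<dots> = {a, \<phi> a, \<phi> (\<phi> a), \<phi> (\<phi> (\<phi> a))}"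
    by (auto simp: less_Suc_eq numeral_eq_Suc intro: exI[of _ 0] exI[of _ "Suc 0"]
        exI[of _ "Suc (Suc 0)"] exI[of _ "Suc (Suc (Suc 0))"])
  finally show "orbit \<phi> a = {a, \<phi> a, \<phi> (\<phi> a), \<phi> (\<phi> (\<phi> a))}" .
qed

text \<open>
  After the four steps around a face the label is back at its starting value.
\<close>
lemma face_rises:
  assumes "a \<in> A"
  shows "(if up a then 1 else - 1) + (if up (\<phi> a) then 1 else - 1) +
    (if up (\<phi> (\<phi> a)) then 1 else - 1) + (if up (\<phi> (\<phi> (\<phi> a))) then 1 else - 1) = (0 :: int)"
  using L_tail_face_succ[of a] L_tail_face_succ[of "\<phi> a"] L_tail_face_succ[of "\<phi> (\<phi> a)"]
    L_tail_face_succ[of "\<phi> (\<phi> (\<phi> a))"] assms face_four(1)[OF assms] by (simp del: tail_face_succ)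

lemma corners_subset: "C \<subseteq> A"
  by (auto simp: opening_corners_def)

lemma inv_face_succ[simp]: "inv \<phi> (\<phi> a) = a"
  using permutes_inj[OF face_succ_permutes] by (simp add: inv_f_f)

lemma face_succ_corner[simp]: "a \<in> A \<Longrightarrow> \<phi> a \<in> C \<longleftrightarrow> up a"
  by (simp add: opening_corners_def up_def L_def)

lemma rot_corner[simp]: "a \<in> A \<Longrightarrow> \<sigma> a \<in> C \<longleftrightarrow> \<not> up a"
  using face_succ_corner[of "\<alpha> a"] by simp

lemma cornerE:
  assumes "b \<in> C"
  obtains a where "a \<in> A" "up a" "b = \<phi> a"
proof -
  obtain a where "b = \<phi> a" using permutes_surj[OF face_succ_permutes] by (metis surjD)
  then show thesis using that assms corners_subset by auto
qed

lemma opening_opp_eqI: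
  assumes "b \<in> C" "c \<in> C" "c \<noteq> b" "\<And>x. x \<in> C \<Longrightarrow> x \<in> orbit \<phi> b \<Longrightarrow> x = b \<or> x = c" "c \<in> orbit \<phi> b"
  shows "\<beta> b = c"
  unfolding opening_opp_def perm_restrict_simps(1)[OF assms(1)]
  using assms by (intro the_equality) auto

text \<open>
  A face has exactly two rising arcs, and its selected corners are the two they lead into.
\<close>
lemma opening_opp_face:
  assumes "a \<in> A" "up a" "x \<in> orbit \<phi> a" "x \<noteq> a" "up x"
  shows "\<beta> (\<phi> a) = \<phi> x"
proof (rule opening_opp_eqI)
  have x: "x \<in> A" using assms(3) permutes_orbit_subset[OF face_succ_permutes assms(1)] by auto
  show "\<phi> a \<in> C" "\<phi> x \<in> C" using assms x by auto
  show "\<phi> x \<noteq> \<phi> a" using assms(4) permutes_inj[OF face_succ_permutes] by (auto dest: injD)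
  have orb: "orbit \<phi> (\<phi> a) = orbit \<phi> a" by (rule permutation_orbit_step[OF permutation_face_succ])
  show "\<phi> x \<in> orbit \<phi> (\<phi> a)" unfolding orb using assms(3) by (rule orbit.step)
  show "y = \<phi> a \<or> y = \<phi> x" if y: "y \<in> C" "y \<in> orbit \<phi> (\<phi> a)" for y
  proof -
    have "y \<in> {a, \<phi> a, \<phi> (\<phi> a), \<phi> (\<phi> (\<phi> a))}" using y(2) unfolding orb face_four(3)[OF assms(1)] .
    moreover have "x \<in> {a, \<phi> a, \<phi> (\<phi> a), \<phi> (\<phi> (\<phi> a))}"
      using assms(3) unfolding face_four(3)[OF assms(1)] .
    moreover have "a \<in> C \<longleftrightarrow> up (\<phi> (\<phi> (\<phi> a)))"
      using face_succ_corner[of "\<phi> (\<phi> (\<phi> a))"] assms(1) face_four(1)[OF assms(1)] by simp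
    ultimately show ?thesis
      using face_rises[OF assms(1)] y(1) assms face_four(1)[OF assms(1)] by (auto split: if_splits)
  qed
qed

lemma opp_up_up:
  assumes "a \<in> A" "up a" "up (\<phi> a)"
  shows "\<beta> (\<phi> a) = \<phi> (\<phi> a)" and "\<beta> (\<phi> (\<phi> a)) = \<phi> a"
    and "\<not> up (\<phi> (\<phi> a))" and "\<not> up (\<phi> (\<phi> (\<phi> a)))"
proof -
  have ne: "\<phi> a \<noteq> a" using face_four(2)[OF assms(1)] by auto
  show "\<beta> (\<phi> a) = \<phi> (\<phi> a)" using assms ne by (intro opening_opp_face) (auto intro: orbit.base)
  show "\<beta> (\<phi> (\<phi> a)) = \<phi> a"
    using assms ne face_four(3)[of "\<phi> a"] face_four(1)[OF assms(1)] by (intro opening_opp_face) auto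
  show "\<not> up (\<phi> (\<phi> a))" "\<not> up (\<phi> (\<phi> (\<phi> a)))"
    using face_rises[OF assms(1)] assms by (auto split: if_splits)
qed

lemma opp_up_down_up:
  assumes "a \<in> A" "up a" "up (\<phi> (\<phi> a))"
  shows "\<beta> (\<phi> a) = \<phi> (\<phi> (\<phi> a))" and "\<not> up (\<phi> a)" and "\<not> up (\<phi> (\<phi> (\<phi> a)))"
proof -
  show "\<beta> (\<phi> a) = \<phi> (\<phi> (\<phi> a))"
    using assms face_four(2)[OF assms(1)] face_four(3)[OF assms(1)] by (intro opening_opp_face) auto
  show "\<not> up (\<phi> a)" "\<not> up (\<phi> (\<phi> (\<phi> a)))"
    using face_rises[OF assms(1)] assms by (auto split: if_splits)
qed

end

context pointed_quadrangulation
begin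

lemma funpow_rot_in: "a \<in> A \<Longrightarrow> (\<sigma> ^^ k) a \<in> A"
  by (induction k) auto

lemma tail_funpow_rot: "a \<in> A \<Longrightarrow> tl_of ((\<sigma> ^^ k) a) = tl_of a"
  by (induction k) (auto simp: funpow_rot_in)

lemma corner_in_orbit:
  assumes "a \<in> A" "tl_of a \<noteq> v0"
  obtains b where "b \<in> C" "b \<in> orbit \<sigma> a"
proof -
  obtain x where x: "x \<in> A" "tl_of x = tl_of a" "\<not> up x"
    using down_neighbour[of "tl_of a"] assms by auto
  then show thesis using orbit_rot[OF assms(1)] by (intro that[of "\<sigma> x"]) auto
qed

lemma kappa_down: "a \<in> A \<Longrightarrow> \<not> up a \<Longrightarrow> \<kappa> a = \<sigma> a"
  by (simp add: first_return_step_in)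

lemma kappa_up:
  assumes "a \<in> A" "up a" "tl_of a \<noteq> v0"
  shows "\<kappa> a = \<kappa> (\<sigma> a)"
proof -
  obtain b where "b \<in> C" "b \<in> orbit \<sigma> a" by (rule corner_in_orbit[OF assms(1,3)])
  then show ?thesis using assms by (intro first_return_step_out) auto
qed

lemma kappa_corner:
  assumes "a \<in> A" "tl_of a \<noteq> v0"
  shows "\<kappa> a \<in> C" and "tl_of (\<kappa> a) = tl_of a"
proof -
  obtain b where b: "b \<in> C" "b \<in> orbit \<sigma> a" by (rule corner_in_orbit[OF assms])
  show "\<kappa> a \<in> C" "tl_of (\<kappa> a) = tl_of a"
    using assms tail_funpow_rot by (rule_tac first_returnE[OF b]; auto)+
qed

lemma opening_rot_corner: "b \<in> C \<Longrightarrow> \<rho> b = \<kappa> b"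
  by (simp add: opening_rot_def first_return_def perm_restrict_simps)

lemma corner_tail: "b \<in> C \<Longrightarrow> tl_of b \<noteq> v0"
  by (metis cornerE face_succ_opp not_up_root tail_rot up_opp arev_in_arcs arev_arev)

lemma opening_opp_in: "b \<in> C \<Longrightarrow> \<beta> b \<in> C"
  and opening_opp_opp: "b \<in> C \<Longrightarrow> \<beta> (\<beta> b) = b"
  and opening_opp_neq: "b \<in> C \<Longrightarrow> \<beta> b \<noteq> b"
proof -
  assume "b \<in> C"
  then obtain a where a: "a \<in> A" "up a" "b = \<phi> a" by (rule cornerE)
  let ?a1 = "\<phi> a" and ?a2 = "\<phi> (\<phi> a)" and ?a3 = "\<phi> (\<phi> (\<phi> a))"
  have in_A: "?a1 \<in> A" "?a2 \<in> A" "?a3 \<in> A" using a by auto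
  note four = face_four(1)[OF a(1)]
  have neq: "\<phi> x \<noteq> x" if "x \<in> A" for x using face_four(2)[OF that] by auto
  consider "up ?a1" | "up ?a2" | "up ?a3"
    using face_rises[OF a(1)] a(2) by (auto split: if_splits)
  then have "\<beta> b \<in> C \<and> \<beta> (\<beta> b) = b \<and> \<beta> b \<noteq> b"
  proof cases
    case 1
    then show ?thesis using opp_up_up[OF a(1,2)] neq[OF in_A(1)] a in_A by simp
  next
    case 2
    have "\<beta> ?a3 = ?a1"
    proof -
      have "\<beta> (\<phi> ?a2) = \<phi> (\<phi> (\<phi> ?a2))" using 2 a four by (intro opp_up_down_up(1)) auto
      then show ?thesis using four by simp
    qed
    moreover have "?a3 \<noteq> ?a1" using face_four(2)[OF in_A(1)] .
    ultimately show ?thesis using opp_up_down_up[OF a(1,2) 2] a 2 in_A by simp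
  next
    case 3
    have "\<beta> (\<phi> ?a3) = \<phi> (\<phi> ?a3)" "\<beta> (\<phi> (\<phi> ?a3)) = \<phi> ?a3"
      using opp_up_up[of ?a3] 3 a four by auto
    then show ?thesis using four neq[OF a(1)] a 3 face_succ_corner[OF in_A(3)] by simp
  qed
  then show "\<beta> b \<in> C" "\<beta> (\<beta> b) = b" "\<beta> b \<noteq> b" by auto
qed

lemma contour_eq: "\<psi> b = \<rho> (\<beta> b)"
  by (simp add: face_succ_def opening_drawing_def)

text \<open>
  In a face with two consecutive rises, the contour of the opened drawing climbs by one on one side of
  the new edge and falls by one on the other side.
\<close>
lemma contour_up_up:
  assumes "a \<in> A" "up a" "up (\<phi> a)"
  shows "\<psi> (\<phi> a) = \<sigma> (\<phi> (\<phi> a))" and "\<psi> (\<phi> (\<phi> a)) = \<kappa> (\<phi> a)"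
proof -
  note opp = opp_up_up[OF assms]
  show "\<psi> (\<phi> a) = \<sigma> (\<phi> (\<phi> a))"
    using opp assms by (simp add: contour_eq opening_rot_corner kappa_down)
  show "\<psi> (\<phi> (\<phi> a)) = \<kappa> (\<phi> a)"
    using opp assms by (simp add: contour_eq opening_rot_corner)
qed

text \<open>
  In a face whose rises alternate with falls, the contour stays at the same label along the new edge.
\<close>
lemma contour_up_down_up:
  assumes "a \<in> A" "up a" "up (\<phi> (\<phi> a))"
  shows "\<psi> (\<phi> a) = \<sigma> (\<phi> (\<phi> (\<phi> a)))"
  using opp_up_down_up[OF assms] assms by (simp add: contour_eq opening_rot_corner kappa_down)

text \<open>
  The face on the left of \<open>w\<close> decides; its clockwise boundary runs from the opposite of \<open>w\<close> to \<open>\<sigma> w\<close>. If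
  its rises alternate with falls, the contour passes from the corner of \<open>\<sigma> w\<close> to the corner of \<open>w\<close> in one step. Otherwise it
  first climbs to a corner of larger label, whose next lower corner is the corner of \<open>w\<close>. The
  assumption on larger labels makes the lemma usable inside the induction of the next one.
\<close>
lemma returns_neighbour_aux:
  assumes w: "w \<in> A" "up w" "up (\<sigma> w)"
    and higher: "\<And>x. x \<in> A \<Longrightarrow> up x \<Longrightarrow> L (tl_of x) = L (tl_of w) + 1 \<Longrightarrow> descends \<psi> l (\<phi> x) (\<kappa> x)"
  shows "returns \<psi> l (\<phi> (\<sigma> w)) (\<phi> w)"
proof -
  let ?u = "\<sigma> w"
  have u: "?u \<in> A" using w by simp
  have f3: "\<phi> (\<phi> (\<phi> ?u)) = \<alpha> w"
    using face_four(1)[of "\<alpha> w"] w(1) by (simp add: face_succ_def)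
  have d3: "\<not> up (\<phi> (\<phi> (\<phi> ?u)))" using w f3 by simp
  have Lu: "L (tl_of (\<phi> ?u)) = L (tl_of w) + 1" "L (tl_of (\<phi> w)) = L (tl_of w) + 1"
    using L_tail_face_succ[OF u] L_tail_face_succ[OF w(1)] w by auto
  show ?thesis
  proof (cases "up (\<phi> ?u)")
    case False
    then have "up (\<phi> (\<phi> ?u))" using face_rises[OF u] w d3 by (auto split: if_splits)
    then have "\<psi> (\<phi> ?u) = \<phi> w"
      using contour_up_down_up[OF u w(3)] w(1) by (simp add: f3 face_succ_def[of q w])
    then show ?thesis using Lu returns_step[of l \<psi> "\<phi> ?u"] by simp
  next
    case True
    let ?x = "\<phi> (\<phi> ?u)"
    have x: "?x \<in> A" "\<not> up ?x" using opp_up_up(3)[OF u w(3) True] u by auto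
    have step: "\<psi> (\<phi> ?u) = \<sigma> ?x" using contour_up_up(1)[OF u w(3) True] .
    have Lx: "L (tl_of ?x) = L (tl_of w) + 2" "L (hd_of ?x) = L (tl_of w) + 1"
      using L_tail_face_succ[of "\<phi> ?u"] L_step[of ?x] x u True Lu by auto
    have rot: "\<sigma> (\<alpha> ?x) = \<alpha> w" using f3 by (simp add: face_succ_def)
    have "tl_of (\<alpha> ?x) \<noteq> v0" using Lx x L_root L_nonneg[of "tl_of w"] by auto
    then have "\<kappa> (\<alpha> ?x) = \<phi> w"
      using kappa_up[of "\<alpha> ?x"] kappa_down[of "\<alpha> w"] x w rot by (simp add: face_succ_def[of q w])
    moreover have "descends \<psi> l (\<phi> (\<alpha> ?x)) (\<kappa> (\<alpha> ?x))" using x Lx by (intro higher) auto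
    ultimately have "descends \<psi> l (\<psi> (\<phi> ?u)) (\<phi> w)" using step by simp
    then show ?thesis using Lu Lx step x by (intro returns_over) auto
  qed
qed

text \<open>
  At the tail of \<open>u\<close>, turn clockwise from \<open>u\<close> until a falling arc appears. If it is
  adjacent to \<open>u\<close>, the contour drops into the sector of \<open>u\<close> in one step. Otherwise the corner of \<open>u\<close> is
  followed, possibly after an excursion above its label, by the corner of the rising arc before \<open>u\<close>, which
  belongs to the same sector. The induction is on the number of turns inside a descending induction on
  the label, as the excursion needs the statement for the next larger label.
\<close>
lemma descends_kappa:
  assumes "u \<in> A" "up u" "tl_of u \<noteq> v0"
  shows "descends \<psi> l (\<phi> u) (\<kappa> u)"
proof -
  define m where "m = Max (L ` V)"
  have Lm: "L (tl_of a) \<le> m" if "a \<in> A" for a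
    using that by (simp add: m_def)
  show ?thesis using assms
  proof (induction "nat (m - L (tl_of u))" arbitrary: u rule: less_induct)
    case less
    have higher: "descends \<psi> l (\<phi> x) (\<kappa> x)"
      if "x \<in> A" "up x" "L (tl_of x) = L (tl_of u) + 1" for x
    proof (rule less.hyps)
      show "nat (m - L (tl_of x)) < nat (m - L (tl_of u))" using Lm[OF that(1)] that(3) by linarith
      show "tl_of x \<noteq> v0" using that(3) L_root L_nonneg[of "tl_of u"] by auto
    qed (use that in auto)
    obtain d where d: "d \<in> A" "tl_of d = tl_of u" "\<not> up d"
      using down_neighbour[of "tl_of u"] less.prems by auto
    \<comment> \<open>\<open>k\<close> counts the arcs counterclockwise from a falling arc \<open>d\<close> at the same vertex\<close>
    have claim: "descends \<psi> l (\<phi> y) (\<kappa> y)" if "(\<sigma> ^^ k) d = y" "up y" for k y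
      using that
    proof (induction k arbitrary: y)
      case 0
      then show ?case using d by simp
    next
      case (Suc k)
      define w where "w = (\<sigma> ^^ k) d"
      have w: "w \<in> A" "tl_of w = tl_of u" "\<sigma> w = y"
        using d Suc.prems by (auto simp: w_def funpow_rot_in tail_funpow_rot)
      show ?case
      proof (cases "up w")
        case True
        have "descends \<psi> l (\<phi> w) (\<kappa> w)" using Suc.IH[of w] True by (simp add: w_def)
        moreover have "\<kappa> w = \<kappa> y" using kappa_up[of w] True w less.prems(3) by simp
        moreover have "returns \<psi> l (\<phi> (\<sigma> w)) (\<phi> w)"
          using True w Suc.prems(2) higher by (intro returns_neighbour_aux) auto
        ultimately show ?thesis using returns_descends w(3) by metis
      next
        case False
        then have "y \<in> C" using w rot_corner[of w] by simp
        then obtain a where a: "a \<in> A" "up a" "y = \<phi> a" by (rule cornerE)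
        have "\<psi> (\<phi> y) = \<kappa> y" using contour_up_up(2)[of a] a Suc.prems(2) by simp
        moreover have "l (\<kappa> y) < l (\<phi> y)"
          using kappa_corner(2)[of y] L_tail_face_succ[of y] a Suc.prems(2) tail_rot[OF w(1)] w(2,3)
            less.prems(3) by (simp del: tail_face_succ)
        ultimately show ?thesis using descends_step[of l \<psi> "\<phi> y"] by simp
      qed
    qed
    have "u \<in> orbit \<sigma> d" using orbit_rot[OF d(1)] d less.prems by simp
    then show ?case using claim less.prems(2) by (auto simp: orbit_altdef)
  qed
qed

lemma returns_neighbour:
  assumes "w \<in> A" "up w" "up (\<sigma> w)"
  shows "returns \<psi> l (\<phi> (\<sigma> w)) (\<phi> w)"
proof (rule returns_neighbour_aux[OF assms])
  show "descends \<psi> l (\<phi> x) (\<kappa> x)" if "x \<in> A" "up x" "L (tl_of x) = L (tl_of w) + 1" for x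
    using that L_root L_nonneg[of "tl_of w"] by (intro descends_kappa) auto
qed

section \<open>The opening is a well labeled one-face map\<close>

lemma opening_simps[simp]:
  "verts (graph T) = V - {v0}" "arcs (graph T) = C" "tail (graph T) = tl_of"
  "head (graph T) = (\<lambda>a. tl_of (\<beta> a))" "opp T = \<beta>" "rot T = \<rho>"
  by (simp_all add: opening_drawing_def)

lemma vertex_corner:
  assumes "v \<in> V" "v \<noteq> v0"
  obtains b where "b \<in> C" "tl_of b = v"
proof -
  obtain a where "a \<in> A" "tl_of a = v" "\<not> up a" by (rule down_neighbour[OF assms])
  then show thesis using that[of "\<sigma> a"] by simp
qed

lemma rotation_system_opening: "rotation_system T"
proof (rule rotation_systemI)
  show "finite (verts (graph T))" "finite (arcs (graph T))"
    using finite_subset[OF corners_subset] by auto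
  show "tail (graph T) a \<in> verts (graph T)" if "a \<in> arcs (graph T)" for a
    using that corner_tail corners_subset by auto
  show "opp T a = a" if "a \<notin> arcs (graph T)" for a
    using that by (simp add: opening_opp_def perm_restrict_simps)
  show "rot T permutes arcs (graph T)"
    using first_return_permutes[OF rot_permutes finite_arcs corners_subset]
    by (simp add: opening_rot_def first_return_def[abs_def])
  show "cyclic_on (rot T) (out_arcs (graph T) v)"
    if v: "v \<in> verts (graph T)" "out_arcs (graph T) v \<noteq> {}" for v
  proof -
    have eq: "out_arcs (graph T) v = out_arcs (graph q) v \<inter> C"
      using corners_subset by auto
    obtain b where "b \<in> C" "tl_of b = v" using v(2) by (auto simp: out_arcs_def)
    then have "cyclic_on \<sigma> (out_arcs (graph q) v)" using rot_cyclic[of b] corners_subset by auto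
    then have "cyclic_on \<kappa> (out_arcs (graph q) v \<inter> C)"
      using v(2) unfolding eq by (rule cyclic_on_first_return)
    then show ?thesis unfolding eq
      by (subst cyclic_cong[where g = \<kappa>]) (auto simp: opening_rot_corner)
  qed
qed (auto simp: opening_opp_in opening_opp_opp opening_opp_neq)

sublocale T: rotation_drawing T
  by unfold_locales (rule rotation_system_opening)

lemma label_pos: "b \<in> C \<Longrightarrow> 1 \<le> l b"
  using L_pos[of "tl_of b"] corner_tail[of b] corners_subset by (auto simp: subset_iff)

lemma contour_in[simp]: "\<psi> b \<in> C \<longleftrightarrow> b \<in> C"
  using T.face_succ_in_arcs by simp

lemma orbit_contour_sym: "c \<in> orbit \<psi> b \<Longrightarrow> b \<in> orbit \<psi> c"
  using orbit_swap permutation_self_in_orbit[OF T.permutation_face_succ] by metis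

text \<open>
  From each corner the contour comes to a smaller label until label 1 is reached.
\<close>
lemma reaches_label_1:
  assumes "b \<in> C"
  shows "\<exists>c\<in>C. l c = 1 \<and> c \<in> orbit \<psi> b"
  using assms
proof (induction "nat (l b)" arbitrary: b rule: less_induct)
  case less
  show ?case
  proof (cases "l b = 1")
    case True
    then show ?thesis
      using less.prems permutation_self_in_orbit[OF T.permutation_face_succ] by blast
  next
    case False
    obtain u where u: "u \<in> A" "up u" "b = \<phi> u" by (rule cornerE[OF less.prems])
    have "l b = L (tl_of u) + 1" using L_tail_face_succ[of u] u by simp
    then have "tl_of u \<noteq> v0" using False L_root by auto
    then have "descends \<psi> l b (\<kappa> u)" "\<kappa> u \<in> C" using descends_kappa u kappa_corner by auto
    then have "l (\<kappa> u) < l b" using descends_label by metis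
    then have "nat (l (\<kappa> u)) < nat (l b)" using label_pos[OF less.prems] by linarith
    then obtain c where "c \<in> C" "l c = 1" "c \<in> orbit \<psi> (\<kappa> u)"
      using less.hyps \<open>\<kappa> u \<in> C\<close> by blast
    then show ?thesis using descends_orbit[OF \<open>descends \<psi> l b (\<kappa> u)\<close>] orbit_trans by metis
  qed
qed

text \<open>
  The corners of label 1 belong to the arcs leaving the basepoint. These all rise, and consecutive ones
  have their corners on the same contour.
\<close>
lemma label_1_same_face:
  assumes "b \<in> C" "l b = 1" "c \<in> C" "l c = 1"
  shows "c \<in> orbit \<psi> b"
proof -
  have root: "\<exists>u\<in>A. tl_of u = v0 \<and> x = \<phi> u" if x: "x \<in> C" "l x = 1" for x
  proof -
    obtain u where u: "u \<in> A" "up u" "x = \<phi> u" by (rule cornerE[OF x(1)])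
    then have "L (tl_of u) = 0" using L_tail_face_succ[of u] x(2) by simp
    then show ?thesis using u L_pos[of "tl_of u"] by force
  qed
  obtain u w where u: "u \<in> A" "tl_of u = v0" "b = \<phi> u" and w: "w \<in> A" "tl_of w = v0" "c = \<phi> w"
    using root assms by metis
  have "u \<in> orbit \<sigma> w" using orbit_rot u w by simp
  then have "u \<in> A \<and> tl_of u = v0 \<and> \<phi> w \<in> orbit \<psi> (\<phi> u)"
  proof induction
    case base
    then show ?case
      using returns_orbit[OF returns_neighbour[of w]] not_up_root[of w] not_up_root[of "\<sigma> w"] w by auto
  next
    case (step y)
    then show ?case
      using returns_orbit[OF returns_neighbour[of y]] not_up_root[of y] not_up_root[of "\<sigma> y"]
      by (auto intro: orbit_trans)
  qed
  then show ?thesis using u w by simp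
qed

lemma single_contour: "b \<in> C \<Longrightarrow> c \<in> C \<Longrightarrow> c \<in> orbit \<psi> b"
  using reaches_label_1[of b] reaches_label_1[of c] label_1_same_face orbit_contour_sym
  by (meson orbit_trans)

lemma faces_opening:
  assumes "C \<noteq> {}"
  shows "faces T = {C}"
proof -
  have "orbit \<psi> b = C" if "b \<in> C" for b
    using single_contour[OF that] permutes_orbit_subset[OF T.face_succ_permutes] that by auto
  then show ?thesis using assms by (auto simp: faces_def)
qed

lemma connected_opening:
  assumes "C \<noteq> {}"
  shows "connected (graph T)"
proof -
  obtain b where b: "b \<in> C" using assms by auto
  have reach: "tl_of b \<rightarrow>\<^sup>*\<^bsub>graph T\<^esub> tl_of c" if "c \<in> orbit \<psi> b" for c
    using that
  proof (induction)
    case base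
    have "tl_of b \<rightarrow>\<^bsub>graph T\<^esub> tl_of (\<psi> b)"
      using T.in_arcs_imp_in_arcs_ends[of b] b T.tail_face_succ[of b] by simp
    then show ?case by (rule T.reachable_adjI)
  next
    case (step c)
    then have "c \<in> C" using permutes_orbit_subset[OF T.face_succ_permutes, of b] b by auto
    then have "tl_of c \<rightarrow>\<^bsub>graph T\<^esub> tl_of (\<psi> c)"
      using T.in_arcs_imp_in_arcs_ends[of c] T.tail_face_succ[of c] by simp
    with step.IH show ?case by (rule T.reachable_adj_trans)
  qed
  show ?thesis
  proof (rule T.connectedI_root)
    show "tl_of b \<in> verts (graph T)" using T.tail_in_verts[of b] b by simp
    show "tl_of b \<rightarrow>\<^sup>*\<^bsub>graph T\<^esub> v" if v: "v \<in> verts (graph T)" for v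
    proof -
      obtain c where "c \<in> C" "tl_of c = v" using vertex_corner[of v] v by auto
      then show ?thesis using reach single_contour[OF b] by blast
    qed
  qed
qed

lemma card_corners: "2 * card C = card A"
proof -
  have "bij_betw (\<lambda>b. \<alpha> b) {a \<in> A. up a} {a \<in> A. \<not> up a}"
    by (rule bij_betw_byWitness[where f' = \<alpha>]) auto
  then have "card {a \<in> A. up a} = card {a \<in> A. \<not> up a}" by (rule bij_betw_same_card)
  moreover have "\<phi> ` {a \<in> A. up a} = C" by (auto elim: cornerE)
  then have "card C = card {a \<in> A. up a}"
    using card_image[of \<phi> "{a \<in> A. up a}"] permutes_inj[OF face_succ_permutes]
    by (metis inj_on_subset subset_UNIV)
  moreover have "card A = card {a \<in> A. up a} + card {a \<in> A. \<not> up a}"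
    by (subst card_Un_disjoint[symmetric]) (auto intro: arg_cong[where f = card])
  ultimately show ?thesis by simp
qed

lemma card_edges_opening: "card (edges T) = card (faces q)"
proof -
  have "4 * card (faces q) = card A" by (rule card_arcs_faces) (rule card_face_q)
  then show ?thesis using T.card_arcs_edges card_corners by simp
qed

lemma label_opp: "b \<in> C \<Longrightarrow> \<bar>l b - l (\<beta> b)\<bar> \<le> 1"
proof -
  assume "b \<in> C"
  then obtain a where a: "a \<in> A" "up a" "b = \<phi> a" by (rule cornerE)
  let ?a1 = "\<phi> a" and ?a2 = "\<phi> (\<phi> a)" and ?a3 = "\<phi> (\<phi> (\<phi> a))"
  have in_A: "?a1 \<in> A" "?a2 \<in> A" "?a3 \<in> A" using a by auto
  note four = face_four(1)[OF a(1)]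
  note lab = L_tail_face_succ[OF a(1)] L_tail_face_succ[OF in_A(1)] L_tail_face_succ[OF in_A(2)]
    L_tail_face_succ[OF in_A(3)]
  consider "up ?a1" | "up ?a2" | "up ?a3"
    using face_rises[OF a(1)] a(2) by (auto split: if_splits)
  then show ?thesis
  proof cases
    case 1
    then show ?thesis using opp_up_up(1)[OF a(1,2)] lab a in_A by simp
  next
    case 2
    then show ?thesis using opp_up_down_up[OF a(1,2) 2] lab a in_A by (simp del: tail_face_succ)
  next
    case 3
    have "\<beta> (\<phi> (\<phi> ?a3)) = \<phi> ?a3"
      using opp_up_up(2)[of ?a3] 3 a four by auto
    then show ?thesis using four lab a 3 by (simp del: tail_face_succ)
  qed
qed

lemma well_labeled_opening:
  assumes "C \<noteq> {}"
  shows "well_labeled T L"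
  unfolding well_labeled_def
proof
  show "\<forall>a\<in>arcs (graph T). \<bar>L (tail (graph T) a) - L (head (graph T) a)\<bar> \<le> 1"
    using label_opp by simp
  obtain c where c: "c \<in> C" "l c = 1" using reaches_label_1 assms by blast
  show "Min (L ` verts (graph T)) = 1"
  proof (rule Min_eqI)
    show "1 \<le> y" if "y \<in> L ` verts (graph T)" for y
      using that L_pos by fastforce
    show "1 \<in> L ` verts (graph T)"
      using c T.tail_in_verts[of c] by (metis image_eqI opening_simps(2,3))
  qed simp
qed

section \<open>The quadrangulation is determined by its opening\<close>

text \<open>
  A rising arc leads into its corner, whereas a falling arc precedes its corner counterclockwise
  around its tail. The two arcs of an edge get the same corner.
\<close>
definition code :: "'a \<Rightarrow> bool \<times> 'a" where
  "code a = (up a, if up a then \<phi> a else \<sigma> a)"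

lemma inj_contour: "inj \<psi>"
  by (rule permutes_inj[OF T.face_succ_permutes])

text \<open>
  The four cases are the possible directions of two consecutive arcs of a face. Two rises follow one
  side of a new edge upwards. A rise followed by a fall leads to the falling arc of the next
  corner around the vertex, and then the new edge does not go up. A fall followed by a rise turns around
  at a lower vertex, and the corners of the two edges are consecutive visits to a label. Two falls lead
  from a corner to its next lower corner; then the face also contains two rises and the contour enters the first of the
  two corners from below.
\<close>
lemma code_face_succ:
  assumes "a \<in> A"
  shows "code (\<phi> a) = closing_step \<beta> \<psi> l (code a)"
proof (cases "up a"; cases "up (\<phi> a)")
  assume up: "up a" "up (\<phi> a)"
  then have "\<beta> (\<phi> a) = \<phi> (\<phi> a)" "l (\<phi> a) < l (\<phi> (\<phi> a))"
    using opp_up_up(1)[OF assms] L_tail_face_succ[of "\<phi> a"] assms by auto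
  then show ?thesis using up by (simp add: code_def closing_step_simps del: tail_face_succ)
next
  assume up: "up a" "\<not> up (\<phi> a)"
  have c: "\<phi> a \<in> C" using up assms by simp
  have "\<rho> (\<phi> a) = \<sigma> (\<phi> a)" using c up assms by (simp add: opening_rot_corner kappa_down)
  then have "\<psi> (\<beta> (\<phi> a)) = \<sigma> (\<phi> a)" using opening_opp_opp[OF c] by (simp add: contour_eq)
  moreover have "\<not> l (\<phi> a) < l (\<beta> (\<phi> a))"
  proof -
    let ?a2 = "\<phi> (\<phi> a)" and ?a3 = "\<phi> (\<phi> (\<phi> a))"
    have in_A: "\<phi> a \<in> A" "?a2 \<in> A" "?a3 \<in> A" using assms by auto
    note four = face_four(1)[OF assms]
    note lab = L_tail_face_succ[OF assms] L_tail_face_succ[OF in_A(1)]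
      L_tail_face_succ[OF in_A(2)] L_tail_face_succ[OF in_A(3)]
    consider "up ?a2" | "up ?a3"
      using face_rises[OF assms] up by (auto split: if_splits)
    then show ?thesis
    proof cases
      case 1
      then show ?thesis using opp_up_down_up[OF assms up(1) 1] lab up by (simp del: tail_face_succ)
    next
      case 2
      have "\<beta> (\<phi> (\<phi> ?a3)) = \<phi> ?a3" using opp_up_up(2)[of ?a3] 2 assms up four by auto
      then show ?thesis using four lab 2 up by (simp del: tail_face_succ)
    qed
  qed
  ultimately show ?thesis using up by (simp add: code_def closing_step_simps del: tail_face_succ)
next
  assume up: "\<not> up a" "up (\<phi> a)"
  have "returns \<psi> l (\<phi> (\<sigma> (\<alpha> a))) (\<phi> (\<alpha> a))"
    using up assms by (intro returns_neighbour) (auto simp: face_succ_def)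
  then have "returns \<psi> l (\<phi> (\<phi> a)) (\<sigma> a)" by (simp add: face_succ_def)
  then show ?thesis using up closing_step_returns[OF _ inj_contour] by (simp add: code_def)
next
  assume up: "\<not> up a" "\<not> up (\<phi> a)"
  let ?b = "\<phi> (\<phi> a)"
  have four: "\<phi> (\<phi> ?b) = a" using face_four(1)[OF assms] .
  have b: "?b \<in> A" "up ?b" "up (\<phi> ?b)"
    using face_rises[OF assms] up assms by (auto split: if_splits)
  have "\<psi> (\<phi> ?b) = \<sigma> a" using contour_up_up(1)[OF b] four by simp
  moreover have "l (\<phi> ?b) < l (\<sigma> a)"
    using L_tail_face_succ[of "\<phi> ?b"] b four assms by (simp del: tail_face_succ)
  ultimately have no: "\<not> (\<exists>e. returns \<psi> l e (\<sigma> a))"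
    using no_return_after_rise[OF inj_contour, of l "\<phi> ?b"] by metis
  have tl: "tl_of (\<alpha> a) \<noteq> v0" using not_up_root[of "\<phi> a"] up assms by simp
  have "\<kappa> (\<alpha> a) = \<sigma> (\<phi> a)"
    using kappa_up[of "\<alpha> a"] kappa_down[of "\<phi> a"] tl up assms by (simp add: face_succ_def)
  moreover have "descends \<psi> l (\<phi> (\<alpha> a)) (\<kappa> (\<alpha> a))" using tl up assms by (intro descends_kappa) auto
  ultimately have "descends \<psi> l (\<sigma> a) (\<sigma> (\<phi> a))" by simp
  then have "closing_step \<beta> \<psi> l (False, \<sigma> a) = (False, \<sigma> (\<phi> a))"
    using no by (rule closing_step_descends)
  then show ?thesis using up by (simp add: code_def)
qed

lemma code_opp: "a \<in> A \<Longrightarrow> code (\<alpha> a) = map_prod Not id (code a)"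
  by (simp add: code_def face_succ_def)

lemma bij_code: "bij_betw code A (UNIV \<times> C)"
proof -
  \<comment> \<open>a rising arc is the face predecessor of its corner, a falling arc the rotation predecessor\<close>
  define g where "g = (\<lambda>(u, b). if u then inv \<phi> b else inv \<sigma> b)"
  have inv_rot: "inv \<sigma> (\<sigma> a) = a" for a
    using permutes_inj[OF rot_permutes] by (simp add: inv_f_f)
  have "code (g x) = x \<and> g x \<in> A" if x: "x \<in> UNIV \<times> C" for x
  proof -
    obtain u b where ub: "x = (u, b)" "b \<in> C" using x by auto
    obtain a where a: "a \<in> A" "up a" "b = \<phi> a" by (rule cornerE[OF ub(2)])
    have "b = \<sigma> (\<alpha> a)" using a by (simp add: face_succ_def)
    then have "inv \<sigma> b = \<alpha> a" "\<sigma> (\<alpha> a) = b" using inv_rot by simp_all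
    then show ?thesis using a ub by (cases u) (auto simp: g_def code_def)
  qed
  moreover have "g (code a) = a" if "a \<in> A" for a
    using inv_rot by (simp add: g_def code_def)
  moreover have "code a \<in> UNIV \<times> C" if "a \<in> A" for a
    using that by (simp add: code_def)
  ultimately show ?thesis by (intro bij_betw_byWitness[where f' = g]) blast+
qed

text \<open>
  A rising arc starts at the next lower corner of the contour, and at the basepoint if its corner has
  label 1. So tails, too, are visible in the opened drawing.
\<close>
lemma tail_code:
  assumes "a \<in> A"
  shows "\<not> up a \<Longrightarrow> tl_of a = tl_of (snd (code a))"
    and "up a \<Longrightarrow> l (snd (code a)) = 1 \<Longrightarrow> tl_of a = v0"
    and "up a \<Longrightarrow> l (snd (code a)) \<noteq> 1 \<Longrightarrow> descends \<psi> l (snd (code a)) c \<Longrightarrow> tl_of a = tl_of c"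
    and "up a \<Longrightarrow> l (snd (code a)) \<noteq> 1 \<Longrightarrow> \<exists>c\<in>C. descends \<psi> l (snd (code a)) c"
proof -
  show "\<not> up a \<Longrightarrow> tl_of a = tl_of (snd (code a))" using assms by (simp add: code_def)
  show "up a \<Longrightarrow> l (snd (code a)) = 1 \<Longrightarrow> tl_of a = v0"
    using L_tail_face_succ[OF assms] L_pos[of "tl_of a"] assms
    by (force simp: code_def simp del: tail_face_succ)
  assume up: "up a" "l (snd (code a)) \<noteq> 1"
  then have "tl_of a \<noteq> v0"
    using L_tail_face_succ[OF assms] L_root by (auto simp: code_def simp del: tail_face_succ)
  then have d: "descends \<psi> l (snd (code a)) (\<kappa> a)" "tl_of (\<kappa> a) = tl_of a" "\<kappa> a \<in> C"
    using descends_kappa[OF assms up(1)] kappa_corner[OF assms] up(1) by (auto simp: code_def)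
  show "\<exists>c\<in>C. descends \<psi> l (snd (code a)) c" using d by blast
  show "descends \<psi> l (snd (code a)) c \<Longrightarrow> tl_of a = tl_of c"
    using descends_unique[OF d(1)] d(2) by metis
qed

end

section \<open>Closing a well labeled one-face map\<close>

text \<open>
  Among all points with \<open>P\<close> from which \<open>b\<close> is reached, one at minimal distance has no other such point
  in between.
\<close>
lemma nearest_before:
  assumes "P x" "b \<in> orbit f x"
  obtains e k where "0 < k" "(f ^^ k) e = b" "P e" "\<forall>i. 0 < i \<and> i < k \<longrightarrow> \<not> P ((f ^^ i) e)"
proof -
  define Q where "Q = (\<lambda>k. 0 < k \<and> (\<exists>e. P e \<and> (f ^^ k) e = b))"
  have "\<exists>k. Q k" using assms by (auto simp: orbit_altdef Q_def)
  then have "Q (LEAST k. Q k)" by (rule LeastI_ex)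
  then obtain e where e: "P e" "(f ^^ (LEAST k. Q k)) e = b" "0 < (LEAST k. Q k)"
    by (auto simp: Q_def)
  have "\<not> P ((f ^^ i) e)" if i: "0 < i" "i < (LEAST k. Q k)" for i
  proof
    assume P: "P ((f ^^ i) e)"
    have "(f ^^ ((LEAST k. Q k) - i)) ((f ^^ i) e) = b"
      using e(2) i(2) by (metis funpow_add le_add_diff_inverse2 less_imp_le o_apply)
    then have "Q ((LEAST k. Q k) - i)" using P i unfolding Q_def by auto
    then show False using not_less_Least[of "(LEAST k. Q k) - i" Q] i by simp
  qed
  then show thesis using that e by blast
qed

lemma card_orbit_four:
  assumes "f (f (f (f x))) = x" "f (f x) \<noteq> x"
  shows "card (orbit f x) = 4"
proof -
  have "(f ^^ 4) x = x" using assms(1) by (simp add: eval_nat_numeral)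
  then have "orbit f x = {(f ^^ m) x |m. m < 4}" by (rule orbit_altdef_bounded) simp
  also have "\<dots> = {x, f x, f (f x), f (f (f x))}"
    by (auto simp: less_Suc_eq numeral_eq_Suc intro: exI[of _ 0] exI[of _ "Suc 0"]
        exI[of _ "Suc (Suc 0)"] exI[of _ "Suc (Suc (Suc 0))"])
  finally have orb: "orbit f x = {x, f x, f (f x), f (f (f x))}" .
  have "f x \<noteq> x" "f (f (f x)) \<noteq> x" using assms by metis+
  moreover have "f (f x) \<noteq> f x" "f (f (f x)) \<noteq> f x" "f (f (f x)) \<noteq> f (f x)"
    using assms by metis+
  ultimately show ?thesis unfolding orb using assms(2) by (simp add: card_insert_if eq_commute)
qed

text \<open>
  The arcs are the pairs \<open>(u, b)\<close> of \<open>closing_step\<close>, the new vertex is \<open>None\<close>. The rotation is forced by the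
  face permutation: turning around a vertex means reversing the arc and then taking a face step.
\<close>
definition closing_drawing :: "('v, 'a) drawing \<Rightarrow> ('v \<Rightarrow> int) \<Rightarrow> ('v option, bool \<times> 'a) drawing" where
  "closing_drawing t l =
     (let lab = (\<lambda>b. l (tail (graph t) b));
          X = UNIV \<times> arcs (graph t);
          op = perm_restrict (map_prod Not id) X;
          tl = (\<lambda>(u, b). if \<not> u then Some (tail (graph t) b)
                 else if lab b = 1 then None
                 else Some (tail (graph t) (THE c. descends (face_succ t) lab b c)))
      in \<lparr> graph = \<lparr> verts = insert None (Some ` verts (graph t)), arcs = X, tail = tl, head = tl \<circ> op \<rparr>,
           opp = op,
           rot = perm_restrict (closing_step (opp t) (face_succ t) lab \<circ> map_prod Not id) X \<rparr>)"

text \<open>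
  A well labeled map with one face and at least one edge, in the form in which the closing uses it.
\<close>
locale labeled_contour = rotation_drawing t for t :: "('v, 'a) drawing" +
  fixes lb :: "'v \<Rightarrow> int"
  assumes single_face: "b \<in> A \<Longrightarrow> c \<in> A \<Longrightarrow> c \<in> orbit \<phi> b"
    and lipschitz: "b \<in> A \<Longrightarrow> \<bar>lb (tl_of b) - lb (hd_of b)\<bar> \<le> 1"
    and no_isolated: "v \<in> V \<Longrightarrow> \<exists>b\<in>A. tl_of b = v"
    and label_ge_1: "v \<in> V \<Longrightarrow> 1 \<le> lb v"
    and label_1_ex: "\<exists>v\<in>V. lb v = 1"
begin

abbreviation "lab \<equiv> (\<lambda>b. lb (tl_of b))"
abbreviation "X \<equiv> (UNIV :: bool set) \<times> A"
abbreviation "step \<equiv> closing_step \<alpha> \<phi> lab"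
abbreviation "Q \<equiv> closing_drawing t lb"

lemma lab_opp: "b \<in> A \<Longrightarrow> lab (\<alpha> b) = lab (\<phi> b)"
  by simp

lemma lab_step: "b \<in> A \<Longrightarrow> \<bar>lab b - lab (\<phi> b)\<bar> \<le> 1"
  using lipschitz by simp

lemma inj_face_succ: "inj \<phi>"
  by (rule permutes_inj[OF face_succ_permutes])

lemma funpow_in: "(\<phi> ^^ k) b \<in> A \<longleftrightarrow> b \<in> A"
  by (induction k) auto

lemma returns_in: "returns \<phi> lab e b \<Longrightarrow> e \<in> A \<longleftrightarrow> b \<in> A"
  using funpow_in by (auto simp: returns_def)

lemma descends_in: "descends \<phi> lab b c \<Longrightarrow> c \<in> A \<longleftrightarrow> b \<in> A"
  using funpow_in by (auto simp: descends_def)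

lemma face_pred:
  assumes "b \<in> A"
  obtains a where "a \<in> A" "b = \<phi> a"
  using permutes_surj[OF face_succ_permutes] assms by (metis face_succ_in_arcs surjD)

lemma label_1_arc:
  obtains b where "b \<in> A" "lab b = 1"
  using label_1_ex no_isolated by blast

text \<open>
  The nearest earlier corner that is not above \<open>\<phi> a\<close> cannot be strictly below it: labels change by at
  most one, so the corner after it would be nearer; and \<open>a\<close> itself is not below \<open>\<phi> a\<close> by assumption.
\<close>
lemma returns_ex:
  assumes "a \<in> A" "lab (\<phi> a) \<le> lab a"
  shows "\<exists>e. returns \<phi> lab e (\<phi> a)"
proof -
  let ?b = "\<phi> a"
  let ?P = "\<lambda>e. e \<in> A \<and> lab e \<le> lab ?b"
  have P: "?P ?b" using assms by simp
  have self: "?b \<in> orbit \<phi> ?b" by (rule permutation_self_in_orbit[OF permutation_face_succ])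
  obtain e k where e: "0 < k" "(\<phi> ^^ k) e = ?b" "?P e" "\<forall>i. 0 < i \<and> i < k \<longrightarrow> \<not> ?P ((\<phi> ^^ i) e)"
    by (rule nearest_before[of ?P, OF P self])
  have "lab e = lab ?b"
  proof (rule ccontr)
    assume less: "lab e \<noteq> lab ?b"
    show False
    proof (cases "k = 1")
      case True
      then have "e = a" using e(2) inj_face_succ by (auto dest: injD)
      then show False using less e(3) assms(2) by simp
    next
      case False
      then have "\<not> ?P (\<phi> e)" using e(1) e(4)[rule_format, of 1] by simp
      then show False using e(3) less lab_step[of e] by auto
    qed
  qed
  moreover have "\<forall>i. 0 < i \<and> i < k \<longrightarrow> lab ?b < lab ((\<phi> ^^ i) e)"
    using e(3,4) funpow_in by (meson not_less)
  ultimately show ?thesis using e(1,2) unfolding returns_def by blast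
qed

text \<open>
  Some corner has label 1, and all corners lie on one contour.
\<close>
lemma descends_ex:
  assumes "b \<in> A" "lab b \<noteq> 1"
  shows "\<exists>c\<in>A. descends \<phi> lab b c"
proof -
  obtain c where c: "c \<in> A" "lab c = 1" by (rule label_1_arc)
  define P where "P = (\<lambda>k. lab ((\<phi> ^^ k) b) < lab b)"
  have "1 \<le> lab b" using label_ge_1 assms(1) by simp
  then have "lab c < lab b" using assms(2) c(2) by linarith
  then have "\<exists>k. P k"
    using single_face[OF assms(1) c(1)] by (auto simp: P_def orbit_altdef)
  then have least: "P (LEAST k. P k)" by (rule LeastI_ex)
  have "lab b \<le> lab ((\<phi> ^^ j) b)" if "j < (LEAST k. P k)" for j
    using not_less_Least[OF that] by (simp add: P_def)
  moreover have "0 < (LEAST k. P k)" using least by (cases "LEAST k. P k") (auto simp: P_def)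
  ultimately have "descends \<phi> lab b ((\<phi> ^^ (LEAST k. P k)) b)"
    using least unfolding descends_def P_def by blast
  then show ?thesis using funpow_in assms(1) by blast
qed

lemma lab_descends:
  assumes "descends \<phi> lab b c" "b \<in> A"
  shows "lab c = lab b - 1"
proof -
  obtain k where k: "0 < k" "(\<phi> ^^ k) b = c" "lab c < lab b" "\<forall>j<k. lab b \<le> lab ((\<phi> ^^ j) b)"
    using assms(1) by (auto simp: descends_def)
  obtain m where m: "k = Suc m" using k(1) by (cases k) auto
  have "lab b \<le> lab ((\<phi> ^^ m) b)" "c = \<phi> ((\<phi> ^^ m) b)" using k m by auto
  moreover have "\<bar>lab ((\<phi> ^^ m) b) - lab (\<phi> ((\<phi> ^^ m) b))\<bar> \<le> 1"
    using lab_step[of "(\<phi> ^^ m) b"] funpow_in[of m b] assms(2) by simp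
  ultimately show ?thesis using k(3) by (simp del: tail_face_succ)
qed

lemma the_descends: "descends \<phi> lab b c \<Longrightarrow> (THE c. descends \<phi> lab b c) = c"
  by (intro the_equality) (auto intro: descends_unique)

lemma no_return_iff:
  assumes "a \<in> A"
  shows "(\<exists>e. returns \<phi> lab e (\<phi> a)) \<longleftrightarrow> lab (\<phi> a) \<le> lab a"
  using returns_ex[OF assms] no_return_after_rise[OF inj_face_succ, of lab a] by (metis not_le)

text \<open>
  The face that is cut by an edge \<open>{b, \<alpha> b}\<close> going up from \<open>b\<close>: two rises, then two falls.
\<close>
lemma step_face_rise:
  assumes "b \<in> A" "lab b < lab (\<alpha> b)" "descends \<phi> lab (\<phi> b) s"
  shows "step (True, b) = (True, \<alpha> b)" "step (True, \<alpha> b) = (False, \<phi> b)"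
    "step (False, \<phi> b) = (False, s)" "step (False, s) = (True, b)" "s \<in> A"
proof -
  have lab: "lab (\<phi> b) = lab (\<alpha> b)" "lab (\<alpha> b) = lab b + 1"
    using assms lab_step[of b] lab_opp[of b] by linarith+
  show "step (True, b) = (True, \<alpha> b)" using assms by (intro closing_step_simps)
  show "step (True, \<alpha> b) = (False, \<phi> b)" using closing_step_simps(2)[of lab "\<alpha> b" \<alpha> \<phi>] assms by simp
  have "\<not> (\<exists>e. returns \<phi> lab e (\<phi> b))" using no_return_iff[OF assms(1)] lab assms(2) by simp
  with assms(3) show "step (False, \<phi> b) = (False, s)" by (rule closing_step_descends)
  show "s \<in> A" using descends_in[OF assms(3)] assms(1) by simp
  have "returns \<phi> lab b s"
    using assms lab lab_descends[OF assms(3)] by (intro returns_over) auto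
  then show "step (False, s) = (True, b)" using inj_face_succ by (rule closing_step_returns)
qed

text \<open>
  Half of the face that is cut by a horizontal edge \<open>{b, \<alpha> b}\<close>; the other half arises by exchanging the
  roles of \<open>b\<close> and \<open>\<alpha> b\<close>.
\<close>
lemma step_face_flat:
  assumes "b \<in> A" "lab b = lab (\<alpha> b)"
  shows "step (True, b) = (False, \<phi> (\<alpha> b))" "step (False, \<phi> (\<alpha> b)) = (True, \<alpha> b)"
proof -
  show "step (True, b) = (False, \<phi> (\<alpha> b))" using assms by (intro closing_step_simps) simp
  have "returns \<phi> lab (\<alpha> b) (\<phi> (\<alpha> b))" using assms by (intro returns_step) simp
  then show "step (False, \<phi> (\<alpha> b)) = (True, \<alpha> b)" using inj_face_succ by (rule closing_step_returns)
qed

lemma descends_after_rise: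
  assumes "b \<in> A" "lab b < lab (\<alpha> b)"
  obtains s where "descends \<phi> lab (\<phi> b) s"
proof -
  have "lab (\<phi> b) \<noteq> 1" using assms label_ge_1[of "tl_of b"] by auto
  then show thesis using descends_ex[of "\<phi> b"] assms(1) that by auto
qed

text \<open>
  The edge \<open>{b, \<alpha> b}\<close> cuts a single face, and the two rising arcs of that face are those of \<open>b\<close> and \<open>\<alpha> b\<close>.
  An edge that goes down from \<open>b\<close> goes up from \<open>\<alpha> b\<close>, which turns the third case into the first.
\<close>
lemma step_True:
  assumes "b \<in> A"
  shows "step (step (step (step (True, b)))) = (True, b)" "step (step (True, b)) \<noteq> (True, b)"
    "step (True, b) \<in> X" "step (step (True, b)) \<in> X" "step (step (step (True, b))) \<in> X"
    "(True, \<alpha> b) \<in> orbit step (True, b)"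
proof -
  have ab: "\<alpha> b \<in> A" "\<alpha> (\<alpha> b) = b" "\<alpha> b \<noteq> b" using assms arev_neq by auto
  have "step (step (step (step (True, b)))) = (True, b) \<and> step (step (True, b)) \<noteq> (True, b) \<and>
    step (True, b) \<in> X \<and> step (step (True, b)) \<in> X \<and> step (step (step (True, b))) \<in> X \<and>
    (True, \<alpha> b) \<in> {step (True, b), step (step (True, b)), step (step (step (True, b)))}"
  proof -
    consider "lab b < lab (\<alpha> b)" | "lab b = lab (\<alpha> b)" | "lab (\<alpha> b) < lab b" by linarith
    then show ?thesis
    proof cases
      case 1
      then obtain s where "descends \<phi> lab (\<phi> b) s" by (rule descends_after_rise[OF assms])
      then show ?thesis using step_face_rise[OF assms 1] assms ab by simp
    next
      case 2
      then show ?thesis using step_face_flat[OF assms 2] step_face_flat[OF ab(1)] ab assms by simp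
    next
      case 3
      then have r: "lab (\<alpha> b) < lab (\<alpha> (\<alpha> b))" using ab by simp
      then obtain s where "descends \<phi> lab (\<phi> (\<alpha> b)) s" by (rule descends_after_rise[OF ab(1)])
      then show ?thesis using step_face_rise[OF ab(1) r] assms ab by simp
    qed
  qed
  moreover have "{step (True, b), step (step (True, b)), step (step (step (True, b)))} \<subseteq> orbit step (True, b)"
    by (auto intro: orbit.intros)
  ultimately show "step (step (step (step (True, b)))) = (True, b)" "step (step (True, b)) \<noteq> (True, b)"
    "step (True, b) \<in> X" "step (step (True, b)) \<in> X" "step (step (step (True, b))) \<in> X"
    "(True, \<alpha> b) \<in> orbit step (True, b)"
    by blast+
qed

text \<open>
  Every face contains a rise: if the contour climbs into \<open>d\<close>, the falling arc of \<open>d\<close> belongs to the face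
  cut by the last edge before \<open>d\<close>, and otherwise to the face cut by the edge after the previous visit
  to the label of \<open>d\<close>.
\<close>
lemma step_False:
  assumes "d \<in> A"
  shows "\<exists>b\<in>A. (False, d) = step (step (True, b)) \<or> (False, d) = step (step (step (True, b)))"
proof -
  obtain a where a: "a \<in> A" "d = \<phi> a" by (rule face_pred[OF assms])
  show ?thesis
  proof (cases "lab a < lab d")
    case True
    then have r: "lab a < lab (\<alpha> a)" using a by simp
    then obtain s where "descends \<phi> lab (\<phi> a) s" by (rule descends_after_rise[OF a(1)])
    then show ?thesis using step_face_rise[OF a(1) r] a by (intro bexI[of _ a]) auto
  next
    case False
    then obtain e where ret: "returns \<phi> lab e d" using returns_ex[OF a(1)] a(2) by auto
    have e: "e \<in> A" using returns_in[OF ret] assms by simp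
    obtain k where k: "0 < k" "(\<phi> ^^ k) e = d" "lab e = lab d"
      "\<forall>j. 0 < j \<and> j < k \<longrightarrow> lab d < lab ((\<phi> ^^ j) e)"
      using ret by (auto simp: returns_def)
    show ?thesis
    proof (cases "k = 1")
      case True
      then have "lab e = lab (\<alpha> e)" "d = \<phi> e" using k e by auto
      then show ?thesis using step_face_flat[OF e] step_face_flat[of "\<alpha> e"] e by (intro bexI[of _ e]) auto
    next
      case False
      obtain m where m: "k = Suc m" "0 < m" using k(1) False by (cases k) auto
      have r: "lab e < lab (\<phi> e)" using k(3) k(4)[rule_format, of 1] m by simp
      have step1: "lab (\<phi> e) = lab d + 1" using r k(3) lab_step[OF e] by linarith
      have "lab (\<phi> e) \<le> lab ((\<phi> ^^ j) (\<phi> e))" if "j < m" for j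
      proof -
        have "lab d < lab ((\<phi> ^^ Suc j) e)" using k(4)[rule_format, of "Suc j"] that m by simp
        then show ?thesis using step1 by (simp add: funpow_swap1)
      qed
      moreover have "(\<phi> ^^ m) (\<phi> e) = d" using k(2) m by (simp add: funpow_swap1)
      ultimately have "descends \<phi> lab (\<phi> e) d"
        unfolding descends_def using m(2) r k(3) by (intro exI[of _ m]) auto
      then show ?thesis using step_face_rise[OF e] r e by (intro bexI[of _ e]) auto
    qed
  qed
qed

lemma
  assumes "x \<in> X"
  shows step_four: "step (step (step (step x))) = x" and step_two: "step (step x) \<noteq> x"
    and step_in: "step x \<in> X"
proof -
  obtain u b where x: "x = (u, b)" "b \<in> A" using assms by auto
  have "step (step (step (step x))) = x \<and> step (step x) \<noteq> x \<and> step x \<in> X"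
  proof (cases u)
    case True
    then show ?thesis using step_True[OF x(2)] x by simp
  next
    case False
    then obtain c where c: "c \<in> A" "x = step (step (True, c)) \<or> x = step (step (step (True, c)))"
      using step_False[OF x(2)] x by auto
    note c4 = step_True[OF c(1)]
    have "step (step (step (True, c))) \<noteq> step (True, c)" using c4(1,2) by metis
    then show ?thesis using c(2) c4 c(1) by auto
  qed
  then show "step (step (step (step x))) = x" "step (step x) \<noteq> x" "step x \<in> X" by auto
qed

abbreviation "flip \<equiv> map_prod Not (id :: 'a \<Rightarrow> 'a)"

definition tlQ :: "bool \<times> 'a \<Rightarrow> 'v option" where
  "tlQ = (\<lambda>(u, b). if \<not> u then Some (tl_of b) else if lab b = 1 then None
     else Some (tl_of (THE c. descends \<phi> lab b c)))"

lemma closing_simps[simp]: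
  "verts (graph Q) = insert None (Some ` V)" "arcs (graph Q) = X" "tail (graph Q) = tlQ"
  "head (graph Q) x = tlQ (opp Q x)"
  by (simp_all add: closing_drawing_def Let_def tlQ_def)

lemma opp_closing[simp]: "x \<in> X \<Longrightarrow> opp Q x = flip x"
  by (simp add: closing_drawing_def Let_def perm_restrict_simps)

lemma rot_closing: "x \<in> X \<Longrightarrow> rot Q x = step (flip x)"
  by (simp add: closing_drawing_def Let_def perm_restrict_simps)

lemma flip_in[simp]: "flip x \<in> X \<longleftrightarrow> x \<in> X" and flip_flip[simp]: "flip (flip x) = x"
  by (cases x; simp)+

lemma face_succ_closing: "x \<in> X \<Longrightarrow> face_succ Q x = step x"
  by (simp add: face_succ_def rot_closing del: mem_Times_iff)

lemma tlQ_simps: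
  "tlQ (False, b) = Some (tl_of b)"
  "lab b = 1 \<Longrightarrow> tlQ (True, b) = None"
  "lab b \<noteq> 1 \<Longrightarrow> descends \<phi> lab b c \<Longrightarrow> tlQ (True, b) = Some (tl_of c)"
  by (simp_all add: tlQ_def the_descends)

lemma rot_closing_in: "x \<in> X \<Longrightarrow> rot Q x \<in> X"
  using step_in[of "flip x"] by (simp add: rot_closing del: mem_Times_iff)

lemma tlQ_rot:
  assumes "x \<in> X"
  shows "tlQ (rot Q x) = tlQ x"
proof -
  obtain u b where x: "x = (u, b)" "b \<in> A" using assms by auto
  have rot: "rot Q x = step (\<not> u, b)" using rot_closing[OF assms] x by simp
  show ?thesis
  proof (cases u)
    case False
    show ?thesis
    proof (cases "lab b < lab (\<alpha> b)")
      case True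
      have "lab (\<phi> (\<alpha> b)) < lab (\<alpha> b)" using True x(2) by simp
      then have "descends \<phi> lab (\<alpha> b) (\<phi> (\<alpha> b))" by (rule descends_step)
      moreover have "lab (\<alpha> b) \<noteq> 1" using True label_ge_1[of "tl_of b"] x(2) by simp
      ultimately have "tlQ (True, \<alpha> b) = Some (tl_of (\<phi> (\<alpha> b)))" by (intro tlQ_simps)
      then show ?thesis using True False rot x by (simp add: closing_step_simps tlQ_simps)
    next
      case notless: False
      then have "rot Q x = (False, \<phi> (\<alpha> b))" using False rot by (simp add: closing_step_simps)
      then show ?thesis using False x by (simp add: tlQ_simps)
    qed
  next
    case True
    show ?thesis
    proof (cases "\<exists>e. returns \<phi> lab e b")
      case ex: True
      then obtain e where e: "returns \<phi> lab e b" by blast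
      have rote: "rot Q x = (True, e)" using rot True closing_step_returns[OF e inj_face_succ] by simp
      show ?thesis
      proof (cases "lab b = 1")
        case one: True
        then show ?thesis using rote x True returns_label[OF e] by (simp add: tlQ_simps)
      next
        case False
        then obtain c where c: "descends \<phi> lab b c" using descends_ex x(2) by blast
        then have "descends \<phi> lab e c" using returns_descends[OF e] by blast
        then show ?thesis
          using tlQ_simps(3)[OF _ c] tlQ_simps(3)[of e c] rote x True False returns_label[OF e] by simp
      qed
    next
      case no: False
      obtain a where a: "a \<in> A" "b = \<phi> a" by (rule face_pred[OF x(2)])
      have "lab b \<noteq> 1" using no_return_iff[OF a(1)] no a label_ge_1[of "tl_of a"] by simp
      then obtain c where c: "descends \<phi> lab b c" using descends_ex x(2) by blast
      then have "rot Q x = (False, c)" using rot True closing_step_descends[OF c no] by simp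
      then show ?thesis using tlQ_simps(3)[OF \<open>lab b \<noteq> 1\<close> c] x True by (simp add: tlQ_simps)
    qed
  qed
qed

text \<open>
  Going back from \<open>b\<close> to the previous visit of the same label, again and again, passes every such visit as
  long as the contour does not fall below this label.
\<close>
lemma returns_chain:
  assumes "(\<phi> ^^ j) e = b" "e \<in> A" "lab e = lab b" "\<forall>i\<le>j. lab b \<le> lab ((\<phi> ^^ i) e)"
  shows "(returns \<phi> lab)\<^sup>*\<^sup>* e b"
  using assms
proof (induction j arbitrary: b rule: less_induct)
  case (less j)
  show ?case
  proof (cases j)
    case 0
    then show ?thesis using less.prems by simp
  next
    case (Suc m)
    let ?a = "(\<phi> ^^ m) e"
    have "?a \<in> A" "b = \<phi> ?a" "lab b \<le> lab ?a" using less.prems Suc funpow_in by auto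
    then obtain e1 where e1: "returns \<phi> lab e1 b" using returns_ex by metis
    then obtain k where k: "0 < k" "(\<phi> ^^ k) e1 = b" "lab e1 = lab b"
      "\<forall>i. 0 < i \<and> i < k \<longrightarrow> lab b < lab ((\<phi> ^^ i) e1)"
      by (auto simp: returns_def)
    have cancel: "(\<phi> ^^ i) x = y" if eq: "(\<phi> ^^ (i + j)) x = (\<phi> ^^ j) y" for i j x y
      using eq inj_fn[OF inj_face_succ, of j] by (simp add: add.commute[of i] funpow_add inj_eq)
    have "k \<le> j"
    proof (rule ccontr)
      assume "\<not> k \<le> j"
      then have "(\<phi> ^^ (k - j)) e1 = e" using cancel[of "k - j" j e1 e] k(2) less.prems(1) by simp
      then show False
        using k(4)[rule_format, of "k - j"] less.prems(3) \<open>\<not> k \<le> j\<close> Suc by auto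
    qed
    then have "(\<phi> ^^ (j - k)) e = e1" using cancel[of "j - k" k e e1] k(2) less.prems(1) by simp
    then have "(returns \<phi> lab)\<^sup>*\<^sup>* e e1"
      using less.IH[of "j - k" e1] k(1,3) \<open>k \<le> j\<close> less.prems by simp
    then show ?thesis using e1 by simp
  qed
qed

lemma lowest_start:
  assumes "b \<in> A" "lab b \<noteq> 1"
  obtains e where "e \<in> A" "(returns \<phi> lab)\<^sup>*\<^sup>* e b" "\<not> (\<exists>e'. returns \<phi> lab e' e)" "lab e = lab b"
proof -
  obtain x where x: "x \<in> A" "lab x = 1" by (rule label_1_arc)
  let ?P = "\<lambda>e. e \<in> A \<and> lab e < lab b"
  have "1 \<le> lab b" using label_ge_1 assms(1) by simp
  then have "?P x" using x assms by simp
  moreover have "b \<in> orbit \<phi> x" using single_face x assms by simp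
  ultimately obtain e k where e: "0 < k" "(\<phi> ^^ k) e = b" "?P e" "\<forall>i. 0 < i \<and> i < k \<longrightarrow> \<not> ?P ((\<phi> ^^ i) e)"
    by (rule nearest_before[of ?P])
  obtain m where m: "k = Suc m" using e(1) by (cases k) auto
  have ge: "lab b \<le> lab ((\<phi> ^^ i) (\<phi> e))" if "i \<le> m" for i
  proof (cases "i = m")
    case True
    then show ?thesis using e(2) m by (simp add: funpow_swap1)
  next
    case False
    then have "\<not> ?P ((\<phi> ^^ Suc i) e)" using e(4)[rule_format, of "Suc i"] that m by simp
    then show ?thesis using e(3) funpow_in[of "Suc i" e] by (simp add: funpow_swap1 not_less)
  qed
  have lab: "lab (\<phi> e) = lab b" using ge[of 0] lab_step[of e] e(3) by simp
  show thesis
  proof (rule that)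
    show "\<phi> e \<in> A" using e(3) by simp
    show "lab (\<phi> e) = lab b" by (rule lab)
    show "(returns \<phi> lab)\<^sup>*\<^sup>* (\<phi> e) b"
      using e(2,3) m ge lab by (intro returns_chain[of m]) (auto simp: funpow_swap1)
    show "\<not> (\<exists>e'. returns \<phi> lab e' (\<phi> e))"
      using no_return_iff[of e] e(3) lab by simp
  qed
qed

text \<open>
  The corners whose next lower corner is \<open>c\<close> have the same label and form a chain under \<open>returns\<close>. It starts at a corner
  that the contour enters from below, and the rotation runs backwards through the rising arcs of the chain until
  it comes to the falling arc of \<open>c\<close>.
\<close>
lemma climb_induct:
  assumes "b \<in> A" "descends \<phi> lab b c"
    and start: "\<And>e. e \<in> A \<Longrightarrow> descends \<phi> lab e c \<Longrightarrow> \<not> (\<exists>e'. returns \<phi> lab e' e) \<Longrightarrow> P e"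
    and climb: "\<And>e d. e \<in> A \<Longrightarrow> d \<in> A \<Longrightarrow> descends \<phi> lab d c \<Longrightarrow> returns \<phi> lab e d \<Longrightarrow> P e \<Longrightarrow> P d"
  shows "P b"
proof -
  have "lab c \<ge> 1" using descends_in[OF assms(2)] assms(1) label_ge_1 by simp
  then have one: "lab b \<noteq> 1" using descends_label[OF assms(2)] by simp
  obtain e where e: "e \<in> A" "(returns \<phi> lab)\<^sup>*\<^sup>* e b" "\<not> (\<exists>e'. returns \<phi> lab e' e)" "lab e = lab b"
    by (rule lowest_start[OF assms(1) one])
  obtain c0 where c0: "descends \<phi> lab e c0" using descends_ex[of e] e one by auto
  have "z \<in> A \<and> lab z = lab b \<and> descends \<phi> lab z c0 \<and> (c0 = c \<longrightarrow> P z)" if "(returns \<phi> lab)\<^sup>*\<^sup>* e z" for z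
    using that
  proof induction
    case base
    then show ?case using e start c0 by blast
  next
    case (step y z)
    have z: "z \<in> A" "lab z = lab b" using returns_in[OF step(2)] returns_label[OF step(2)] step.IH by auto
    then obtain c1 where c1: "descends \<phi> lab z c1" using descends_ex one by metis
    have "descends \<phi> lab y c1" using step(2) c1 by (rule returns_descends)
    then have "c1 = c0" using step.IH descends_unique by metis
    then show ?case using z c1 step climb by blast
  qed
  from this[OF e(2)] show ?thesis using assms(2) descends_unique by metis
qed

lemma rot_closing_simps:
  "b \<in> A \<Longrightarrow> returns \<phi> lab e b \<Longrightarrow> rot Q (True, b) = (True, e)"
  "b \<in> A \<Longrightarrow> descends \<phi> lab b c \<Longrightarrow> \<not> (\<exists>e'. returns \<phi> lab e' b) \<Longrightarrow> rot Q (True, b) = (False, c)"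
  "b \<in> A \<Longrightarrow> lab b < lab (\<alpha> b) \<Longrightarrow> rot Q (False, b) = (True, \<alpha> b)"
  "b \<in> A \<Longrightarrow> \<not> lab b < lab (\<alpha> b) \<Longrightarrow> rot Q (False, b) = (False, \<sigma> b)"
  using closing_step_returns[OF _ inj_face_succ, of lab e b \<alpha>] closing_step_descends[of \<phi> lab b c \<alpha>]
  by (auto simp: rot_closing closing_step_simps)

lemma climb_orbit:
  assumes "b \<in> A" "descends \<phi> lab b c"
  shows "(False, c) \<in> orbit (rot Q) (True, b)"
  using assms
proof (rule climb_induct)
  show "(False, c) \<in> orbit (rot Q) (True, e)"
    if "e \<in> A" "descends \<phi> lab e c" "\<not> (\<exists>e'. returns \<phi> lab e' e)" for e
    using rot_closing_simps(2)[OF that] by (metis orbit.base)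
  show "(False, c) \<in> orbit (rot Q) (True, d)"
    if "d \<in> A" "returns \<phi> lab e d" "(False, c) \<in> orbit (rot Q) (True, e)" for e d
    using rot_closing_simps(1)[OF that(1,2)] that(3) by (metis orbit_subset)
qed

text \<open>
  Between the falling arcs of two consecutive corners of a vertex, the rotation only passes rising arcs
  that end in the second corner.
\<close>
lemma orbit_False:
  assumes "b \<in> A" "c \<in> A" "tl_of b = tl_of c"
  shows "(False, c) \<in> orbit (rot Q) (False, b)"
proof -
  have one: "(False, \<sigma> b) \<in> orbit (rot Q) (False, b)" if "b \<in> A" for b
  proof (cases "lab b < lab (\<alpha> b)")
    case True
    have "descends \<phi> lab (\<alpha> b) (\<phi> (\<alpha> b))" using True that by (intro descends_step) simp
    then have "(False, \<sigma> b) \<in> orbit (rot Q) (True, \<alpha> b)" using climb_orbit[of "\<alpha> b"] that by simp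
    then show ?thesis using rot_closing_simps(3)[OF that True] by (metis orbit_subset)
  next
    case False
    then show ?thesis using rot_closing_simps(4)[OF that False] by (metis orbit.base)
  qed
  have "c \<in> orbit \<sigma> b" using orbit_rot assms by simp
  then have "c \<in> A \<and> (False, c) \<in> orbit (rot Q) (False, b)"
    by induction (use one assms(1) in \<open>auto intro: orbit_trans\<close>)
  then show ?thesis by simp
qed

text \<open>
  No label lies below 1, so the corners of label 1 form a single chain of returns.
\<close>
lemma orbit_True:
  assumes "b \<in> A" "c \<in> A" "lab b = 1" "lab c = 1"
  shows "(True, c) = (True, b) \<or> (True, c) \<in> orbit (rot Q) (True, b)"
proof -
  have "b \<in> orbit \<phi> c" using single_face assms by simp
  then obtain j where "(\<phi> ^^ j) c = b" by (auto simp: orbit_altdef)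
  moreover have "\<forall>i\<le>j. lab b \<le> lab ((\<phi> ^^ i) c)" using label_ge_1 funpow_in assms by simp
  ultimately have "(returns \<phi> lab)\<^sup>*\<^sup>* c b" using assms by (intro returns_chain) auto
  then have "b \<in> A \<and> ((True, c) = (True, b) \<or> (True, c) \<in> orbit (rot Q) (True, b))"
  proof induction
    case base
    then show ?case using assms by simp
  next
    case (step y z)
    have z: "z \<in> A" using returns_in[OF step(2)] step.IH by simp
    have "rot Q (True, z) = (True, y)" using rot_closing_simps(1)[OF z step(2)] .
    then show ?case using z step.IH by (metis orbit.base orbit_subset)
  qed
  then show ?thesis by simp
qed

lemma rot_closing_permutes: "rot Q permutes X"
proof (rule bij_imp_permutes)
  have "bij_betw step X X"
  proof (rule bij_betw_byWitness)
    show "\<forall>x\<in>X. step (step (step (step x))) = x" "\<forall>x\<in>X. step (step (step (step x))) = x"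
      using step_four by blast+
    show "step ` X \<subseteq> X" "(\<lambda>x. step (step (step x))) ` X \<subseteq> X"
      using step_in by blast+
  qed
  moreover have "bij_betw flip X X"
    by (rule bij_betw_byWitness[where f' = flip]) auto
  ultimately have "bij_betw (step \<circ> flip) X X" by (rule bij_betw_trans[rotated])
  then show "bij_betw (rot Q) X X"
    by (rule bij_betw_cong[THEN iffD1, rotated]) (simp add: rot_closing del: mem_Times_iff)
  show "rot Q x = x" if "x \<notin> X" for x
    using that by (simp add: closing_drawing_def Let_def perm_restrict_def)
qed

lemma finite_X: "finite X"
  by (intro finite_cartesian_product) auto

lemma rotation_system_closing: "rotation_system Q"
proof (rule rotation_systemI)
  have perm: "permutation (rot Q)" using rot_closing_permutes finite_X permutation_permutes by blast
  show "finite (verts (graph Q))" "finite (arcs (graph Q))" by simp_all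
  show "tail (graph Q) x \<in> verts (graph Q)" if arc: "x \<in> arcs (graph Q)" for x
  proof -
    obtain u b where x: "x = (u, b)" "b \<in> A" using arc by (cases x) simp
    show ?thesis
    proof (cases "u \<and> lab b \<noteq> 1")
      case True
      then obtain c where "c \<in> A" "descends \<phi> lab b c" using descends_ex x(2) by blast
      then show ?thesis using True x tlQ_simps(3)[of b c] by simp
    next
      case False
      then show ?thesis using x by (cases u) (auto simp: tlQ_simps)
    qed
  qed
  show "opp Q x = x" if "x \<notin> arcs (graph Q)" for x
    using that by (simp add: closing_drawing_def Let_def perm_restrict_def)
  show "rot Q permutes arcs (graph Q)" using rot_closing_permutes by simp
  show "cyclic_on (rot Q) (out_arcs (graph Q) v)"
    if v: "v \<in> verts (graph Q)" "out_arcs (graph Q) v \<noteq> {}" for v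
  proof (cases v)
    case None
    have mem: "x \<in> out_arcs (graph Q) None \<longleftrightarrow> (\<exists>b\<in>A. lab b = 1 \<and> x = (True, b))" for x
      by (cases x) (auto simp: tlQ_def split: if_splits)
    obtain b where b: "b \<in> A" "lab b = 1" by (rule label_1_arc)
    have "out_arcs (graph Q) None = orbit (rot Q) (True, b)"
    proof
      show "out_arcs (graph Q) None \<subseteq> orbit (rot Q) (True, b)"
      proof
        fix x assume "x \<in> out_arcs (graph Q) None"
        then obtain c where c: "c \<in> A" "lab c = 1" "x = (True, c)" using mem by blast
        show "x \<in> orbit (rot Q) (True, b)"
          using orbit_True[OF b(1) c(1) b(2) c(2)] permutation_self_in_orbit[OF perm] c(3) by metis
      qed
      show "orbit (rot Q) (True, b) \<subseteq> out_arcs (graph Q) None"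
      proof
        fix x assume "x \<in> orbit (rot Q) (True, b)"
        then have "x \<in> X \<and> tlQ x = None"
        proof induction
          case base
          then show ?case
            using b tlQ_rot[of "(True, b)"] rot_closing_in[of "(True, b)"] by (simp add: tlQ_simps)
        next
          case (step y)
          then show ?case using tlQ_rot[of y] rot_closing_in[of y] by simp
        qed
        then show "x \<in> out_arcs (graph Q) None" by simp
      qed
    qed
    moreover have "(True, b) \<in> out_arcs (graph Q) None" using b mem by blast
    ultimately have "cyclic_on (rot Q) (out_arcs (graph Q) None)" by (rule cyclic_on_singleI[rotated])
    then show ?thesis unfolding None .
  next
    case (Some w)
    have w: "w \<in> V" using v(1) Some by auto
    obtain b where b: "b \<in> A" "tl_of b = w" using no_isolated[OF w] by blast
    have to: "(False, b) \<in> orbit (rot Q) x" if x: "x \<in> out_arcs (graph Q) v" for x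
    proof -
      obtain u d where d: "x = (u, d)" "d \<in> A" using x by (auto simp: out_arcs_def)
      have tl: "tlQ x = Some w" using x Some by simp
      show ?thesis
      proof (cases u)
        case True
        then have "lab d \<noteq> 1" using tl d by (auto simp: tlQ_simps)
        then obtain c where c: "c \<in> A" "descends \<phi> lab d c" using descends_ex d(2) by blast
        then have "tl_of c = w" using tl tlQ_simps(3)[OF \<open>lab d \<noteq> 1\<close> c(2)] d True by simp
        then have "(False, b) \<in> orbit (rot Q) (False, c)" using orbit_False c b by simp
        then show ?thesis using climb_orbit[OF d(2) c(2)] d True by (auto intro: orbit_trans)
      next
        case False
        then show ?thesis using orbit_False[OF d(2) b(1)] tl d b by (simp add: tlQ_simps)
      qed
    qed
    have "out_arcs (graph Q) v = orbit (rot Q) (False, b)"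
    proof
      show "out_arcs (graph Q) v \<subseteq> orbit (rot Q) (False, b)"
      proof
        fix x assume "x \<in> out_arcs (graph Q) v"
        then show "x \<in> orbit (rot Q) (False, b)"
          using orbit_swap[OF permutation_self_in_orbit[OF perm] to] by blast
      qed
      show "orbit (rot Q) (False, b) \<subseteq> out_arcs (graph Q) v"
      proof
        fix x assume "x \<in> orbit (rot Q) (False, b)"
        then have "x \<in> X \<and> tlQ x = v"
        proof induction
          case base
          then show ?case
            using b Some tlQ_rot[of "(False, b)"] rot_closing_in[of "(False, b)"] by (simp add: tlQ_simps)
        next
          case (step y)
          then show ?case using tlQ_rot[of y] rot_closing_in[of y] by simp
        qed
        then show "x \<in> out_arcs (graph Q) v" by simp
      qed
    qed
    moreover have "(False, b) \<in> out_arcs (graph Q) v" using b Some by (simp add: tlQ_simps)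
    ultimately show ?thesis by (rule cyclic_on_singleI[rotated])
  qed
qed auto

sublocale Q: rotation_drawing Q
  by unfold_locales (rule rotation_system_closing)

section \<open>The closing is a pointed bipartite quadrangulation\<close>

text \<open>
  The label that \<open>lb\<close> gives to the vertices of the closing, with the new vertex at height 0.
\<close>
definition height :: "'v option \<Rightarrow> nat" where
  "height v = (case v of None \<Rightarrow> 0 | Some w \<Rightarrow> nat (lb w))"

lemma height_tail: "b \<in> A \<Longrightarrow> int (height (tlQ (u, b))) = (if u then lab b - 1 else lab b)"
proof -
  assume b: "b \<in> A"
  have pos: "1 \<le> lab x" if "x \<in> A" for x using label_ge_1 that by simp
  show ?thesis
  proof (cases "u \<and> lab b \<noteq> 1")
    case True
    then obtain c where c: "c \<in> A" "descends \<phi> lab b c" using descends_ex b by blast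
    then show ?thesis
      using True tlQ_simps(3)[of b c] lab_descends[OF c(2) b] pos[OF c(1)] by (simp add: height_def)
  next
    case False
    then show ?thesis using pos[OF b] by (cases u) (auto simp: tlQ_simps height_def)
  qed
qed

lemma height_step: "b \<in> A \<Longrightarrow> int (height (Q.hd_of (u, b))) = (if u then lab b else lab b - 1)"
  by (simp add: height_tail)

lemma
  assumes "v \<in> Q.V"
  shows graph_dist_closing: "graph_dist Q None v = height v"
    and reachable_closing: "None \<rightarrow>\<^sup>*\<^bsub>graph Q\<^esub> v"
proof -
  have root: "None \<in> Q.V" "height None = 0" by (simp_all add: height_def)
  have arc: "height (Q.hd_of x) \<le> Suc (height (Q.tl_of x))" if "x \<in> Q.A" for x
  proof (cases x)
    case (Pair u b)
    then show ?thesis using height_step[of b u] height_tail[of b u] \<open>x \<in> Q.A\<close> by (cases u) auto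
  qed
  have down: "\<exists>x\<in>Q.A. Q.hd_of x = v \<and> height (Q.tl_of x) < height v" if v: "v \<in> Q.V" "v \<noteq> None" for v
  proof -
    obtain w where w: "w \<in> V" "v = Some w" using v by auto
    obtain b where b: "b \<in> A" "tl_of b = w" using no_isolated[OF w(1)] by blast
    have hd: "Q.hd_of (True, b) = v" using b w by (simp add: tlQ_simps)
    have "int (height (Q.tl_of (True, b))) < int (height (Q.hd_of (True, b)))"
      using height_step[OF b(1), of True] height_tail[OF b(1), of True] b(1) by (simp del: closing_simps(4))
    then have "height (Q.tl_of (True, b)) < height v" unfolding hd by simp
    then show ?thesis using hd b(1) by (intro bexI[of _ "(True, b)"]) auto
  qed
  show "graph_dist Q None v = height v" "None \<rightarrow>\<^sup>*\<^bsub>graph Q\<^esub> v"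
    using Q.graph_dist_eqI[OF root arc down assms] by blast+
qed

lemma connected_closing: "connected (graph Q)"
  by (rule Q.connectedI_root[of None]) (use reachable_closing in auto)

lemma face_four_closing:
  assumes "F \<in> faces Q"
  shows "card F = 4"
proof -
  obtain x where x: "x \<in> X" "F = orbit (face_succ Q) x" using assms by (auto simp: faces_def)
  have eq: "face_succ Q y = step y" "step y \<in> X" if "y \<in> X" for y
    using that face_succ_closing step_in by blast+
  show ?thesis unfolding x(2)
    by (rule card_orbit_four) (use x(1) eq step_four step_two in metis)+
qed

lemma bipartite_closing: "bipartite Q"
proof -
  have "odd (height (Q.tl_of x)) \<noteq> odd (height (Q.hd_of x))" if "x \<in> Q.A" for x
  proof (cases x)
    case (Pair u b)
    then have "int (height (Q.tl_of x)) = int (height (Q.hd_of x)) + 1 \<or>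
        int (height (Q.hd_of x)) = int (height (Q.tl_of x)) + 1"
      using height_step[of b u] height_tail[of b u] \<open>x \<in> Q.A\<close> by (cases u) auto
    then show ?thesis by presburger
  qed
  then show ?thesis unfolding bipartite_def
    by (intro exI[of _ "\<lambda>v. odd (height v)"] ballI)
qed

lemma card_closing:
  shows "card (edges Q) = 2 * card (edges t)" and "card (faces Q) = card (edges t)"
    and "card Q.V = card V + 1"
proof -
  have X: "card X = 4 * card (edges t)"
    using card_arcs_edges by (simp add: card_cartesian_product)
  show "card (edges Q) = 2 * card (edges t)" using Q.card_arcs_edges X by simp
  show "card (faces Q) = card (edges t)" using Q.card_arcs_faces[OF face_four_closing] X by simp
  have "card (Some ` V) = card V" by (intro card_image) simp
  then show "card Q.V = card V + 1" by simp
qed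

sublocale P: pointed_quadrangulation Q None
  by unfold_locales (simp_all add: connected_closing face_four_closing bipartite_closing)

section \<open>Opening the closing\<close>

lemma L_tail_closing: "b \<in> A \<Longrightarrow> P.L (tlQ (u, b)) = (if u then lab b - 1 else lab b)"
  using height_tail[of b u] graph_dist_closing[of "tlQ (u, b)"] Q.tail_in_verts[of "(u, b)"]
  by (simp add: P.L_def)

lemma up_closing[simp]: "b \<in> A \<Longrightarrow> P.up (u, b) \<longleftrightarrow> u"
  using L_tail_closing[of b u] L_tail_closing[of b "\<not> u"] by (simp add: P.up_def)

text \<open>
  The selected corners are those that follow a falling arc around its tail, and on its way from
  \<open>(True, b)\<close> to \<open>(False, c)\<close> the rotation passes rising arcs only.
\<close>
lemma kappa_climb:
  assumes "b \<in> A" "descends \<phi> lab b c"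
  shows "first_return (rot Q) (opening_corners Q None) (True, b) = rot Q (False, c)"
  using assms
proof (rule climb_induct)
  let ?k = "first_return (rot Q) (opening_corners Q None)"
  have kap: "?k (True, d) = ?k (rot Q (True, d))" if d: "d \<in> A" "descends \<phi> lab d c" for d
  proof (rule P.kappa_up)
    have "1 \<le> lab c" using descends_in[OF d(2)] d(1) label_ge_1 by simp
    then show "Q.tl_of (True, d) \<noteq> None" using descends_label[OF d(2)] tlQ_simps(3)[of d c] d(2) by simp
  qed (use d in auto)
  show "?k (True, e) = rot Q (False, c)"
    if "e \<in> A" "descends \<phi> lab e c" "\<not> (\<exists>e'. returns \<phi> lab e' e)" for e
    using kap[OF that(1,2)] rot_closing_simps(2)[OF that] P.kappa_down[of "(False, c)"]
      descends_in[OF that(2)] that(1) by simp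
  show "?k (True, d) = rot Q (False, c)"
    if "d \<in> A" "descends \<phi> lab d c" "returns \<phi> lab e d" "?k (True, e) = rot Q (False, c)" for e d
    using kap[OF that(1,2)] rot_closing_simps(1)[OF that(1,3)] that(4) by simp
qed

text \<open>
  Corner \<open>b\<close> of the given map reappears as the selected corner that the rising arc \<open>(True, b)\<close> leads into.
\<close>
lemma opening_closing: "drawing_iso Some (\<lambda>b. step (True, b)) t P.T"
proof -
  let ?f = "\<lambda>b. step (True, b)"
  have fs: "face_succ Q (True, b) = ?f b" "rot Q (False, b) = ?f b" if "b \<in> A" for b
    using that face_succ_closing[of "(True, b)"] rot_closing[of "(False, b)"] by auto
  have f_in: "?f b \<in> P.C" if "b \<in> A" for b
    using P.face_succ_corner[of "(True, b)"] fs(1)[OF that] that by simp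
  have "P.C \<subseteq> ?f ` A"
  proof
    fix y assume "y \<in> P.C"
    then obtain x where x: "x \<in> Q.A" "P.up x" "y = face_succ Q x" by (rule P.cornerE)
    then obtain b where "b \<in> A" "x = (True, b)" by (cases x) auto
    then show "y \<in> ?f ` A" using x fs by auto
  qed
  moreover have "inj_on ?f A"
  proof (rule inj_onI)
    fix b c assume bc: "b \<in> A" "c \<in> A" "?f b = ?f c"
    then have "(True, b) = (True, c)" using step_True(1)[OF bc(1)] step_True(1)[OF bc(2)] by metis
    then show "b = c" by simp
  qed
  ultimately have bij: "bij_betw ?f A P.C" using f_in by (auto simp: bij_betw_def)
  have tl: "Some (tl_of b) = tlQ (?f b)" if "b \<in> A" for b
    using tlQ_rot[of "(False, b)"] fs(2)[OF that] that by (simp add: tlQ_simps)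
  have op: "?f (\<alpha> b) = opening_opp Q None (?f b)" if b: "b \<in> A" for b
  proof -
    have eq: "orbit (face_succ Q) (True, b) = orbit step (True, b)"
      by (rule orbit_cong0[of _ X]) (use b step_in face_succ_closing in auto)
    have "opening_opp Q None (face_succ Q (True, b)) = face_succ Q (True, \<alpha> b)"
      using step_True(6)[OF b] b arev_neq[OF b] by (intro P.opening_opp_face) (auto simp: eq)
    then show ?thesis using fs b by simp
  qed
  have ro: "?f (\<sigma> b) = opening_rot Q None (?f b)" if b: "b \<in> A" for b
  proof -
    have rk: "opening_rot Q None (?f b) = first_return (rot Q) P.C (?f b)"
      using f_in[OF b] by (rule P.opening_rot_corner)
    show ?thesis
    proof (cases "lab b < lab (\<alpha> b)")
      case True
      have "descends \<phi> lab (\<alpha> b) (\<phi> (\<alpha> b))" using True b by (intro descends_step) simp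
      then have "first_return (rot Q) P.C (True, \<alpha> b) = rot Q (False, \<sigma> b)"
        using kappa_climb[of "\<alpha> b"] b by simp
      then show ?thesis using rk fs b True by (simp add: closing_step_simps)
    next
      case False
      then have "?f b = (False, \<sigma> b)" using b by (simp add: closing_step_simps)
      then show ?thesis using rk fs[of "\<sigma> b"] P.kappa_down[of "(False, \<sigma> b)"] b by simp
    qed
  qed
  have "bij_betw Some V (verts (graph P.T))" by (auto simp: bij_betw_def)
  then show ?thesis
    unfolding drawing_iso_def using rotation_system P.rotation_system_opening bij tl op ro
    by (simp del: closing_simps(1))
qed

lemma label_closing: "v \<in> V \<Longrightarrow> int (graph_dist Q None (Some v)) = lb v"
  using graph_dist_closing[of "Some v"] label_ge_1[of v] by (simp add: height_def)

end

section \<open>Isomorphic quadrangulations have isomorphic openings\<close>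

context pointed_quadrangulation
begin

lemma opposite_rise:
  assumes "a \<in> A" "up a"
  obtains x where "x \<in> A" "up x" "x \<noteq> a" "x \<in> orbit \<phi> a"
proof -
  have in_A: "\<phi> a \<in> A" "\<phi> (\<phi> a) \<in> A" "\<phi> (\<phi> (\<phi> a)) \<in> A" using assms by auto
  have ne: "\<phi> y \<noteq> y" if "y \<in> A" for y using face_four(2)[OF that] by auto
  have ne3: "\<phi> (\<phi> (\<phi> a)) \<noteq> a" using face_four(1)[OF assms(1)] ne[OF assms(1)] by metis
  consider "up (\<phi> a)" | "up (\<phi> (\<phi> a))" | "up (\<phi> (\<phi> (\<phi> a)))"
    using face_rises[OF assms(1)] assms(2) by (auto split: if_splits)
  then show thesis
    using that[of "\<phi> a"] that[of "\<phi> (\<phi> a)"] that[of "\<phi> (\<phi> (\<phi> a))"]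
      in_A ne[OF assms(1)] ne3 face_four(2,3)[OF assms(1)] by cases auto
qed

end

lemma first_return_transfer:
  assumes f: "inj_on f A" "S \<subseteq> A" and "a \<in> A"
    and comm: "\<And>x. x \<in> A \<Longrightarrow> s x \<in> A \<and> f (s x) = s' (f x)"
    and ex: "b \<in> S" "b \<in> orbit s a"
  shows "first_return s' (f ` S) (f a) = f (first_return s S a)"
proof -
  have pow: "(s ^^ k) a \<in> A \<and> f ((s ^^ k) a) = (s' ^^ k) (f a)" for k
    by (induction k) (use comm \<open>a \<in> A\<close> in auto)
  have mem: "f x \<in> f ` S \<longleftrightarrow> x \<in> S" if "x \<in> A" for x
    using f that by (meson inj_on_image_mem_iff)
  obtain k where k: "0 < k" "first_return s S a = (s ^^ k) a" "(s ^^ k) a \<in> S"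
    "\<forall>j. 0 < j \<and> j < k \<longrightarrow> (s ^^ j) a \<notin> S"
    by (rule first_returnE[OF ex])
  show ?thesis
  proof (rule first_return_eqI[of k])
    show "(s' ^^ k) (f a) = f (first_return s S a)" using pow k(2) by simp
    show "f (first_return s S a) \<in> f ` S" using k(2,3) by simp
    show "(s' ^^ j) (f a) \<notin> f ` S" if "0 < j" "j < k" for j
      using k(4) that pow[of j] mem[of "(s ^^ j) a"] by simp
  qed (rule k(1))
qed

lemma pointed_quadrangulation_iso:
  assumes iso: "drawing_iso p f q q'" and q: "pointed_quadrangulation q v0"
  shows "pointed_quadrangulation q' (p v0)"
proof -
  interpret q: pointed_quadrangulation q v0 by (rule q)
  interpret I: drawing_iso_pair p f q q' using iso by unfold_locales
  show ?thesis
  proof unfold_locales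
    show "connected (graph q')" by (rule I.connected_transfer[OF q.connected_q])
    show "card F = 4" if "F \<in> faces q'" for F
      using that q.card_face_q I.card_face unfolding I.faces_eq by auto
    show "bipartite q'" by (rule I.bipartite_transfer[OF q.bipartite_q])
    show "p v0 \<in> verts (graph q')" using q.root_in by simp
  qed
qed

lemma opening_iso:
  assumes iso: "drawing_iso p f q q'" and q: "pointed_quadrangulation q v0"
  shows "drawing_iso p f (opening_drawing q v0) (opening_drawing q' (p v0))"
    and "\<And>v. v \<in> verts (graph q) \<Longrightarrow> graph_dist q' (p v0) (p v) = graph_dist q v0 v"
proof -
  interpret q: pointed_quadrangulation q v0 by (rule q)
  interpret q': pointed_quadrangulation q' "p v0" by (rule pointed_quadrangulation_iso[OF assms])
  interpret I: drawing_iso_pair p f q q' using iso by unfold_locales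
  show dist: "graph_dist q' (p v0) (p v) = graph_dist q v0 v" if "v \<in> verts (graph q)" for v
    using I.graph_dist_transfer[OF q.connected_q q.root_in that] .
  have L: "q'.L (p v) = q.L v" if "v \<in> q.V" for v
    using dist[OF that] by (simp add: q.L_def q'.L_def)
  have up: "q'.up (f a) \<longleftrightarrow> q.up a" if "a \<in> q.A" for a
  proof -
    have "q'.tl_of (f a) = p (q.tl_of a)" "q'.hd_of (f a) = p (q.hd_of a)"
      using I.p_tail[OF that] I.p_head[OF that] by simp_all
    then show ?thesis using that L by (simp add: q.up_def q'.up_def)
  qed
  have f_in: "f b \<in> q'.C" if b: "b \<in> q.C" for b
  proof -
    obtain a where a: "a \<in> q.A" "q.up a" "b = face_succ q a" by (rule q.cornerE[OF b])
    then show ?thesis using I.f_face_succ[of a] q'.face_succ_corner[of "f a"] up[of a] by simp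
  qed
  have C: "q'.C = f ` q.C"
  proof
    show "f ` q.C \<subseteq> q'.C" using f_in by blast
    show "q'.C \<subseteq> f ` q.C"
    proof
      fix y assume "y \<in> q'.C"
      then obtain x where x: "x \<in> q'.A" "q'.up x" "y = face_succ q' x" by (rule q'.cornerE)
      then obtain a where a: "a \<in> q.A" "x = f a" unfolding I.f_image[symmetric] by blast
      then have "face_succ q a \<in> q.C" "y = f (face_succ q a)"
        using x up[of a] I.f_face_succ[of a] by simp_all
      then show "y \<in> f ` q.C" by blast
    qed
  qed
  have inj: "inj_on f q.A" using I.bij_f by (simp add: bij_betw_def)
  have opp: "f (q.\<beta> b) = q'.\<beta> (f b)" if b: "b \<in> q.C" for b
  proof -
    obtain a where a: "a \<in> q.A" "q.up a" "b = face_succ q a" by (rule q.cornerE[OF b])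
    obtain x where x: "x \<in> q.A" "q.up x" "x \<noteq> a" "x \<in> orbit (face_succ q) a"
      by (rule q.opposite_rise[OF a(1,2)])
    have "q.\<beta> (face_succ q a) = face_succ q x" using a x by (intro q.opening_opp_face)
    moreover have "q'.\<beta> (face_succ q' (f a)) = face_succ q' (f x)"
    proof (rule q'.opening_opp_face)
      show "f x \<in> orbit (face_succ q') (f a)" using I.f_orbit[OF a(1)] x(4) by blast
    qed (use a x up I.f_eq_iff in auto)
    ultimately show ?thesis using a x I.f_face_succ by metis
  qed
  have rot: "f (q.\<rho> b) = q'.\<rho> (f b)" if b: "b \<in> q.C" for b
  proof -
    have bA: "b \<in> q.A" using b q.corners_subset by blast
    have "q'.\<kappa> (f b) = f (q.\<kappa> b)"
      unfolding C
      using inj q.corners_subset bA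
    proof (rule first_return_transfer)
      show "b \<in> orbit (rot q) b" by (rule permutation_self_in_orbit[OF q.permutation_rot])
    qed (use b I.f_rot in auto)
    then show ?thesis using q.opening_rot_corner[OF b] q'.opening_rot_corner[OF f_in[OF b]] by simp
  qed
  have "bij_betw f q.C q'.C" unfolding C using inj_on_subset[OF inj q.corners_subset] by (rule inj_on_imp_bij_betw)
  moreover have "bij_betw p (q.V - {v0}) (q'.V - {p v0})"
    using bij_betw_DiffI[OF I.bij_p, of "{v0}" "{p v0}"] q.root_in by simp
  moreover have "p (q.tl_of b) = q'.tl_of (f b)" if "b \<in> q.C" for b
    using that q.corners_subset I.p_tail by blast
  ultimately show "drawing_iso p f q.T q'.T"
    unfolding drawing_iso_def using q.rotation_system_opening q'.rotation_system_opening opp rot by simp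
qed

section \<open>Isomorphic openings come from isomorphic quadrangulations\<close>

lemma (in pointed_quadrangulation) labeled_contour_opening:
  assumes "A \<noteq> {}"
  shows "labeled_contour T L"
proof unfold_locales
  have "C \<noteq> {}" using card_corners assms finite_arcs by fastforce
  then obtain b where b: "b \<in> C" "l b = 1" using reaches_label_1 by blast
  then show "\<exists>v\<in>verts (graph T). L v = 1" using T.tail_in_verts[of b] by auto
  show "c \<in> orbit (face_succ T) b" if "b \<in> arcs (graph T)" "c \<in> arcs (graph T)" for b c
    using that single_contour by simp
  show "\<bar>L (tail (graph T) b) - L (head (graph T) b)\<bar> \<le> 1" if "b \<in> arcs (graph T)" for b
    using that label_opp by simp
  show "\<exists>b\<in>arcs (graph T). tail (graph T) b = v" if "v \<in> verts (graph T)" for v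
    using that vertex_corner[of v] by auto
  show "1 \<le> L v" if "v \<in> verts (graph T)" for v
    using that L_pos[of v] by simp
qed

lemma
  assumes comm: "\<And>x. x \<in> A \<Longrightarrow> f (s x) = s' (f x)" and closed: "\<And>x. x \<in> A \<Longrightarrow> s x \<in> A"
    and lab: "\<And>x. x \<in> A \<Longrightarrow> l' (f x) = l x" and "b \<in> A"
  shows returns_transfer: "returns s l b c \<Longrightarrow> returns s' l' (f b) (f c)"
    and descends_transfer: "descends s l b c \<Longrightarrow> descends s' l' (f b) (f c)"
    and returns_transfer_back: "inj_on f A \<Longrightarrow> c \<in> A \<Longrightarrow> returns s' l' (f b) (f c) \<Longrightarrow> returns s l b c"
proof -
  have pow: "(s ^^ k) b \<in> A \<and> (s' ^^ k) (f b) = f ((s ^^ k) b) \<and> l' ((s' ^^ k) (f b)) = l ((s ^^ k) b)" for k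
    by (induction k) (simp_all add: comm[symmetric] closed lab \<open>b \<in> A\<close>)
  show "returns s l b c \<Longrightarrow> returns s' l' (f b) (f c)"
    "descends s l b c \<Longrightarrow> descends s' l' (f b) (f c)"
    using pow lab[OF \<open>b \<in> A\<close>] unfolding returns_def descends_def by metis+
  assume *: "inj_on f A" "c \<in> A" "returns s' l' (f b) (f c)"
  then show "returns s l b c"
    using pow lab[OF \<open>b \<in> A\<close>] lab[OF \<open>c \<in> A\<close>] unfolding returns_def by (metis inj_onD)
qed

text \<open>
  An isomorphism preserves contours and labels, hence returns and descents. The existence of one of the
  two in a labeled one-face map guarantees that the definite descriptions in \<open>closing_step\<close> denote.
\<close>
lemma closing_step_transfer:
  assumes t: "labeled_contour t lb" and iso: "drawing_iso p f t t'"
    and lab: "\<And>v. v \<in> verts (graph t) \<Longrightarrow> lb' (p v) = lb v" and b: "b \<in> arcs (graph t)"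
  shows "closing_step (opp t') (face_succ t') (\<lambda>b. lb' (tail (graph t') b)) (u, f b)
    = map_prod id f (closing_step (opp t) (face_succ t) (\<lambda>b. lb (tail (graph t) b)) (u, b))"
proof -
  interpret t: labeled_contour t lb by (rule t)
  interpret I: drawing_iso_pair p f t t' using iso by unfold_locales
  let ?l' = "\<lambda>b. lb' (tail (graph t') b)"
  have l: "?l' (f x) = t.lab x" if "x \<in> t.A" for x
    using I.p_tail[OF that] lab[of "t.tl_of x"] that by simp
  have inj: "inj_on f t.A" using I.bij_f by (simp add: bij_betw_def)
  show ?thesis
  proof (cases u)
    case True
    have "lb' (I.N.hd_of (f b)) = lb (t.hd_of b)"
      using I.p_head[OF b] lab[of "t.hd_of b"] b by simp
    then show ?thesis
      using True b l[OF b] I.f_opp[OF b] I.f_face_succ[of "opp t b"] by (simp add: closing_step_def)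
  next
    case False
    show ?thesis
    proof (cases "\<exists>e. returns (face_succ t) t.lab e b")
      case True
      then obtain e where e: "returns (face_succ t) t.lab e b" by blast
      then have "e \<in> t.A" using t.returns_in b by blast
      then have "returns (face_succ t') ?l' (f e) (f b)"
        using returns_transfer[of t.A f "face_succ t" "face_succ t'" ?l' t.lab e b] I.f_face_succ l e by simp
      then show ?thesis
        using False closing_step_returns[OF _ permutes_inj[OF I.N.face_succ_permutes]]
          closing_step_returns[OF e t.inj_face_succ] by simp
    next
      case no: False
      have no': "\<not> (\<exists>e. returns (face_succ t') ?l' e (f b))"
      proof
        assume "\<exists>e. returns (face_succ t') ?l' e (f b)"
        then obtain e' where e': "returns (face_succ t') ?l' e' (f b)" by blast
        obtain k where "(face_succ t' ^^ k) e' = f b" using e' by (auto simp: returns_def)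
        moreover have "(face_succ t' ^^ k) e' \<in> I.N.A \<longleftrightarrow> e' \<in> I.N.A" for k by (induction k) auto
        ultimately have "e' \<in> I.N.A" using b by (metis I.f_in)
        then obtain e where e: "e \<in> t.A" "e' = f e" unfolding I.f_image[symmetric] by blast
        have "returns (face_succ t) t.lab e b"
          using returns_transfer_back[of t.A f "face_succ t" "face_succ t'" ?l' t.lab e b]
            I.f_face_succ l e inj b e' by simp
        then show False using no by blast
      qed
      obtain a where a: "a \<in> t.A" "b = face_succ t a" by (rule t.face_pred[OF b])
      have "t.lab b \<noteq> 1" using t.no_return_iff[OF a(1)] no a t.label_ge_1[of "t.tl_of a"] by simp
      then obtain c where c: "descends (face_succ t) t.lab b c" using t.descends_ex b by blast
      have "descends (face_succ t') ?l' (f b) (f c)"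
        using descends_transfer[of t.A f "face_succ t" "face_succ t'" ?l' t.lab b c] I.f_face_succ l b c by simp
      then show ?thesis
        using False closing_step_descends[OF _ no'] closing_step_descends[OF c no] by simp
    qed
  qed
qed

text \<open>
  The isomorphism \<open>f\<close> of the openings acts on codes, and the codes of a quadrangulation determine its face
  permutation, its opposites and its tails.
\<close>
lemma iso_of_opening_iso:
  assumes q: "pointed_quadrangulation q v0" and q': "pointed_quadrangulation q' v0'"
    and iso: "drawing_iso p f (opening_drawing q v0) (opening_drawing q' v0')"
    and lab: "\<And>v. v \<in> verts (graph q) - {v0} \<Longrightarrow> graph_dist q' v0' (p v) = graph_dist q v0 v"
    and ne: "arcs (graph q) \<noteq> {}"
  shows "\<exists>p' f'. drawing_iso p' f' q q' \<and> p' v0 = v0'"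
proof -
  interpret q: pointed_quadrangulation q v0 by (rule q)
  interpret q': pointed_quadrangulation q' v0' by (rule q')
  interpret I: drawing_iso_pair p f q.T q'.T using iso by unfold_locales
  interpret t: labeled_contour q.T q.L by (rule q.labeled_contour_opening[OF ne])
  have L: "q'.L (p v) = q.L v" if "v \<in> verts (graph q.T)" for v
    using lab that by (simp add: q.L_def q'.L_def)
  have tl: "p (q.tl_of b) = q'.tl_of (f b)" if "b \<in> q.C" for b
    using I.p_tail[of b] that by simp
  have tl_ne: "q.tl_of b \<noteq> v0" if "b \<in> q.C" for b
    by (rule q.corner_tail[OF that])
  have Lf: "q'.l (f b) = q.l b" if "b \<in> q.C" for b
    using L[of "q.tl_of b"] q.T.tail_in_verts[of b] that tl by simp
  have f_C: "f b \<in> q'.C" if "b \<in> q.C" for b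
    using I.f_in that by simp
  define F where "F = (\<lambda>x. the_inv_into q'.A q'.code (map_prod id f (q.code x)))"
  \<comment> \<open>\<open>p\<close> may send the basepoint, which is no vertex of the opening, anywhere\<close>
  define p' where "p' = p(v0 := v0')"
  have code_in: "map_prod id f (q.code x) \<in> UNIV \<times> q'.C" "snd (q.code x) \<in> q.C" if "x \<in> q.A" for x
    using bij_betwE[OF q.bij_code] that f_C by (auto simp: mem_Times_iff)
  have code_F: "q'.code (F x) = map_prod id f (q.code x)" and F_in: "F x \<in> q'.A" if "x \<in> q.A" for x
    using f_the_inv_into_f_bij_betw[OF q'.bij_code] code_in(1)[OF that]
      bij_betwE[OF bij_betw_the_inv_into[OF q'.bij_code]] by (auto simp: F_def)
  have code_eqD: "x = y" if "q'.code x = q'.code y" "x \<in> q'.A" "y \<in> q'.A" for x y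
    using q'.bij_code that by (auto simp: bij_betw_def dest: inj_onD)
  have up: "q'.up (F x) \<longleftrightarrow> q.up x" if "x \<in> q.A" for x
    using arg_cong[OF code_F[OF that], of fst] by (simp add: q.code_def q'.code_def)
  have snd_code: "snd (q'.code (F x)) = f (snd (q.code x))" if "x \<in> q.A" for x
    using code_F[OF that] by simp
  have face: "F (face_succ q x) = face_succ q' (F x)" if x: "x \<in> q.A" for x
  proof (rule code_eqD)
    obtain u b where ub: "q.code x = (u, b)" "b \<in> q.C" using code_in(2)[OF x] by (cases "q.code x") auto
    have "q'.code (F (face_succ q x)) = map_prod id f (q.code (face_succ q x))"
      using code_F[of "face_succ q x"] x by simp
    also have "\<dots> = map_prod id f (closing_step q.\<beta> q.\<psi> q.l (u, b))"
      using q.code_face_succ[OF x] ub by simp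
    also have "\<dots> = closing_step q'.\<beta> q'.\<psi> q'.l (u, f b)"
      using closing_step_transfer[OF t.labeled_contour_axioms iso, of q'.L b u] L ub(2) by simp
    also have "\<dots> = closing_step q'.\<beta> q'.\<psi> q'.l (q'.code (F x))"
      using code_F[OF x] ub by simp
    also have "\<dots> = q'.code (face_succ q' (F x))"
      using q'.code_face_succ[OF F_in[OF x]] by simp
    finally show "q'.code (F (face_succ q x)) = q'.code (face_succ q' (F x))" .
  qed (use x F_in in auto)
  have opp: "F (opp q x) = opp q' (F x)" if x: "x \<in> q.A" for x
  proof (rule code_eqD)
    have "q'.code (F (opp q x)) = map_prod id f (map_prod Not id (q.code x))"
      using code_F[of "opp q x"] q.code_opp[OF x] x by simp
    also have "\<dots> = map_prod Not id (q'.code (F x))"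
      using code_F[OF x] by (cases "q.code x") simp
    also have "\<dots> = q'.code (opp q' (F x))" using q'.code_opp[OF F_in[OF x]] by simp
    finally show "q'.code (F (opp q x)) = q'.code (opp q' (F x))" .
  qed (use x F_in in auto)
  have rot: "F (rot q x) = rot q' (F x)" if x: "x \<in> q.A" for x
    using face[of "opp q x"] opp[OF x] x by simp
  have tail: "p' (q.tl_of x) = q'.tl_of (F x)" if x: "x \<in> q.A" for x
  proof -
    let ?b = "snd (q.code x)"
    have b: "?b \<in> q.C" by (rule code_in(2)[OF x])
    consider "\<not> q.up x" | "q.up x" "q.l ?b = 1" | "q.up x" "q.l ?b \<noteq> 1" by blast
    then show ?thesis
    proof cases
      case 1
      then have "q.tl_of x = q.tl_of ?b" "q'.tl_of (F x) = q'.tl_of (f ?b)"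
        using q.tail_code(1)[OF x] q'.tail_code(1)[OF F_in[OF x]] up[OF x] snd_code[OF x] by auto
      then show ?thesis using tl[OF b] tl_ne[OF b] by (simp add: p'_def)
    next
      case 2
      then have "q.tl_of x = v0" "q'.tl_of (F x) = v0'"
        using q.tail_code(2)[OF x] q'.tail_code(2)[OF F_in[OF x]] up[OF x] snd_code[OF x] Lf[OF b] by auto
      then show ?thesis by (simp add: p'_def)
    next
      case 3
      obtain c where c: "c \<in> q.C" "descends q.\<psi> q.l ?b c" using q.tail_code(4)[OF x 3] by blast
      have d: "descends q'.\<psi> q'.l (f ?b) (f c)"
        using descends_transfer[of q.C f q.\<psi> q'.\<psi> q'.l q.l ?b c] I.f_face_succ Lf b c(2) by simp
      have "q'.tl_of (F x) = q'.tl_of (f c)"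
        using q'.tail_code(3)[OF F_in[OF x], of "f c"] up[OF x] 3 snd_code[OF x] Lf[OF b] d by simp
      then show ?thesis
        using q.tail_code(3)[OF x 3 c(2)] tl[OF c(1)] tl_ne[OF c(1)] by (simp add: p'_def)
    qed
  qed
  have "bij_betw (map_prod id f) (UNIV \<times> q.C) ((UNIV :: bool set) \<times> q'.C)"
  proof -
    have bf: "bij_betw f q.C q'.C" using I.bij_f by simp
    show ?thesis
      by (rule bij_betw_byWitness[where f' = "map_prod id (the_inv_into q.C f)"])
        (use bf bij_betwE[OF bf] bij_betwE[OF bij_betw_the_inv_into[OF bf]]
          the_inv_into_f_f[OF bij_betw_imp_inj_on[OF bf]] f_the_inv_into_f_bij_betw[OF bf] in auto)
  qed
  then have "bij_betw F q.A q'.A"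
    using bij_betw_trans[OF bij_betw_trans[OF q.bij_code] bij_betw_the_inv_into[OF q'.bij_code]]
    by (simp add: F_def o_def)
  moreover have "bij_betw p' q.V q'.V"
  proof -
    have "bij_betw p (q.V - {v0}) (q'.V - {v0'})" using I.bij_p by simp
    then have "bij_betw p' (q.V - {v0}) (q'.V - {v0'})"
      by (rule bij_betw_cong[THEN iffD1, rotated]) (simp add: p'_def)
    then have "bij_betw p' ((q.V - {v0}) \<union> {v0}) ((q'.V - {v0'}) \<union> {v0'})"
      by (rule bij_betw_combine) (auto simp: p'_def)
    then show ?thesis using q.root_in q'.root_in by (simp add: insert_absorb)
  qed
  ultimately have "drawing_iso p' F q q'"
    unfolding drawing_iso_def using q.rotation_system q'.rotation_system opp rot tail by simp
  then show ?thesis by (intro exI[of _ p'] exI[of _ F]) (simp add: p'_def)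
qed

section \<open>Isomorphism classes\<close>

lemma pointed_equiv_iff:
  "((M, v), (N, w)) \<in> pointed_equiv \<longleftrightarrow>
     v \<in> verts (graph M) \<and> (\<exists>p f. drawing_iso p f M N \<and> p v = w)"
  unfolding pointed_equiv_def using ex_drawing_isomorphism_iff[of M N "\<lambda>p. p v = w"] by simp

lemma labeled_equiv_iff:
  "((M, l), (N, k)) \<in> labeled_equiv \<longleftrightarrow>
     (\<exists>p f. drawing_iso p f M N \<and> (\<forall>v\<in>verts (graph M). k (p v) = l v))"
  unfolding labeled_equiv_def
  using ex_drawing_isomorphism_iff[of M N "\<lambda>p. \<forall>v\<in>verts (graph M). k (p v) = l v"] by simp

lemma drawing_iso_verts: "drawing_iso p f M N \<Longrightarrow> bij_betw p (verts (graph M)) (verts (graph N))"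
  by (simp add: drawing_iso_def)

lemma sym_pointed_equiv: "sym pointed_equiv"
proof (rule symI)
  fix x y :: "('a, 'b) drawing \<times> 'a"
  assume xy: "(x, y) \<in> pointed_equiv"
  obtain M v N w where e: "x = (M, v)" "y = (N, w)" by (cases x; cases y)
  obtain p f where f: "v \<in> verts (graph M)" "drawing_iso p f M N" "p v = w"
    using xy unfolding e pointed_equiv_iff by blast
  have "the_inv_into (verts (graph M)) p w = v" "w \<in> verts (graph N)"
    using drawing_iso_verts[OF f(2)] f(1,3) by (auto simp: bij_betw_def the_inv_into_f_f)
  then show "(y, x) \<in> pointed_equiv"
    unfolding e pointed_equiv_iff using drawing_iso_sym[OF f(2)] by blast
qed

lemma trans_pointed_equiv: "trans pointed_equiv"
proof (rule transI)
  fix x y z :: "('a, 'b) drawing \<times> 'a"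
  assume xy: "(x, y) \<in> pointed_equiv" and yz: "(y, z) \<in> pointed_equiv"
  obtain M v N w P u where e: "x = (M, v)" "y = (N, w)" "z = (P, u)" by (cases x; cases y; cases z)
  obtain p f where f: "v \<in> verts (graph M)" "drawing_iso p f M N" "p v = w"
    using xy unfolding e pointed_equiv_iff by blast
  obtain r g where g: "drawing_iso r g N P" "r w = u"
    using yz unfolding e pointed_equiv_iff by blast
  have "(r \<circ> p) v = u" using f g by simp
  then show "(x, z) \<in> pointed_equiv"
    unfolding e pointed_equiv_iff using f(1) drawing_iso_trans[OF f(2) g(1)] by blast
qed

lemma sym_labeled_equiv: "sym labeled_equiv"
proof (rule symI)
  fix x y :: "('a, 'b) drawing \<times> ('a \<Rightarrow> int)"
  assume xy: "(x, y) \<in> labeled_equiv"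
  obtain M l N k where e: "x = (M, l)" "y = (N, k)" by (cases x; cases y)
  obtain p f where f: "drawing_iso p f M N" "\<forall>v\<in>verts (graph M). k (p v) = l v"
    using xy unfolding e labeled_equiv_iff by blast
  have "l (the_inv_into (verts (graph M)) p w) = k w" if w: "w \<in> verts (graph N)" for w
  proof -
    have p: "inj_on p (verts (graph M))" "p ` verts (graph M) = verts (graph N)"
      using drawing_iso_verts[OF f(1)] by (auto simp: bij_betw_def)
    then obtain v where "v \<in> verts (graph M)" "w = p v" using w by blast
    then show ?thesis using f(2) p(1) by (simp add: the_inv_into_f_f)
  qed
  then show "(y, x) \<in> labeled_equiv"
    unfolding e labeled_equiv_iff using drawing_iso_sym[OF f(1)] by blast
qed

lemma trans_labeled_equiv: "trans labeled_equiv"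
proof (rule transI)
  fix x y z :: "('a, 'b) drawing \<times> ('a \<Rightarrow> int)"
  assume xy: "(x, y) \<in> labeled_equiv" and yz: "(y, z) \<in> labeled_equiv"
  obtain M l N k P j where e: "x = (M, l)" "y = (N, k)" "z = (P, j)" by (cases x; cases y; cases z)
  obtain p f where f: "drawing_iso p f M N" "\<forall>v\<in>verts (graph M). k (p v) = l v"
    using xy unfolding e labeled_equiv_iff by blast
  obtain r g where g: "drawing_iso r g N P" "\<forall>v\<in>verts (graph N). j (r v) = k v"
    using yz unfolding e labeled_equiv_iff by blast
  have "\<forall>v\<in>verts (graph M). j ((r \<circ> p) v) = l v"
    using f(2) g(2) bij_betwE[OF drawing_iso_verts[OF f(1)]] by simp
  then show "(x, z) \<in> labeled_equiv"
    unfolding e labeled_equiv_iff using drawing_iso_trans[OF f(1) g(1)] by blast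
qed

lemma labeled_equiv_refl: "rotation_system M \<Longrightarrow> ((M, l), (M, l)) \<in> labeled_equiv"
  unfolding labeled_equiv_iff using drawing_iso_refl by fastforce

lemma pointed_equiv_refl: "rotation_system M \<Longrightarrow> v \<in> verts (graph M) \<Longrightarrow> ((M, v), (M, v)) \<in> pointed_equiv"
  unfolding pointed_equiv_iff using drawing_iso_refl by fastforce

text \<open>
  A map between representatives that respects and reflects the equivalences, and hits every class, is
  a bijection between classes. Closedness of \<open>X\<close> is what makes the image of a whole class lie in one class.
\<close>
lemma bij_betw_quotients:
  assumes R: "sym R" "trans R" and S: "sym S" "trans S"
    and reflX: "\<And>x. x \<in> X \<Longrightarrow> (x, x) \<in> R" and reflY: "\<And>y. y \<in> Y \<Longrightarrow> (y, y) \<in> S"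
    and closed: "\<And>x x'. x \<in> X \<Longrightarrow> (x, x') \<in> R \<Longrightarrow> x' \<in> X"
    and maps: "\<And>x. x \<in> X \<Longrightarrow> h x \<in> Y"
    and respects: "\<And>x x'. x \<in> X \<Longrightarrow> x' \<in> X \<Longrightarrow> (h x, h x') \<in> S \<longleftrightarrow> (x, x') \<in> R"
    and onto: "\<And>y. y \<in> Y \<Longrightarrow> \<exists>x\<in>X. (h x, y) \<in> S"
  shows "bij_betw (\<lambda>C. S `` (h ` C)) (X // R) (Y // S)"
proof -
  have img: "S `` (h ` (R `` {x})) = S `` {h x}" if x: "x \<in> X" for x
  proof
    show "S `` (h ` (R `` {x})) \<subseteq> S `` {h x}"
    proof
      fix y assume "y \<in> S `` (h ` (R `` {x}))"
      then obtain x' where x': "(x, x') \<in> R" "(h x', y) \<in> S" by blast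
      then have "(h x, h x') \<in> S" using respects closed x by blast
      then show "y \<in> S `` {h x}" using transD[OF S(2)] x'(2) by blast
    qed
    show "S `` {h x} \<subseteq> S `` (h ` (R `` {x}))" using reflX[OF x] by blast
  qed
  have R_eq: "R `` {x} = R `` {x'}" if "(x, x') \<in> R" for x x'
    using transD[OF R(2) that] transD[OF R(2) symD[OF R(1) that]] by blast
  have S_eq: "S `` {y} = S `` {y'}" if "(y, y') \<in> S" for y y'
    using transD[OF S(2) that] transD[OF S(2) symD[OF S(1) that]] by blast
  show ?thesis
  proof (rule bij_betw_imageI)
    show "inj_on (\<lambda>C. S `` (h ` C)) (X // R)"
    proof (rule inj_onI)
      fix C D assume "C \<in> X // R" "D \<in> X // R" and eq: "S `` (h ` C) = S `` (h ` D)"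
      then obtain x x' where x: "x \<in> X" "C = R `` {x}" and x': "x' \<in> X" "D = R `` {x'}"
        by (metis quotientE)
      have "S `` {h x} = S `` {h x'}" using eq img x x' by simp
      then have "(h x, h x') \<in> S" using reflY[OF maps[OF x'(1)]] by blast
      then show "C = D" using respects R_eq x x' by blast
    qed
    show "(\<lambda>C. S `` (h ` C)) ` (X // R) = Y // S"
    proof
      show "(\<lambda>C. S `` (h ` C)) ` (X // R) \<subseteq> Y // S"
      proof (rule image_subsetI)
        fix C assume "C \<in> X // R"
        then obtain x where x: "x \<in> X" "C = R `` {x}" by (rule quotientE)
        then have "S `` (h ` C) = S `` {h x}" using img by simp
        then show "S `` (h ` C) \<in> Y // S" using quotientI[OF maps[OF x(1)]] by simp
      qed
      show "Y // S \<subseteq> (\<lambda>C. S `` (h ` C)) ` (X // R)"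
      proof
        fix D assume "D \<in> Y // S"
        then obtain y where y: "y \<in> Y" "D = S `` {y}" by (rule quotientE)
        then obtain x where x: "x \<in> X" "(h x, y) \<in> S" using onto by blast
        then have "D = S `` (h ` (R `` {x}))" using img S_eq y by simp
        then show "D \<in> (\<lambda>C. S `` (h ` C)) ` (X // R)" using quotientI[OF x(1)] by (rule image_eqI)
      qed
    qed
  qed
qed

text \<open>
  Names of vertices and arcs do not matter: a finite drawing can be transported along any
  injections into the natural numbers.
\<close>
lemma drawing_copy:
  fixes M :: "('v, 'a) drawing"
  assumes "rotation_system M"
  shows "\<exists>(N :: (nat, nat) drawing) p f. drawing_iso p f M N"
proof -
  interpret rotation_drawing M by unfold_locales (rule assms)
  obtain p :: "'v \<Rightarrow> nat" where p: "inj_on p V"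
    using finite_imp_inj_to_nat_seg[OF finite_verts] by blast
  obtain f :: "'a \<Rightarrow> nat" where f: "inj_on f A"
    using finite_imp_inj_to_nat_seg[OF finite_arcs] by blast
  define g where "g = the_inv_into A f"
  have g: "g (f a) = a" if "a \<in> A" for a using f that by (simp add: g_def the_inv_into_f_f)
  define N where "N = \<lparr> graph = \<lparr> verts = p ` V, arcs = f ` A, tail = p \<circ> tl_of \<circ> g, head = p \<circ> hd_of \<circ> g \<rparr>,
    opp = perm_restrict (f \<circ> \<alpha> \<circ> g) (f ` A), rot = perm_restrict (f \<circ> \<sigma> \<circ> g) (f ` A) \<rparr>"
  have f_eq: "f a = f b \<longleftrightarrow> a = b" if "a \<in> A" "b \<in> A" for a b using f that by (auto dest: inj_onD)
  have rotN: "rot N (f a) = f (\<sigma> a)" and oppN: "opp N (f a) = f (\<alpha> a)" if "a \<in> A" for a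
    using that g by (auto simp: N_def perm_restrict_simps)
  have "rotation_system N"
  proof (rule rotation_systemI)
    show "rot N permutes arcs (graph N)"
    proof (rule bij_imp_permutes)
      have "rot N ` f ` A = f ` \<sigma> ` A" using rotN by (auto simp: image_image intro!: image_cong)
      then have "rot N ` f ` A = f ` A" using permutes_image[OF rot_permutes] by simp
      then show "bij_betw (rot N) (arcs (graph N)) (arcs (graph N))"
        by (simp add: N_def bij_betw_def eq_card_imp_inj_on)
    qed (simp add: N_def perm_restrict_simps)
    show "cyclic_on (rot N) (out_arcs (graph N) w)"
      if w: "w \<in> verts (graph N)" "out_arcs (graph N) w \<noteq> {}" for w
    proof -
      obtain v where v: "v \<in> V" "w = p v" using w(1) by (auto simp: N_def)
      have pv: "p (tl_of a) = p v \<longleftrightarrow> tl_of a = v" if "a \<in> A" for a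
        using p v that by (auto dest: inj_onD)
      have eq: "out_arcs (graph N) w = f ` out_arcs (graph M) v"
        using v pv g by (auto simp: N_def out_arcs_def)
      then obtain a where "a \<in> out_arcs (graph M) v" using w(2) by blast
      then have a: "a \<in> A" "tl_of a = v" by auto
      have "cyclic_on \<sigma> (out_arcs (graph M) v)" using rot_cyclic[OF a(1)] a(2) by simp
      then show ?thesis unfolding eq by (rule cyclic_on_image) (simp add: rotN)
    qed
  qed (use g f_eq arev_neq in \<open>auto simp: N_def perm_restrict_simps\<close>)
  moreover have "bij_betw p V (verts (graph N))" "bij_betw f A (arcs (graph N))"
    using p f by (auto simp: N_def intro: inj_on_imp_bij_betw)
  moreover have "p (tl_of a) = tail (graph N) (f a)" if "a \<in> A" for a
    using g that by (simp add: N_def)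
  ultimately have "drawing_iso p f M N"
    unfolding drawing_iso_def using assms rotN oppN by simp
  then show ?thesis by blast
qed

section \<open>The bijection\<close>

lemma pointed_quadrangulationI:
  assumes "(q, v0) \<in> pointed_bipartite_quadrangulations g n"
  shows "pointed_quadrangulation q v0"
  using assms unfolding pointed_bipartite_quadrangulations_def quadrangulation_def map_of_genus_def
  by unfold_locales auto

lemma arcs_nonempty:
  assumes "0 < card (edges M)"
  shows "arcs (graph M) \<noteq> {}"
  using assms by (auto simp: edges_def)

text \<open>
  One vertex is lost and one edge per face is kept, so with a single face the Euler characteristic is
  \<open>(n + 1 - 2 * g) - n + 1 = 2 - 2 * g\<close>.
\<close>
lemma opening_well_labeled_tree:
  assumes q: "(q, v0) \<in> pointed_bipartite_quadrangulations g n" and n: "1 \<le> n"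
  shows "quad_opening (q, v0) \<in> well_labeled_trees g n"
proof -
  interpret q: pointed_quadrangulation q v0 by (rule pointed_quadrangulationI[OF q])
  have cards: "card (faces q) = n" "card (edges q) = 2 * n" "int (card q.V) = int n + 2 - 2 * int g"
    using q by (auto simp: pointed_bipartite_quadrangulations_def)
  have "card q.C = 2 * n"
    using q.card_corners q.card_arcs_edges cards(2) by linarith
  then have ne: "q.C \<noteq> {}" using n by (metis card.empty mult_is_0 not_one_le_zero zero_neq_numeral)
  have V: "int (card (verts (graph q.T))) = int n + 1 - 2 * int g"
  proof -
    have "card q.V = Suc (card (q.V - {v0}))" using card_Suc_Diff1[OF q.finite_verts q.root_in] by simp
    then show ?thesis using cards(3) by simp
  qed
  have E: "card (edges q.T) = n" using q.card_edges_opening cards by simp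
  have F: "faces q.T = {q.C}" by (rule q.faces_opening[OF ne])
  have "g_tree g q.T"
    using q.rotation_system_opening q.connected_opening[OF ne] V E F
    by (simp add: g_tree_def map_of_genus_def)
  then show ?thesis
    using q.well_labeled_opening[OF ne] V E
    by (simp add: well_labeled_trees_def quad_opening_def q.L_def[abs_def])
qed

lemma labeled_contour_tree:
  assumes t: "(t, l) \<in> well_labeled_trees g n" and n: "1 \<le> n"
  shows "labeled_contour t l"
proof -
  have rs: "rotation_system t" and conn: "connected (graph t)" and F: "card (faces t) = 1"
    and wl: "well_labeled t l" and E: "card (edges t) = n"
    using t by (auto simp: well_labeled_trees_def g_tree_def map_of_genus_def)
  interpret rotation_drawing t by unfold_locales (rule rs)
  have ne: "A \<noteq> {}" using E n by (intro arcs_nonempty) simp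
  have V: "V \<noteq> {}" using ne tail_in_verts by blast
  obtain F where F: "faces t = {F}" using F by (auto simp: card_1_singleton_iff)
  then have "F = A" using Union_faces by simp
  then have face: "orbit \<phi> b = A" if "b \<in> A" for b
    using F that by (auto simp: faces_def)
  have Min: "Min (l ` V) = 1" using wl by (simp add: well_labeled_def)
  show ?thesis
  proof unfold_locales
    show "c \<in> orbit \<phi> b" if "b \<in> A" "c \<in> A" for b c using face that by simp
    show "\<bar>l (tl_of b) - l (hd_of b)\<bar> \<le> 1" if "b \<in> A" for b
      using wl that by (simp add: well_labeled_def)
    show "1 \<le> l v" if "v \<in> V" for v
      using Min_le[of "l ` V" "l v"] that Min by simp
    show "\<exists>v\<in>V. l v = 1" using Min_in[of "l ` V"] V Min by auto
    show "\<exists>b\<in>A. tl_of b = v" if v: "v \<in> V" for v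
    proof -
      obtain a where a: "a \<in> A" using ne by blast
      have "v \<rightarrow>\<^sup>*\<^bsub>graph t\<^esub> tl_of a" using connected_reachable[OF conn v] a by simp
      then show ?thesis
      proof (cases rule: converse_reachable_cases)
        case base
        then show ?thesis using a by auto
      next
        case (step w)
        then show ?thesis by (auto simp: arcs_ends_conv)
      qed
    qed
  qed
qed

lemma opening_onto:
  assumes t: "(t, l) \<in> well_labeled_trees g n" and n: "1 \<le> n"
  shows "\<exists>x\<in>pointed_bipartite_quadrangulations g n. (quad_opening x, (t, l)) \<in> labeled_equiv"
proof -
  interpret t: labeled_contour t l by (rule labeled_contour_tree[OF assms])
  have cards: "card (edges t) = n" "int (card t.V) = int n + 1 - 2 * int g"
    using t by (auto simp: well_labeled_trees_def)
  obtain N :: "(nat, nat) drawing" and p f where N: "drawing_iso p f t.Q N"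
    using drawing_copy[OF t.rotation_system_closing] by blast
  interpret I: drawing_iso_pair p f t.Q N using N by unfold_locales
  have P: "pointed_quadrangulation t.Q None" by (rule t.P.pointed_quadrangulation_axioms)
  interpret N: pointed_quadrangulation N "p None" by (rule pointed_quadrangulation_iso[OF N P])
  have card: "card (faces N) = n" "card (edges N) = 2 * n"
      "int (card (verts (graph N))) = int n + 2 - 2 * int g"
    using I.card_faces I.card_edges I.card_verts t.card_closing cards by simp_all
  have "(N, p None) \<in> pointed_bipartite_quadrangulations g n"
    using card I.N.rotation_system N.connected_q N.card_face_q N.bipartite_q N.root_in
    by (simp add: pointed_bipartite_quadrangulations_def quadrangulation_def map_of_genus_def)
  moreover have "(quad_opening (N, p None), (t, l)) \<in> labeled_equiv"
  proof -
    have iso: "drawing_iso (p \<circ> Some) (f \<circ> (\<lambda>b. t.step (True, b))) t (opening_drawing N (p None))"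
      using drawing_iso_trans[OF t.opening_closing opening_iso(1)[OF N P]] .
    have "\<forall>v\<in>t.V. int (graph_dist N (p None) ((p \<circ> Some) v)) = l v"
      using opening_iso(2)[OF N P] t.label_closing by simp
    then have "((t, l), quad_opening (N, p None)) \<in> labeled_equiv"
      unfolding quad_opening_def case_prod_conv labeled_equiv_iff using iso by blast
    then show ?thesis by (rule symD[OF sym_labeled_equiv])
  qed
  ultimately show ?thesis by blast
qed

lemma opening_equiv_iff:
  assumes x: "x \<in> pointed_bipartite_quadrangulations g n" and y: "y \<in> pointed_bipartite_quadrangulations g n"
    and n: "1 \<le> n"
  shows "(quad_opening x, quad_opening y) \<in> labeled_equiv \<longleftrightarrow> (x, y) \<in> pointed_equiv"
proof -
  obtain q v0 q' v0' where e: "x = (q, v0)" "y = (q', v0')" by (cases x; cases y)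
  have q: "pointed_quadrangulation q v0" and q': "pointed_quadrangulation q' v0'"
    using pointed_quadrangulationI x y e by blast+
  interpret q: pointed_quadrangulation q v0 by (rule q)
  have "0 < card (edges q)" using x e n by (simp add: pointed_bipartite_quadrangulations_def)
  then have ne: "arcs (graph q) \<noteq> {}" by (rule arcs_nonempty)
  show ?thesis
  proof
    assume "(quad_opening x, quad_opening y) \<in> labeled_equiv"
    then obtain p f where f: "drawing_iso p f q.T (opening_drawing q' v0')"
      "\<forall>v\<in>verts (graph q.T). int (graph_dist q' v0' (p v)) = int (graph_dist q v0 v)"
      unfolding e quad_opening_def case_prod_conv labeled_equiv_iff by blast
    then show "(x, y) \<in> pointed_equiv"
      unfolding e pointed_equiv_iff using q.root_in iso_of_opening_iso[OF q q' f(1) _ ne] by simp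
  next
    assume "(x, y) \<in> pointed_equiv"
    then obtain p f where f: "drawing_iso p f q q'" "p v0 = v0'"
      unfolding e pointed_equiv_iff by blast
    show "(quad_opening x, quad_opening y) \<in> labeled_equiv"
      unfolding e quad_opening_def case_prod_conv labeled_equiv_iff
      using opening_iso[OF f(1) q] f(2) by auto
  qed
qed

text \<open>
  Genus, face degrees, colorings and distances are all invariant under isomorphism.
\<close>
lemma pointed_equiv_closed:
  assumes x: "x \<in> pointed_bipartite_quadrangulations g n" and xy: "(x, y) \<in> pointed_equiv"
  shows "y \<in> pointed_bipartite_quadrangulations g n"
    and "card (odd_distance_vertices y) = card (odd_distance_vertices x)"
proof -
  obtain q v0 q' v0' where e: "x = (q, v0)" "y = (q', v0')" by (cases x; cases y)
  obtain p f where f: "drawing_iso p f q q'" "p v0 = v0'"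
    using xy unfolding e pointed_equiv_iff by blast
  interpret q: pointed_quadrangulation q v0 using pointed_quadrangulationI x e by blast
  interpret I: drawing_iso_pair p f q q' using f(1) by unfold_locales
  have x': "quadrangulation g q" "bipartite q" "card (faces q) = n" "card (edges q) = 2 * n"
    "int (card (verts (graph q))) = int n + 2 - 2 * int g"
    using x e by (auto simp: pointed_bipartite_quadrangulations_def)
  show "y \<in> pointed_bipartite_quadrangulations g n"
    using I.quadrangulation_transfer[OF x'(1)] I.bipartite_transfer[OF x'(2)] x'(3-5)
      I.card_faces I.card_edges I.card_verts I.p_in[OF q.root_in] f(2) e
    by (simp add: pointed_bipartite_quadrangulations_def)
  have dist: "graph_dist q' v0' (p v) = graph_dist q v0 v" if "v \<in> q.V" for v
    using I.graph_dist_transfer[OF q.connected_q q.root_in that] f(2) by simp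
  have "odd_distance_vertices y = p ` odd_distance_vertices x"
    using dist by (auto simp: odd_distance_vertices_def e I.p_image[symmetric])
  moreover have "inj_on p (odd_distance_vertices x)"
    using I.bij_p by (auto simp: odd_distance_vertices_def e bij_betw_def intro: inj_on_subset)
  ultimately show "card (odd_distance_vertices y) = card (odd_distance_vertices x)"
    by (simp add: card_image)
qed

lemma card_odd_labels_equiv:
  assumes "(x, y) \<in> labeled_equiv"
  shows "card (odd_label_vertices y) = card (odd_label_vertices x)"
proof -
  obtain M l N k where e: "x = (M, l)" "y = (N, k)" by (cases x; cases y)
  obtain p f where f: "drawing_iso p f M N" "\<forall>v\<in>verts (graph M). k (p v) = l v"
    using assms unfolding e labeled_equiv_iff by blast
  have p: "p ` verts (graph M) = verts (graph N)" "inj_on p (verts (graph M))"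
    using drawing_iso_verts[OF f(1)] by (auto simp: bij_betw_def)
  have "odd_label_vertices y = p ` odd_label_vertices x"
    using f(2) by (auto simp: odd_label_vertices_def e p(1)[symmetric])
  moreover have "inj_on p (odd_label_vertices x)"
    using p(2) by (rule inj_on_subset) (auto simp: odd_label_vertices_def e)
  ultimately show ?thesis by (simp add: card_image)
qed

lemma odd_labels_opening:
  assumes "x \<in> pointed_bipartite_quadrangulations g n"
  shows "odd_label_vertices (quad_opening x) = odd_distance_vertices x"
proof -
  obtain q v0 where e: "x = (q, v0)" by (cases x)
  interpret q: pointed_quadrangulation q v0 using pointed_quadrangulationI assms e by blast
  have "graph_dist q v0 v0 = 0" by (rule q.graph_dist_root[OF q.connected_q q.root_in])
  then show ?thesis
    by (auto simp: e odd_label_vertices_def odd_distance_vertices_def quad_opening_def)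
qed

theorem theorem1:
  fixes g n :: nat
  assumes "n \<ge> 1"
  shows
    "(\<forall>(q, v\<^sub>0) \<in> pointed_bipartite_quadrangulations g n.
        \<forall>t l. quad_opening (q, v\<^sub>0) = (t, l) \<longrightarrow>
          (t, l) \<in> well_labeled_trees g n \<and>
          verts (graph t) = verts (graph q) - {v\<^sub>0} \<and>
          (\<forall>v \<in> verts (graph t). l v = int (graph_dist q v\<^sub>0 v))) \<and>
     (\<forall>x \<in> pointed_bipartite_quadrangulations g n.
        \<forall>y \<in> pointed_bipartite_quadrangulations g n.
          (x, y) \<in> pointed_equiv \<longrightarrow> (quad_opening x, quad_opening y) \<in> labeled_equiv) \<and>
     bij_betw opening_class
       (pointed_bipartite_quadrangulations g n // pointed_equiv)
       (well_labeled_trees g n // labeled_equiv) \<and>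
     (\<forall>i. bij_betw opening_class
       ({x \<in> pointed_bipartite_quadrangulations g n. card (odd_distance_vertices x) = i} // pointed_equiv)
       ({y \<in> well_labeled_trees g n. card (odd_label_vertices y) = i} // labeled_equiv))"
proof -
  let ?X = "pointed_bipartite_quadrangulations g n" and ?Y = "well_labeled_trees g n"
  have maps: "quad_opening x \<in> ?Y" if "x \<in> ?X" for x
    using opening_well_labeled_tree[OF _ assms] that by (cases x) blast
  have reflX: "(x, x) \<in> pointed_equiv" if "x \<in> ?X" for x
    using that pointed_equiv_refl
    by (cases x) (auto simp: pointed_bipartite_quadrangulations_def quadrangulation_def map_of_genus_def)
  have reflY: "(y, y) \<in> labeled_equiv" if "y \<in> ?Y" for y
    using that labeled_equiv_refl
    by (cases y) (auto simp: well_labeled_trees_def g_tree_def map_of_genus_def)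
  have cls: "opening_class = (\<lambda>C. labeled_equiv `` (quad_opening ` C))"
    by (simp add: opening_class_def fun_eq_iff)
  have bij: "bij_betw opening_class ({x \<in> ?X. P (card (odd_distance_vertices x))} // pointed_equiv)
      ({y \<in> ?Y. P (card (odd_label_vertices y))} // labeled_equiv)" for P
    unfolding cls
  proof (rule bij_betw_quotients[OF sym_pointed_equiv trans_pointed_equiv
        sym_labeled_equiv trans_labeled_equiv])
    fix y assume y: "y \<in> {y \<in> ?Y. P (card (odd_label_vertices y))}"
    then show "(y, y) \<in> labeled_equiv" using reflY by simp
    obtain x where x: "x \<in> ?X" "(quad_opening x, y) \<in> labeled_equiv"
      using opening_onto[OF _ assms] y by (cases y) blast
    then show "\<exists>x\<in>{x \<in> ?X. P (card (odd_distance_vertices x))}. (quad_opening x, y) \<in> labeled_equiv"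
      using y card_odd_labels_equiv[OF x(2)] odd_labels_opening[OF x(1)] by (intro bexI[of _ x]) simp_all
  next
    fix x assume x: "x \<in> {x \<in> ?X. P (card (odd_distance_vertices x))}"
    then show "(x, x) \<in> pointed_equiv" using reflX by simp
    show "quad_opening x \<in> {y \<in> ?Y. P (card (odd_label_vertices y))}"
      using x maps[of x] odd_labels_opening[of x g n] by simp
    fix x'
    show "x' \<in> {x \<in> ?X. P (card (odd_distance_vertices x))}" if "(x, x') \<in> pointed_equiv"
      using x pointed_equiv_closed[OF _ that, of g n] by simp
    show "(quad_opening x, quad_opening x') \<in> labeled_equiv \<longleftrightarrow> (x, x') \<in> pointed_equiv"
      if "x' \<in> {x \<in> ?X. P (card (odd_distance_vertices x))}"
      using x that by (intro opening_equiv_iff[of x g n x'] assms) simp_all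
  qed
  have first: "(t, l) \<in> ?Y \<and> verts (graph t) = verts (graph q) - {v\<^sub>0} \<and>
      (\<forall>v\<in>verts (graph t). l v = int (graph_dist q v\<^sub>0 v))"
    if "(q, v\<^sub>0) \<in> ?X" "quad_opening (q, v\<^sub>0) = (t, l)" for q v\<^sub>0 t l
    using maps[OF that(1)] that(2) by (auto simp: quad_opening_def opening_drawing_def)
  have all: "bij_betw opening_class (?X // pointed_equiv) (?Y // labeled_equiv)"
    using bij[of "\<lambda>_. True"] by simp
  show ?thesis
  proof (intro conjI)
    show "\<forall>(q, v\<^sub>0) \<in> ?X. \<forall>t l. quad_opening (q, v\<^sub>0) = (t, l) \<longrightarrow>
        (t, l) \<in> ?Y \<and> verts (graph t) = verts (graph q) - {v\<^sub>0} \<and>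
        (\<forall>v\<in>verts (graph t). l v = int (graph_dist q v\<^sub>0 v))"
      using first by blast
    show "\<forall>x\<in>?X. \<forall>y\<in>?X. (x, y) \<in> pointed_equiv \<longrightarrow> (quad_opening x, quad_opening y) \<in> labeled_equiv"
      using opening_equiv_iff[of _ g n, OF _ _ assms] by blast
    show "\<forall>i. bij_betw opening_class ({x \<in> ?X. card (odd_distance_vertices x) = i} // pointed_equiv)
        ({y \<in> ?Y. card (odd_label_vertices y) = i} // labeled_equiv)"
    proof
      fix i show "bij_betw opening_class ({x \<in> ?X. card (odd_distance_vertices x) = i} // pointed_equiv)
        ({y \<in> ?Y. card (odd_label_vertices y) = i} // labeled_equiv)"
        by (rule bij[of "\<lambda>k. k = i"])
    qed
  qed (rule all)
qed

end
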